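(* Let $1<p<\infty$, $0<\alpha<1/p$, $\theta>0$, and set $q=\frac{p}{1-\alpha p}$. Let $w$ be a weight on $[0,1]$. Then there is a constant $c>0$ such that the inequality $$\|I_\alpha(fw^\alpha)\|_{L_w^{q),\theta(1+\alpha q)}([0,1])}\le c\,\|f\|_{L_w^{p),\theta}([0,1])}$$ holds for all $f\in L_w^{p),\theta}([0,1])$ if and only if $w\in A_{1+q/p'}([0,1])$.
   Context: A weight on $[0,1]$ is an a.e. positive integrable function on $[0,1]$. For $1<r<\infty$, $r'=\frac{r}{r-1}$. $I_\alpha$ is the Riesz potential operator on $[0,1]$: $(I_\alpha f)(x)=\int_0^1\frac{f(y)}{|x-y|^{1-\alpha}}\,dy$, $x\in[0,1]$. For $1<r<\infty$, $\theta>0$ and a weight $w$, the weighted generalized grand Lebesgue space $L_w^{r),\theta}([0,1])$ is the class of measurable $f:[0,1]\to\mathbb{R}$ for which the norm $\|f\|_{L_w^{r),\theta}([0,1])}=\sup_{0<\varepsilon<r-1}\left(\varepsilon^{\theta}\int_0^1|f(t)|^{r-\varepsilon}w(t)\,dt\right)^{1/(r-\varepsilon)}$ is finite. For $1<r<\infty$, a weight $w$ belongs to the Muckenhoupt class $A_r([0,1])$ if $\sup_{J\subset[0,1]}\left(\frac{1}{|J|}\int_J w\right)^{1/r}\left(\frac{1}{|J|}\int_J w^{1-r'}\right)^{1/r'}<\infty$, where the supremum is over all subintervals $J$ of $[0,1]$. *)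

theory Defs
  imports "HOL-Analysis.Analysis"
begin

abbreviation unit_leb :: "real measure" where
  "unit_leb \<equiv> lebesgue_on {0..1}"

definition weight :: "(real \<Rightarrow> real) \<Rightarrow> bool" where
  "weight w \<longleftrightarrow> integrable unit_leb w \<and> (AE x in unit_leb. 0 < w x)"

definition conj_exponent :: "real \<Rightarrow> real" where
  "conj_exponent r = r / (r - 1)"

text \<open>Real powers on \<open>[0, \<infinity>]\<close>, with \<open>\<infinity>\<close> as the power of \<open>\<infinity>\<close>; only used for
  exponents \<open>a > 0\<close>.\<close>

definition ennpowr :: "ennreal \<Rightarrow> real \<Rightarrow> ennreal" where
  "ennpowr x a = (if x = \<infinity> then \<infinity> else ennreal (enn2real x powr a))"

definition grand_norm :: "real \<Rightarrow> real \<Rightarrow> (real \<Rightarrow> real) \<Rightarrow> (real \<Rightarrow> real) \<Rightarrow> ennreal" where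
  "grand_norm r \<theta> w f =
    (SUP \<epsilon>\<in>{0<..<r - 1}.
      ennpowr (ennreal (\<epsilon> powr \<theta>) * (\<integral>\<^sup>+t. ennreal (\<bar>f t\<bar> powr (r - \<epsilon>) * w t) \<partial>unit_leb))
        (1 / (r - \<epsilon>)))"

definition grand_Lebesgue :: "real \<Rightarrow> real \<Rightarrow> (real \<Rightarrow> real) \<Rightarrow> (real \<Rightarrow> real) set" where
  "grand_Lebesgue r \<theta> w = {f \<in> borel_measurable unit_leb. grand_norm r \<theta> w f < \<infinity>}"

definition riesz_potential :: "real \<Rightarrow> (real \<Rightarrow> real) \<Rightarrow> real \<Rightarrow> real" where
  "riesz_potential \<alpha> f x = (LINT y|unit_leb. f y / \<bar>x - y\<bar> powr (1 - \<alpha>))"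

text \<open>The Bochner integral of a non-integrable function is \<open>0\<close>, so that the integral defining the
  Riesz potential exists (as an absolutely convergent integral, for almost every \<open>x\<close>) has to be
  said separately.\<close>

definition riesz_potential_defined :: "real \<Rightarrow> (real \<Rightarrow> real) \<Rightarrow> bool" where
  "riesz_potential_defined \<alpha> f \<longleftrightarrow>
    (AE x in unit_leb. integrable unit_leb (\<lambda>y. f y / \<bar>x - y\<bar> powr (1 - \<alpha>)))"

text \<open>The supremum ranges over the subintervals of positive length. The averages are taken in
  \<open>[0, \<infinity>]\<close>, as \<open>w powr (1 - r')\<close> need not be integrable. For a weight the average of \<open>w\<close>
  over such an interval is positive, so no product \<open>0 * \<infinity>\<close> occurs.\<close>

definition Muckenhoupt :: "real \<Rightarrow> (real \<Rightarrow> real) set" where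
  "Muckenhoupt r = {w. weight w \<and>
    (SUP J\<in>{J. is_interval J \<and> J \<subseteq> {0..1} \<and> 0 < measure lebesgue J}.
      ennpowr (ennreal (1 / measure lebesgue J) * (\<integral>\<^sup>+t. ennreal (w t) \<partial>lebesgue_on J)) (1 / r) *
      ennpowr (ennreal (1 / measure lebesgue J) *
        (\<integral>\<^sup>+t. ennreal (w t powr (1 - conj_exponent r)) \<partial>lebesgue_on J))
        (1 / conj_exponent r)) < \<infinity>}"

end

theory Submission
  imports Defs
begin

text \<open>
  Write \<open>d\<mu> = w dx\<close> and let \<open>1/v = 1/u - \<alpha>\<close>, so that \<open>u = p\<close>
  gives \<open>v = q\<close>. The number \<open>r = 1 + q/p'\<close> is the value at \<open>s = p\<close> of
  \<open>r(s) = 1 + (s - 1)/(1 - \<alpha> s)\<close>.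

  For sufficiency, split \<open>f w\<^sup>\<alpha>\<close> on an interval \<open>I\<close> as \<open>f * w
  powr (1/s)\<close> times \<open>w powr (\<alpha> - 1/s)\<close>. The inequality of Hoelder turns the
  Muckenhoupt condition with exponent \<open>r(s)\<close> into \<open>|I| powr (\<alpha> - 1) *
  \<integral>\<^sub>I f w\<^sup>\<alpha> \<le> C * \<mu>(I) powr \<alpha> * (average of f\<^sup>s over I with
  respect to \<mu>) powr (1/s)\<close> (\<open>Ap_local_estimate\<close>). Summed over intervals around
  \<open>x\<close> whose lengths decrease geometrically, this bounds the Riesz potential by a potential that
  only sees \<open>\<mu>\<close>. The masses of these intervals decrease geometrically as well
  (\<open>Ap_reverse_doubling\<close>), so Hedberg's argument applies: on small intervals the average is at
  most the maximal function of \<open>f\<^sup>s\<close>, on large ones it is controlled by the norm of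
  \<open>f\<close> in \<open>L\<^sup>u(\<mu>)\<close>, and the two geometric series are balanced
  (\<open>Riesz_pointwise_Hedberg\<close>). Integration uses only that the maximal operator of
  \<open>\<mu>\<close> is bounded on the Lebesgue space with exponent \<open>u/s > 1\<close>, which on the
  line holds for every finite measure (\<open>maximal_function_bound\<close>). The result is a bound from
  \<open>L\<^sup>u(\<mu>)\<close> to \<open>L\<^sup>v(\<mu>)\<close> whose constant is uniform for
  \<open>u\<close> in a whole interval \<open>[p0, p]\<close> with \<open>s < p0 < p\<close>
  (\<open>Riesz_strong_type_uniform\<close>).

  The argument needs the condition for some \<open>s < p\<close>, that is, for an exponent below
  \<open>r\<close>. This is the self-improvement of the Muckenhoupt condition
  (\<open>Ap_condition_open\<close>), which follows from a reverse Hoelder inequality for the dual weight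
  (\<open>reverse_Hoelder_of_dense_level_sets\<close>).

  The grand norms are suprema over \<open>\<epsilon> = p - u\<close> and \<open>\<eta> = q - v\<close>. These
  two quantities are comparable, and the power \<open>\<theta> (1 + \<alpha> q)\<close> is exactly the one for
  which the factors depending on \<open>\<eta>\<close> and \<open>\<epsilon>\<close> are comparable too
  (\<open>exponent_comparison\<close>). Small \<open>\<epsilon>\<close> is covered by the uniform estimate;
  large \<open>\<eta>\<close> is harmless because \<open>\<mu>\<close> is finite
  (\<open>grand_inequality_if_Ap_condition\<close>).

  For necessity, the function \<open>f\<close> for which \<open>f w\<^sup>\<alpha>\<close> is the dual weight,
  truncated and restricted to an interval \<open>J\<close>, is inserted into the inequality. The potential is
  bounded below on \<open>J\<close> by a constant, so the grand norm of the indicator of \<open>J\<close>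
  appears on the left; by the inequality of Hoelder the analogous grand norm appears on the right, and the
  comparison of factors cancels both (\<open>truncated_dual_weight_test\<close>).
\<close>

section \<open>Coverings by intervals with bounded overlap\<close>

text \<open>
  A subcover with the least number of members works: of three intervals that share a point, one lies in the
  union of the one reaching furthest left and the one reaching furthest right.
\<close>

lemma finite_interval_cover_overlap_le_2:
  fixes \<F> :: "real set set"
  assumes "finite \<F>" and ivl: "\<And>I. I \<in> \<F> \<Longrightarrow> \<exists>a b. I = {a<..<b}"
  obtains \<G> where "\<G> \<subseteq> \<F>" "\<Union>\<G> = \<Union>\<F>" "\<And>x. card {I \<in> \<G>. x \<in> I} \<le> 2"
proof -
  define P where "P \<G> \<longleftrightarrow> \<G> \<subseteq> \<F> \<and> \<Union>\<G> = \<Union>\<F>" for \<G>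
  have "P \<F>" by (auto simp: P_def)
  then obtain \<G> where G: "P \<G>" and min: "\<And>\<H>. P \<H> \<Longrightarrow> card \<G> \<le> card \<H>"
    using ex_has_least_nat[of P \<F> card] by blast
  have fin: "finite \<G>" using G \<open>finite \<F>\<close> by (auto simp: P_def intro: finite_subset)
  obtain a b :: "real set \<Rightarrow> real" where ab: "\<And>I. I \<in> \<F> \<Longrightarrow> I = {a I<..<b I}"
    using ivl by metis
  have "card {I \<in> \<G>. x \<in> I} \<le> 2" for x
  proof (rule ccontr)
    define C where "C = {I \<in> \<G>. x \<in> I}"
    assume "\<not> card {I \<in> \<G>. x \<in> I} \<le> 2"
    then have c3: "card C > 2" by (simp add: C_def)
    then have C: "finite C" "C \<noteq> {}" using fin by (simp add: C_def) (use c3 in force)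
    obtain i where i: "i \<in> C" "\<And>I. I \<in> C \<Longrightarrow> a i \<le> a I"
      using ex_is_arg_min_if_finite[OF C, of a] by (auto simp: is_arg_min_linorder)
    obtain j where j: "j \<in> C" "\<And>I. I \<in> C \<Longrightarrow> - b j \<le> - b I"
      using ex_is_arg_min_if_finite[OF C, of "\<lambda>I. - b I"] by (auto simp: is_arg_min_linorder)
    have "card {i, j} \<le> 2" by (simp add: card_insert_if)
    then have "\<not> C \<subseteq> {i, j}" using c3 card_mono[of "{i,j}" C] by auto
    then obtain k where k: "k \<in> C" "k \<noteq> i" "k \<noteq> j" by auto
    have inF: "I \<in> \<F>" if "I \<in> C" for I using that G by (auto simp: C_def P_def)
    have "k \<subseteq> i \<union> j"
    proof
      fix y assume "y \<in> k"
      then have "a k < y" "y < b k" using ab[OF inF[OF k(1)]] by auto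
      moreover have "x \<in> i" "x \<in> j" using i j by (auto simp: C_def)
      then have "x < b i" "a j < x" using ab[OF inF[OF i(1)]] ab[OF inF[OF j(1)]] by auto
      ultimately have "y \<in> {a i<..<b i} \<or> y \<in> {a j<..<b j}" using i(2)[OF k(1)] j(2)[OF k(1)] by auto
      then show "y \<in> i \<union> j" using ab[OF inF[OF i(1)]] ab[OF inF[OF j(1)]] by auto
    qed
    moreover have ijk: "i \<in> \<G>" "j \<in> \<G>" "k \<in> \<G>" using i j k by (auto simp: C_def)
    ultimately have "\<Union>(\<G> - {k}) = \<Union>\<G>" using k(2,3) by blast
    then have "P (\<G> - {k})" using G by (auto simp: P_def)
    from min[OF this] show False using fin ijk(3)
      by (metis card_Diff1_less not_less)
  qed
  then show ?thesis using that[of \<G>] G by (auto simp: P_def)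
qed

text \<open>
  An inequality between two measures on the members of a family of intervals passes to the union at the price
  of a factor 2. This is the only covering argument of the development: it gives the weak type bound for
  maximal operators of arbitrary measures, where no doubling property is at hand, as well as the estimates of
  level sets below.
\<close>

lemma emeasure_Union_intervals_le:
  fixes M N :: "real measure"
  assumes M: "sets borel \<subseteq> sets M" and N: "sets borel \<subseteq> sets N"
    and ivl: "\<And>I. I \<in> \<F> \<Longrightarrow> \<exists>a b. I = {a<..<b}"
    and le: "\<And>I. I \<in> \<F> \<Longrightarrow> emeasure M I \<le> emeasure N I"
  shows "emeasure M (\<Union>\<F>) \<le> 2 * emeasure N (\<Union>\<F>)"
proof -
  have op: "open I" if "I \<in> \<F>" for I using ivl[OF that] by auto
  have fin: "emeasure M (\<Union>\<F>') \<le> 2 * emeasure N (\<Union>\<F>)" if F': "finite \<F>'" "\<F>' \<subseteq> \<F>" for \<F>'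
  proof -
    obtain \<G> where G: "\<G> \<subseteq> \<F>'" "\<Union>\<G> = \<Union>\<F>'" "\<And>x. card {I \<in> \<G>. x \<in> I} \<le> 2"
      using finite_interval_cover_overlap_le_2[of \<F>'] F' ivl by (metis subsetD)
    have fG: "finite \<G>" using G(1) F'(1) finite_subset by blast
    have openG: "open I" if "I \<in> \<G>" for I using that op G(1) F'(2) by auto
    have sM: "I \<in> sets M" and sN: "I \<in> sets N" if "I \<in> \<G>" for I
      using openG[OF that] M N by auto
    have sU: "\<Union>\<G> \<in> sets N" using openG N by (meson borel_open open_Union subsetD)
    have "emeasure M (\<Union>\<F>') = emeasure M (\<Union>I\<in>\<G>. I)" using G(2) by simp
    also have "\<dots> \<le> (\<Sum>I\<in>\<G>. emeasure M I)"
      by (rule emeasure_subadditive_finite) (use fG sM in auto)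
    also have "\<dots> \<le> (\<Sum>I\<in>\<G>. emeasure N I)"
      by (rule sum_mono) (use le G(1) F'(2) in auto)
    also have "\<dots> = (\<Sum>I\<in>\<G>. \<integral>\<^sup>+x. indicator I x \<partial>N)"
      by (intro sum.cong refl) (simp add: sN)
    also have "\<dots> = (\<integral>\<^sup>+x. (\<Sum>I\<in>\<G>. indicator I x) \<partial>N)"
      by (rule nn_integral_sum[symmetric]) (use sN in auto)
    also have "\<dots> \<le> (\<integral>\<^sup>+x. 2 * indicator (\<Union>\<G>) x \<partial>N)"
    proof (rule nn_integral_mono)
      fix x
      have "(\<Sum>I\<in>\<G>. indicator I x :: ennreal) = of_nat (card {I\<in>\<G>. x \<in> I})"
        using fG by (simp add: indicator_def sum.If_cases Int_def)
      also have "\<dots> \<le> 2 * indicator (\<Union>\<G>) x"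
      proof (cases "x \<in> \<Union>\<G>")
        case True
        have "(of_nat (card {I\<in>\<G>. x \<in> I}) :: ennreal) \<le> of_nat 2" using G(3)[of x] of_nat_mono by blast
        then show ?thesis using True by simp
      next
        case False
        then have e: "{I\<in>\<G>. x \<in> I} = {}" by auto
        show ?thesis unfolding e by simp
      qed
      finally show "(\<Sum>I\<in>\<G>. indicator I x :: ennreal) \<le> 2 * indicator (\<Union>\<G>) x" .
    qed
    also have "\<dots> = 2 * emeasure N (\<Union>\<G>)" using sU by (simp add: nn_integral_cmult)
    also have "\<dots> \<le> 2 * emeasure N (\<Union>\<F>)"
      by (intro mult_left_mono emeasure_mono) (use G F'(2) N op in \<open>auto intro!: subsetD[OF N] borel_open\<close>)
    finally show ?thesis .
  qed
  obtain \<F>' where F': "\<F>' \<subseteq> \<F>" "countable \<F>'" "\<Union>\<F>' = \<Union>\<F>"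
    using Lindelof[of \<F>] op by blast
  show ?thesis
  proof (cases "\<F>' = {}")
    case True
    then have e: "\<Union>\<F> = {}" using F'(3) by simp
    show ?thesis unfolding e by simp
  next
    case False
    define A where "A n = \<Union>(from_nat_into \<F>' ` {..n::nat})" for n
    have rng: "range (from_nat_into \<F>') = \<F>'" using False F'(2) by (rule range_from_nat_into)
    have sub: "from_nat_into \<F>' ` {..n} \<subseteq> \<F>" for n using rng F'(1) by blast
    have "open (A n)" for n unfolding A_def using sub op by (intro open_Union) blast
    then have A: "range A \<subseteq> sets M" using M by auto
    have inc: "incseq A" unfolding A_def incseq_def by (intro allI impI Union_mono image_mono) auto
    have "(\<Union>n. A n) = \<Union>(range (from_nat_into \<F>'))" unfolding A_def by blast
    then have "(\<Union>n. A n) = \<Union>\<F>" using rng F'(3) by simp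
    then have "emeasure M (\<Union>\<F>) = (SUP n. emeasure M (A n))" using SUP_emeasure_incseq[OF A inc] by simp
    also have "\<dots> \<le> 2 * emeasure N (\<Union>\<F>)"
      by (rule SUP_least) (unfold A_def, rule fin, use sub in auto)
    finally show ?thesis .
  qed
qed

section \<open>Layer-cake formula and the inequality of Hoelder\<close>

lemma nn_integral_powr_Icc:
  fixes k a :: real
  assumes "k > 0" "a \<ge> 0"
  shows "(\<integral>\<^sup>+t. ennreal (k * t powr (k - 1)) * indicator {0<..<a} t \<partial>lborel) = ennreal (a powr k)"
proof -
  have "((\<lambda>x. x powr (k-1)) has_integral (a powr (k-1+1) / (k-1+1))) {0..a}"
    using assms by (intro has_integral_powr_from_0) auto
  then have "((\<lambda>x. k * x powr (k-1)) has_integral (k * (a powr k / k))) {0..a}"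
    by (intro has_integral_mult_right) auto
  then have "((\<lambda>x. k * x powr (k-1)) has_integral (a powr k)) {0..a}" using assms by simp
  then have "((\<lambda>x. k * x powr (k-1)) has_integral (a powr k)) {0<..<a}"
    by (simp add: has_integral_Icc_iff_Ioo)
  then have "integral\<^sup>N lborel (\<lambda>x. indicator {0<..<a} x * (k * x powr (k-1))) = ennreal (a powr k)"
    using assms by (intro nn_integral_has_integral_lebesgue) auto
  moreover have "ennreal (k * t powr (k - 1)) * indicator {0<..<a} t = ennreal (indicator {0<..<a} t * (k * t powr (k-1)))" for t
    by (auto simp: indicator_def)
  ultimately show ?thesis by simp
qed

text \<open>
  Tonelli applied to the representation of \<open>h powr k\<close> as the integral of \<open>k * t powr (k -
  1)\<close> over \<open>0 < t < h\<close>.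
\<close>

lemma nn_integral_layer_cake:
  fixes h :: "'a \<Rightarrow> real"
  assumes "sigma_finite_measure M" and [measurable]: "h \<in> borel_measurable M"
    and h: "\<And>x. x \<in> space M \<Longrightarrow> 0 \<le> h x" and k: "k > 0"
  shows "(\<integral>\<^sup>+x. ennreal (h x powr k) \<partial>M) =
    (\<integral>\<^sup>+t. ennreal (k * t powr (k - 1)) * indicator {0<..} t * emeasure M {x \<in> space M. t < h x} \<partial>lborel)"
proof -
  interpret M: sigma_finite_measure M by fact
  interpret P: pair_sigma_finite lborel M by unfold_locales
  have "(\<integral>\<^sup>+x. ennreal (h x powr k) \<partial>M) =
    (\<integral>\<^sup>+x. (\<integral>\<^sup>+t. ennreal (k * t powr (k - 1)) * indicator {0<..<h x} t \<partial>lborel) \<partial>M)"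
    using h k by (intro nn_integral_cong) (simp add: nn_integral_powr_Icc)
  also have "\<dots> = (\<integral>\<^sup>+x. (\<integral>\<^sup>+t. ennreal (k * t powr (k - 1)) * (if 0 < t \<and> t < h x then 1 else 0) \<partial>lborel) \<partial>M)"
    by (intro nn_integral_cong) (auto simp: indicator_def)
  also have "\<dots> = (\<integral>\<^sup>+t. (\<integral>\<^sup>+x. ennreal (k * t powr (k - 1)) * (if 0 < t \<and> t < h x then 1 else 0) \<partial>M) \<partial>lborel)"
    by (rule P.Fubini') measurable
  also have "\<dots> = (\<integral>\<^sup>+t. ennreal (k * t powr (k - 1)) * indicator {0<..} t * emeasure M {x \<in> space M. t < h x} \<partial>lborel)"
  proof (intro nn_integral_cong)
    fix t :: real
    have "(\<integral>\<^sup>+x. ennreal (k * t powr (k - 1)) * (if 0 < t \<and> t < h x then 1 else 0) \<partial>M)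
      = (\<integral>\<^sup>+x. ennreal (k * t powr (k - 1)) * indicator {0<..} t * indicator {x \<in> space M. t < h x} x \<partial>M)"
      by (intro nn_integral_cong) (auto simp: indicator_def)
    also have "\<dots> = ennreal (k * t powr (k - 1)) * indicator {0<..} t * emeasure M {x \<in> space M. t < h x}"
      by (subst nn_integral_cmult) auto
    finally show "(\<integral>\<^sup>+x. ennreal (k * t powr (k - 1)) * (if 0 < t \<and> t < h x then 1 else 0) \<partial>M) = \<dots>" .
  qed
  finally show ?thesis .
qed

text \<open>
  Formulated with upper bounds \<open>A\<close> and \<open>B\<close> in place of the integrals, which keeps
  the right-hand side real and avoids the products \<open>0 * \<infinity>\<close>.
\<close>

lemma nn_integral_Hoelder:
  fixes u v :: "'a \<Rightarrow> real"
  assumes [measurable]: "u \<in> borel_measurable M" "v \<in> borel_measurable M"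
    and pos: "\<And>x. x \<in> space M \<Longrightarrow> 0 \<le> u x" "\<And>x. x \<in> space M \<Longrightarrow> 0 \<le> v x"
    and ab: "1 < a" "1 < b" "1 / a + 1 / b = 1" and AB: "0 < A" "0 < B"
    and u: "(\<integral>\<^sup>+x. ennreal (u x powr a) \<partial>M) \<le> ennreal A"
    and v: "(\<integral>\<^sup>+x. ennreal (v x powr b) \<partial>M) \<le> ennreal B"
  shows "(\<integral>\<^sup>+x. ennreal (u x * v x) \<partial>M) \<le> ennreal (A powr (1/a) * B powr (1/b))"
proof -
  \<comment> \<open>Young's inequality is applied to \<open>u\<close> and \<open>v\<close> divided by the bounds for their norms.\<close>
  define K where "K = A powr (1/a) * B powr (1/b)"
  have K: "K > 0" using AB by (simp add: K_def)
  have *: "u x * v x \<le> (K / (a * A)) * u x powr a + (K / (b * B)) * v x powr b" if "x \<in> space M" for x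
  proof -
    have "(u x / A powr (1/a)) * (v x / B powr (1/b)) \<le>
       (u x / A powr (1/a)) powr a / a + (v x / B powr (1/b)) powr b / b"
      using ab AB pos[OF that] by (intro Youngs_inequality) auto
    also have "\<dots> = u x powr a / (a * A) + v x powr b / (b * B)"
      using ab AB pos[OF that] by (simp add: powr_divide powr_powr mult.commute)
    finally have "K * ((u x / A powr (1/a)) * (v x / B powr (1/b))) \<le> K * (u x powr a / (a * A) + v x powr b / (b * B))"
      using K by (intro mult_left_mono) auto
    moreover have "K * ((u x / A powr (1/a)) * (v x / B powr (1/b))) = u x * v x"
      using AB by (simp add: K_def)
    ultimately show ?thesis by (simp add: algebra_simps)
  qed
  have "(\<integral>\<^sup>+x. ennreal (u x * v x) \<partial>M) \<le>
     (\<integral>\<^sup>+x. ennreal (K / (a * A)) * ennreal (u x powr a) + ennreal (K / (b * B)) * ennreal (v x powr b) \<partial>M)"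
    using * ab AB K by (intro nn_integral_mono) (simp flip: ennreal_mult ennreal_plus)
  also have "\<dots> = ennreal (K / (a * A)) * (\<integral>\<^sup>+x. ennreal (u x powr a) \<partial>M) +
       ennreal (K / (b * B)) * (\<integral>\<^sup>+x. ennreal (v x powr b) \<partial>M)"
    by (subst nn_integral_add) (auto simp: nn_integral_cmult)
  also have "\<dots> \<le> ennreal (K / (a * A)) * ennreal A + ennreal (K / (b * B)) * ennreal B"
    by (intro add_mono mult_left_mono u v) auto
  also have "\<dots> = ennreal (K / (a * A) * A + K / (b * B) * B)"
    using ab AB K by (simp flip: ennreal_mult ennreal_plus)
  also have "K / (a * A) * A + K / (b * B) * B = K * (1 / a + 1 / b)"
    using AB by (simp add: field_simps)
  finally show ?thesis using ab K_def by simp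
qed

section \<open>The maximal operator of a finite measure on the line\<close>

text \<open>
  The set where the uncentered maximal function of \<open>g\<close> with respect to \<open>M\<close> exceeds
  \<open>t\<close>. Multiplying out avoids averages over intervals of measure zero.
\<close>

definition maximal_set :: "real measure \<Rightarrow> (real \<Rightarrow> real) \<Rightarrow> real \<Rightarrow> real set" where
  "maximal_set M g t = \<Union>{I. (\<exists>a b. I = {a<..<b}) \<and>
     ennreal t * emeasure M I < (\<integral>\<^sup>+x\<in>I. ennreal (g x) \<partial>M)}"

lemma open_maximal_set: "open (maximal_set M g t)"
  unfolding maximal_set_def by (intro open_Union) auto

lemma maximal_set_antimono: "s \<le> t \<Longrightarrow> maximal_set M g t \<subseteq> maximal_set M g s"
  unfolding maximal_set_def
  by (intro Union_mono Collect_mono) (auto intro: le_less_trans[OF mult_right_mono[OF ennreal_leI]])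

text \<open>
  On an interval on which the average of \<open>g\<close> exceeds \<open>t\<close>, the part of
  \<open>g\<close> below \<open>t/2\<close> accounts for at most half of that average. Hence only the values
  of \<open>g\<close> above \<open>t/2\<close> enter, which is what makes the weak type bound integrable in
  \<open>t\<close>.
\<close>

lemma emeasure_maximal_set_le:
  fixes g :: "real \<Rightarrow> real"
  assumes "finite_measure M" and M: "sets M = sets lebesgue"
    and g [measurable]: "g \<in> borel_measurable M" and t: "t > 0"
  shows "ennreal t * emeasure M (maximal_set M g t) \<le> 4 * (\<integral>\<^sup>+x\<in>{x. t < 2 * g x}. ennreal (g x) \<partial>M)"
proof -
  interpret finite_measure M by fact
  have spM: "space M = UNIV" using sets_eq_imp_space_eq[OF M] by simp
  define A where "A = {x. t < 2 * g x}"
  have A [measurable]: "A \<in> sets M"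
  proof -
    have "{x \<in> space M. t < 2 * g x} \<in> sets M" by measurable
    then show ?thesis by (simp add: A_def spM)
  qed
  have bor: "S \<in> sets borel \<Longrightarrow> S \<in> sets M" for S using M by auto
  define K where "K = density M (\<lambda>_. ennreal (t/2))"
  define N where "N = density M (\<lambda>x. ennreal (g x) * indicator A x)"
  define F where "F = {I. (\<exists>a b. I = {a<..<b}) \<and>
     ennreal t * emeasure M I < (\<integral>\<^sup>+x\<in>I. ennreal (g x) \<partial>M)}"
  have KI: "emeasure K S = ennreal (t/2) * emeasure M S" if "S \<in> sets M" for S
    using that by (simp add: K_def emeasure_density nn_integral_cmult)
  have NI: "emeasure N S = (\<integral>\<^sup>+x. ennreal (g x) * indicator A x * indicator S x \<partial>M)" if "S \<in> sets M" for S
    using that by (simp add: N_def emeasure_density)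
  have "emeasure K (\<Union>F) \<le> 2 * emeasure N (\<Union>F)"
  proof (rule emeasure_Union_intervals_le)
    show "sets borel \<subseteq> sets K" "sets borel \<subseteq> sets N" using bor by (auto simp: K_def N_def)
    fix I assume I: "I \<in> F"
    then show "\<exists>a b. I = {a<..<b}" by (auto simp: F_def)
    then have [measurable]: "I \<in> sets M" using bor by auto
    have "ennreal (t/2) * emeasure M I + ennreal (t/2) * emeasure M I = ennreal t * emeasure M I"
      using t by (simp flip: distrib_right ennreal_plus)
    also have "\<dots> \<le> (\<integral>\<^sup>+x\<in>I. ennreal (g x) \<partial>M)" using I by (auto simp: F_def)
    also have "\<dots> \<le> (\<integral>\<^sup>+x. ennreal (t/2) * indicator I x + ennreal (g x) * indicator A x * indicator I x \<partial>M)"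
      using t by (intro nn_integral_mono) (auto simp: A_def indicator_def intro!: ennreal_leI)
    also have "\<dots> = ennreal (t/2) * emeasure M I + emeasure N I"
      by (subst nn_integral_add) (auto simp: nn_integral_cmult NI)
    finally have "ennreal (t/2) * emeasure M I \<le> emeasure N I"
      by (rule ennreal_add_left_cancel_le[THEN iffD1, THEN disjE])
         (auto simp: ennreal_mult_eq_top_iff emeasure_eq_measure)
    then show "emeasure K I \<le> emeasure N I" by (simp add: KI)
  qed
  moreover have U: "\<Union>F = maximal_set M g t" by (simp add: F_def maximal_set_def)
  moreover have S: "maximal_set M g t \<in> sets M" using open_maximal_set bor by auto
  ultimately have "ennreal (t/2) * emeasure M (maximal_set M g t) \<le> 2 * emeasure N (maximal_set M g t)"
    by (simp add: KI)
  also have "emeasure N (maximal_set M g t) \<le> (\<integral>\<^sup>+x\<in>A. ennreal (g x) \<partial>M)"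
    unfolding NI[OF S] by (intro nn_integral_mono) (auto simp: indicator_def)
  finally have "ennreal (t/2) * emeasure M (maximal_set M g t) \<le> 2 * (\<integral>\<^sup>+x\<in>A. ennreal (g x) \<partial>M)"
    by (simp add: mult_left_mono)
  then have "ennreal 2 * (ennreal (t/2) * emeasure M (maximal_set M g t)) \<le>
     ennreal 2 * (2 * (\<integral>\<^sup>+x\<in>A. ennreal (g x) \<partial>M))" by (rule mult_left_mono) simp
  moreover have "ennreal 2 * (ennreal (t/2) * emeasure M (maximal_set M g t)) = ennreal t * emeasure M (maximal_set M g t)"
    using t by (simp add: mult.assoc[symmetric] flip: ennreal_mult ennreal_numeral)
  moreover have "ennreal 2 * (2 * (\<integral>\<^sup>+x\<in>A. ennreal (g x) \<partial>M)) = 4 * (\<integral>\<^sup>+x\<in>A. ennreal (g x) \<partial>M)"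
    by (simp add: mult.assoc[symmetric])
  ultimately show ?thesis by (simp add: A_def)
qed

text \<open>
  The maximal theorem, by integrating the weak type bound over \<open>t\<close> and applying the layer-cake
  formula a second time to the measure with density \<open>g\<close>. The maximal function is represented by a
  real function \<open>h\<close>, which dominates all averages almost everywhere.
\<close>

lemma maximal_function_bound:
  fixes g :: "real \<Rightarrow> real"
  assumes fm: "finite_measure M" and M: "sets M = sets lebesgue"
    and g [measurable]: "g \<in> borel_measurable M" and pos: "\<And>x. 0 \<le> g x" and k: "k > 1"
    and fin: "(\<integral>\<^sup>+x. ennreal (g x powr k) \<partial>M) < \<infinity>"
  obtains h where "h \<in> borel_measurable M" "\<And>x. 0 \<le> h x"
    "AE x in M. \<forall>a b. a < x \<and> x < b \<longrightarrow>
       (\<integral>\<^sup>+y\<in>{a<..<b}. ennreal (g y) \<partial>M) \<le> ennreal (h x) * emeasure M {a<..<b}"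
    "(\<integral>\<^sup>+x. ennreal (h x powr k) \<partial>M) \<le>
       ennreal (4 * k * 2 powr (k - 1) / (k - 1)) * (\<integral>\<^sup>+x. ennreal (g x powr k) \<partial>M)"
proof -
  interpret finite_measure M by fact
  have spM: "space M = UNIV" using sets_eq_imp_space_eq[OF M] by simp
  have bor: "S \<in> sets borel \<Longrightarrow> S \<in> sets M" for S using M by auto
  have G_sets: "maximal_set M g t \<in> sets M" for t using open_maximal_set bor by auto
  \<comment> \<open>As a supremum over open level sets, \<open>H\<close> is lower semicontinuous and therefore measurable.\<close>
  define H where "H x = (SUP t\<in>{t. 0 \<le> t \<and> x \<in> maximal_set M g t}. ennreal t)" for x
  have H_iff: "y < H x \<longleftrightarrow> (\<exists>t\<ge>0. x \<in> maximal_set M g t \<and> y < ennreal t)" for x y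
    by (auto simp: H_def less_SUP_iff)
  have H_meas [measurable]: "H \<in> borel_measurable M"
  proof (rule borel_measurableI_greater)
    fix y
    have "{x \<in> space M. y < H x} = (\<Union>t\<in>{t. 0 \<le> t \<and> y < ennreal t}. maximal_set M g t)"
      by (auto simp: H_iff spM)
    moreover have "open \<dots>" using open_maximal_set by blast
    ultimately show "{x \<in> space M. y < H x} \<in> sets M" using bor by auto
  qed
  define h where "h x = enn2real (H x)" for x
  have h_meas [measurable]: "h \<in> borel_measurable M" unfolding h_def by measurable
  have int_g: "(\<integral>\<^sup>+x. ennreal (g x) \<partial>M) < \<infinity>"
  proof -
    have "g x \<le> 1 + g x powr k" for x
    proof (cases "g x \<le> 1")
      case True then show ?thesis by (rule order_trans) simp
    next
      case False
      then have "g x powr 1 \<le> g x powr k" using k by (intro powr_mono) auto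
      then show ?thesis using False by simp
    qed
    then have "(\<integral>\<^sup>+x. ennreal (g x) \<partial>M) \<le> (\<integral>\<^sup>+x. 1 + ennreal (g x powr k) \<partial>M)"
      by (intro nn_integral_mono) (metis ennreal_1 ennreal_leI ennreal_plus powr_ge_zero zero_le_one)
    also have "\<dots> = emeasure M (space M) + (\<integral>\<^sup>+x. ennreal (g x powr k) \<partial>M)"
      by (subst nn_integral_add) auto
    also have "\<dots> < \<infinity>" using fin by (simp add: emeasure_eq_measure ennreal_add_less_top)
    finally show ?thesis .
  qed
  have "AE x in M. H x < \<infinity>"
  proof -
    define B where "B = {x \<in> space M. H x = \<infinity>}"
    have B [measurable]: "B \<in> sets M" unfolding B_def by measurable
    obtain I where I: "(\<integral>\<^sup>+x. ennreal (g x) \<partial>M) = ennreal I" "I \<ge> 0"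
      using int_g by (cases "\<integral>\<^sup>+x. ennreal (g x) \<partial>M") auto
    have *: "t * measure M B \<le> 4 * I" if "t > 0" for t
    proof -
      have "B \<subseteq> maximal_set M g t"
      proof
        fix x assume "x \<in> B"
        then have "ennreal t < H x" by (simp add: B_def)
        then obtain t' where t': "t' \<ge> 0" "x \<in> maximal_set M g t'" "ennreal t < ennreal t'" by (auto simp: H_iff)
        then have "t \<le> t'" using that by (simp add: ennreal_less_iff)
        then show "x \<in> maximal_set M g t" using t'(2) maximal_set_antimono by blast
      qed
      then have "ennreal t * emeasure M B \<le> ennreal t * emeasure M (maximal_set M g t)"
        using G_sets by (intro mult_left_mono emeasure_mono) auto
      also have "\<dots> \<le> 4 * (\<integral>\<^sup>+x\<in>{x. t < 2 * g x}. ennreal (g x) \<partial>M)"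
        by (rule emeasure_maximal_set_le[OF fm M g that])
      also have "\<dots> \<le> 4 * (\<integral>\<^sup>+x. ennreal (g x) \<partial>M)"
        by (intro mult_left_mono nn_integral_mono) (auto simp: indicator_def)
      also have "\<dots> = ennreal (4 * I)" using I by (simp add: ennreal_mult)
      finally show ?thesis using that I
        by (simp add: emeasure_eq_measure flip: ennreal_mult)
    qed
    have "measure M B = 0"
    proof (rule ccontr)
      assume "measure M B \<noteq> 0"
      then have p: "measure M B > 0" by (simp add: zero_less_measure_iff)
      have "(4 * I + 1) / measure M B * measure M B \<le> 4 * I"
        using p I by (intro *) (auto intro!: divide_pos_pos)
      then show False using p by simp
    qed
    then have "emeasure M B = 0" by (simp add: emeasure_eq_measure)
    then have "AE x in M. x \<notin> B" by (intro AE_not_in) (auto simp: null_sets_def)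
    then show ?thesis by (auto simp: B_def spM less_top)
  qed
  then have AE: "AE x in M. \<forall>a b. a < x \<and> x < b \<longrightarrow>
       (\<integral>\<^sup>+y\<in>{a<..<b}. ennreal (g y) \<partial>M) \<le> ennreal (h x) * emeasure M {a<..<b}"
  proof eventually_elim
    case (elim x)
    show ?case
    proof (intro allI impI, rule ccontr)
      fix a b assume x: "a < x \<and> x < b"
      let ?m = "measure M {a<..<b}" and ?G = "\<integral>\<^sup>+y\<in>{a<..<b}. ennreal (g y) \<partial>M"
      assume "\<not> ?G \<le> ennreal (h x) * emeasure M {a<..<b}"
      then have less: "ennreal (h x * ?m) < ?G"
        by (simp add: emeasure_eq_measure ennreal_mult h_def)
      have "?G \<le> (\<integral>\<^sup>+y. ennreal (g y) \<partial>M)" by (intro nn_integral_mono) (auto simp: indicator_def)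
      then have "?G < \<infinity>" using int_g by simp
      then obtain G where G: "?G = ennreal G" "G \<ge> 0" by (cases ?G) auto
      then have "h x * ?m < G" using less by (simp add: ennreal_less_iff h_def)
      \<comment> \<open>If an average over an interval around \<open>x\<close> exceeded \<open>h x\<close>, it would also exceed some
           \<open>t > h x\<close>, and \<open>x\<close> would lie in the maximal set at height \<open>t\<close>.\<close>
      moreover define t where "t = h x + (G - h x * ?m) / (2 * (?m + 1))"
      ultimately have t: "t > h x" by (simp add: t_def add_nonneg_pos)
      have t0: "t \<ge> 0" using t enn2real_nonneg[of "H x"] unfolding h_def by linarith
      have "t * ?m = h x * ?m + (G - h x * ?m) / 2 * (?m / (?m + 1))"
        by (simp add: t_def field_simps)
      also have "\<dots> \<le> h x * ?m + (G - h x * ?m) / 2 * 1"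
      proof (intro add_left_mono mult_left_mono)
        have "0 < ?m + 1" by (simp add: add_nonneg_pos)
        then show "?m / (?m + 1) \<le> 1" by (subst divide_le_eq_1_pos) auto
      qed (use \<open>h x * ?m < G\<close> in auto)
      also have "\<dots> < G" using \<open>h x * ?m < G\<close> by (simp add: field_simps)
      finally have "ennreal t * emeasure M {a<..<b} < ?G"
        using G t0 by (simp add: emeasure_eq_measure ennreal_less_iff flip: ennreal_mult'')
      then have "x \<in> maximal_set M g t" using x unfolding maximal_set_def by (intro UnionI[of "{a<..<b}"]) auto
      then have "ennreal t \<le> H x" using t0 unfolding H_def by (intro SUP_upper) auto
      also have "H x = ennreal (h x)" using elim by (simp add: h_def)
      finally show False using t by (simp add: h_def)
    qed
  qed
  define N where "N = density M (\<lambda>x. ennreal (g x))"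
  have N: "sigma_finite_measure N"
  proof -
    have "emeasure N (space N) = (\<integral>\<^sup>+x. ennreal (g x) \<partial>M)"
      using emeasure_density[of "\<lambda>x. ennreal (g x)" M, OF _ sets.top] by (simp add: N_def spM)
    then have "finite_measure N" using int_g by (intro finite_measureI) simp
    then show ?thesis by (rule finite_measure.axioms(1))
  qed
  have layer: "ennreal (k * t powr (k - 1)) * indicator {0<..} t * emeasure M {x \<in> space M. t < h x}
     \<le> ennreal (4 * k / (k - 1)) * (ennreal ((k-1) * t powr (k - 1 - 1)) * indicator {0<..} t * emeasure N {x \<in> space N. t < 2 * g x})" for t
  proof (cases "t > 0")
    case True
    have sub: "{x \<in> space M. t < h x} \<subseteq> maximal_set M g t"
    proof
      fix x assume "x \<in> {x \<in> space M. t < h x}"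
      then have "t < enn2real (H x)" by (simp add: h_def)
      then have "ennreal t < H x" using True by (cases "H x") (auto simp: ennreal_less_iff)
      then obtain t' where t': "t' \<ge> 0" "x \<in> maximal_set M g t'" "ennreal t < ennreal t'" by (auto simp: H_iff)
      then have "t \<le> t'" using True by (simp add: ennreal_less_iff)
      then show "x \<in> maximal_set M g t" using t'(2) maximal_set_antimono by blast
    qed
    have "emeasure N {x \<in> space N. t < 2 * g x} = (\<integral>\<^sup>+x\<in>{x. t < 2 * g x}. ennreal (g x) \<partial>M)"
    proof -
      have "{x \<in> space M. t < 2 * g x} \<in> sets M" by measurable
      then show ?thesis by (simp add: N_def emeasure_density spM)
    qed
    then have le: "ennreal t * emeasure M {x \<in> space M. t < h x} \<le> 4 * emeasure N {x \<in> space N. t < 2 * g x}"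
      using order_trans[OF mult_left_mono[OF emeasure_mono[OF sub G_sets] zero_le] emeasure_maximal_set_le[OF fm M g True]]
      by simp
    have eq1: "k * t powr (k - 1) = (k * t powr (k - 2)) * t"
      using True powr_add[of t "k-2" 1] by simp
    have "ennreal (k * t powr (k - 1)) * emeasure M {x \<in> space M. t < h x}
       = ennreal (k * t powr (k - 2)) * (ennreal t * emeasure M {x \<in> space M. t < h x})"
      unfolding eq1 using k True by (simp add: ennreal_mult'' mult.assoc)
    also have "\<dots> \<le> ennreal (k * t powr (k - 2)) * (4 * emeasure N {x \<in> space N. t < 2 * g x})"
      by (intro mult_left_mono le) auto
    also have "\<dots> = ennreal (k * t powr (k - 2)) * ennreal 4 * emeasure N {x \<in> space N. t < 2 * g x}"
      by (simp add: mult.assoc)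
    also have "ennreal (k * t powr (k - 2)) * ennreal 4 = ennreal (4 * k / (k - 1)) * ennreal ((k-1) * t powr (k - 1 - 1))"
    proof -
      have "k * t powr (k - 2) * 4 = 4 * k / (k - 1) * ((k-1) * t powr (k - 1 - 1))"
        using k by (simp add: field_simps)
      then show ?thesis using k by (subst (1 2) ennreal_mult[symmetric]) auto
    qed
    finally show ?thesis using True by (simp add: mult.assoc)
  qed simp
  have bound: "(\<integral>\<^sup>+x. ennreal (h x powr k) \<partial>M) \<le>
       ennreal (4 * k * 2 powr (k - 1) / (k - 1)) * (\<integral>\<^sup>+x. ennreal (g x powr k) \<partial>M)"
  proof -
    have mN [measurable]: "(\<lambda>x. 2 * g x) \<in> borel_measurable N" by (simp add: N_def)
    have "(\<integral>\<^sup>+x. ennreal (h x powr k) \<partial>M) =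
      (\<integral>\<^sup>+t. ennreal (k * t powr (k - 1)) * indicator {0<..} t * emeasure M {x \<in> space M. t < h x} \<partial>lborel)"
      by (rule nn_integral_layer_cake) (use k in \<open>auto simp: h_def sigma_finite_measure_axioms\<close>)
    also have "\<dots> \<le> (\<integral>\<^sup>+t. ennreal (4 * k / (k - 1)) * (ennreal ((k-1) * t powr (k - 1 - 1)) * indicator {0<..} t * emeasure N {x \<in> space N. t < 2 * g x}) \<partial>lborel)"
      by (intro nn_integral_mono layer)
    also have "\<dots> = ennreal (4 * k / (k - 1)) * (\<integral>\<^sup>+t. (ennreal ((k-1) * t powr (k - 1 - 1)) * indicator {0<..} t * emeasure N {x \<in> space N. t < 2 * g x}) \<partial>lborel)"
    proof (rule nn_integral_cmult)
      interpret N: sigma_finite_measure N by fact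
      have "(\<lambda>t. emeasure N {x \<in> space N. t < 2 * g x}) \<in> borel_measurable lborel" by measurable
      then show "(\<lambda>t. ennreal ((k-1) * t powr (k - 1 - 1)) * indicator {0<..} t * emeasure N {x \<in> space N. t < 2 * g x}) \<in> borel_measurable lborel"
        by measurable
    qed
    also have "\<dots> = ennreal (4 * k / (k - 1)) * (\<integral>\<^sup>+x. ennreal ((2 * g x) powr (k - 1)) \<partial>N)"
      by (subst nn_integral_layer_cake[OF N mN]) (use pos k in auto)
    also have "(\<integral>\<^sup>+x. ennreal ((2 * g x) powr (k - 1)) \<partial>N) = (\<integral>\<^sup>+x. ennreal (g x) * ennreal ((2 * g x) powr (k - 1)) \<partial>M)"
      unfolding N_def by (rule nn_integral_density) auto
    also have "\<dots> = (\<integral>\<^sup>+x. ennreal (2 powr (k - 1)) * ennreal (g x powr k) \<partial>M)"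
    proof (intro nn_integral_cong)
      fix x
      have "g x * (2 * g x) powr (k - 1) = 2 powr (k-1) * g x powr k"
      proof (cases "g x = 0")
        case False
        then have "g x powr (1 + (k - 1)) = g x * g x powr (k - 1)" using pos[of x] by (subst powr_add) auto
        then show ?thesis using pos[of x] by (simp add: powr_mult)
      qed simp
      then show "ennreal (g x) * ennreal ((2 * g x) powr (k - 1)) = ennreal (2 powr (k - 1)) * ennreal (g x powr k)"
        by (simp add: pos flip: ennreal_mult)
    qed
    also have "\<dots> = ennreal (2 powr (k - 1)) * (\<integral>\<^sup>+x. ennreal (g x powr k) \<partial>M)"
      by (rule nn_integral_cmult) auto
    also have "ennreal (4 * k / (k - 1)) * \<dots> = ennreal (4 * k * 2 powr (k - 1) / (k - 1)) * (\<integral>\<^sup>+x. ennreal (g x powr k) \<partial>M)"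
      using k by (simp add: mult.assoc[symmetric] flip: ennreal_mult)
    finally show ?thesis .
  qed
  show ?thesis by (rule that[OF h_meas _ AE bound]) (simp add: h_def)
qed

section \<open>Weighted Lebesgue measures on the unit interval\<close>

text \<open>
  The measure \<open>w dx\<close> of the unit interval, placed on the whole line so that intervals reaching
  beyond \<open>[0, 1]\<close> need no special treatment.
\<close>

definition weight_measure :: "(real \<Rightarrow> real) \<Rightarrow> real measure" where
  "weight_measure w = density lebesgue (\<lambda>x. ennreal (w x) * indicator {0..1} x)"

lemma space_weight_measure [simp]: "space (weight_measure w) = UNIV"
  and sets_weight_measure [simp, measurable_cong]: "sets (weight_measure w) = sets lebesgue"
  by (simp_all add: weight_measure_def)

lemma measurable_weight_indicator [measurable]:
  fixes w :: "real \<Rightarrow> real"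
  assumes [measurable]: "w \<in> borel_measurable lebesgue"
  shows "(\<lambda>x. ennreal (w x) * indicator {0..1} x) \<in> borel_measurable lebesgue"
proof -
  have [measurable]: "{0..1::real} \<in> sets lebesgue" by simp
  show ?thesis by measurable
qed

lemma nn_integral_weight_measure:
  assumes [measurable]: "w \<in> borel_measurable lebesgue" "f \<in> borel_measurable lebesgue"
  shows "(\<integral>\<^sup>+x. f x \<partial>weight_measure w) = (\<integral>\<^sup>+x. ennreal (w x) * indicator {0..1} x * f x \<partial>lebesgue)"
  unfolding weight_measure_def by (rule nn_integral_density) auto

lemma emeasure_weight_measure:
  assumes [measurable]: "w \<in> borel_measurable lebesgue" "S \<in> sets lebesgue"
  shows "emeasure (weight_measure w) S = (\<integral>\<^sup>+x. ennreal (w x) * indicator {0..1} x * indicator S x \<partial>lebesgue)"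
  unfolding weight_measure_def by (rule emeasure_density) auto

lemma emeasure_weight_measure_one:
  assumes "S \<in> sets lebesgue" "S \<subseteq> {0..1}"
  shows "emeasure (weight_measure (\<lambda>_. 1)) S = emeasure lebesgue S"
proof -
  have "(\<lambda>x. ennreal 1 * indicator {0..1} x * indicator S x) = (indicator S :: real \<Rightarrow> ennreal)"
    using assms by (auto simp: fun_eq_iff indicator_def)
  then show ?thesis using assms by (simp add: emeasure_weight_measure)
qed

lemma sets_lebesgue_Collect_Ioo:
  assumes "Measurable.pred lebesgue P"
  shows "{x\<in>{a<..<b::real}. P x} \<in> sets lebesgue"
proof -
  have "{x\<in>space lebesgue. P x} \<in> sets lebesgue" using assms by measurable
  then have "{x\<in>space lebesgue. P x} \<inter> {a<..<b} \<in> sets lebesgue" by (rule sets.Int) simp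
  moreover have "{x\<in>space lebesgue. P x} \<inter> {a<..<b} = {x\<in>{a<..<b}. P x}" by auto
  ultimately show ?thesis by simp
qed

text \<open>
  The mass of an interval is a difference of values of an indefinite integral, hence a continuous function of
  the end points.
\<close>

lemma weight_measure_interval_eq_integral:
  fixes w :: "real \<Rightarrow> real"
  assumes w [measurable]: "w \<in> borel_measurable lebesgue" and pos: "\<And>x. 0 \<le> w x"
    and fin: "finite_measure (weight_measure w)"
  shows "w integrable_on {0..1}"
    and "0 \<le> c \<Longrightarrow> c \<le> d \<Longrightarrow> d \<le> 1 \<Longrightarrow>
      measure (weight_measure w) {c<..<d} = integral {0..d} w - integral {0..c} w"
proof -
  interpret finite_measure "weight_measure w" by fact
  have *: "((\<lambda>x. w x * indicator S x) has_integral measure (weight_measure w) S) UNIV"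
    if S [measurable]: "S \<in> sets lebesgue" "S \<subseteq> {0..1}" for S
  proof (rule has_integral_iff_nn_integral_lebesgue[THEN iffD2], goal_cases)
    case 2
    have "emeasure (weight_measure w) S = (\<integral>\<^sup>+x. ennreal (w x * indicator S x) \<partial>lebesgue)"
      unfolding emeasure_weight_measure[OF w S(1)]
      by (intro nn_integral_cong) (use S(2) in \<open>auto simp: indicator_def\<close>)
    then show ?case by (auto simp: emeasure_eq_measure)
  qed (use pos in auto)
  have **: "(w has_integral measure (weight_measure w) S) S" if "S \<in> sets lebesgue" "S \<subseteq> {0..1}" for S
  proof -
    have "(\<lambda>x. w x * indicator S x) = (\<lambda>x. if x \<in> S then w x else 0)" by (auto simp: fun_eq_iff)
    then show ?thesis using *[OF that] has_integral_restrict_UNIV[of S w] by metis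
  qed
  show int: "w integrable_on {0..1}" using **[of "{0..1}"] by auto
  assume cd: "0 \<le> c" "c \<le> d" "d \<le> 1"
  have "w integrable_on {0..d}" by (rule integrable_subinterval_real[OF int]) (use cd in auto)
  then have "integral {0..c} w + integral {c..d} w = integral {0..d} w"
    using cd by (intro Henstock_Kurzweil_Integration.integral_combine) auto
  moreover have "(w has_integral measure (weight_measure w) {c<..<d}) {c..d}"
    unfolding has_integral_Icc_iff_Ioo using cd by (intro **) (simp, force)
  ultimately show "measure (weight_measure w) {c<..<d} = integral {0..d} w - integral {0..c} w"
    by (simp add: integral_unique)
qed

section \<open>Level sets at a stopping height\<close>

text \<open>
  With \<open>G x = F x - l x\<close>, an average above \<open>l\<close> on \<open>[c, d]\<close> means
  \<open>G c < G d\<close>, while \<open>G b \<le> G a\<close>. The intermediate value theorem gives an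
  interval with \<open>G c' = G d'\<close>: either \<open>d\<close> can be moved to the right until \<open>G
  c\<close> is reached, or \<open>d\<close> moves all the way to \<open>b\<close> and then \<open>c\<close> to
  the left. This replaces the dyadic stopping time of the Calderon-Zygmund decomposition and yields averages
  equal to \<open>l\<close>.
\<close>

lemma enlarge_interval_to_average:
  fixes F :: "real \<Rightarrow> real"
  assumes cont: "continuous_on {a..b} F" and ab: "a \<le> c" "c < d" "d \<le> b"
    and cd: "l * (d - c) < F d - F c" and J: "F b - F a \<le> l * (b - a)"
  obtains c' d' where "a \<le> c'" "c' \<le> c" "d \<le> d'" "d' \<le> b" "F d' - F c' = l * (d' - c')"
proof -
  define G where "G x = F x - l * x" for x
  have contG: "continuous_on S G" if "S \<subseteq> {a..b}" for S
    unfolding G_def by (intro continuous_intros continuous_on_subset[OF cont that])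
  have 1: "G c < G d" and 2: "G b \<le> G a" using cd J by (auto simp: G_def algebra_simps)
  show ?thesis
  proof (cases "G b \<le> G c")
    case True
    obtain d' where "d \<le> d'" "d' \<le> b" "G d' = G c"
      using IVT2'[of G b "G c" d] True 1 ab contG[of "{d..b}"] by auto
    then show ?thesis using that[of c d'] ab by (auto simp: G_def algebra_simps)
  next
    case False
    obtain c' where "a \<le> c'" "c' \<le> c" "G c' = G b"
      using IVT2'[of G c "G b" a] False 2 ab contG[of "{a..c}"] by auto
    then show ?thesis using that[of c' b] ab by (auto simp: G_def algebra_simps)
  qed
qed

text \<open>
  The Calderon-Zygmund step. Consider the subintervals of \<open>(a, b)\<close> on which
  \<open>\<sigma>\<close> has average exactly \<open>l\<close>. They cover almost all points where
  \<open>\<sigma> > 2 l\<close>: around an uncovered point all averages are at most \<open>l\<close>, so the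
  covering lemma bounds the \<open>\<sigma>\<close>-mass of the set \<open>E\<close> of such points by
  \<open>2 l\<close> times its length, which is impossible unless \<open>E\<close> is a null set. On each of
  the covering intervals the mass \<open>l (d - c)\<close> is at most \<open>2 l\<close> times the length of
  the set where \<open>\<sigma> > \<kappa> l\<close>, and the covering lemma sums this up.
\<close>

lemma level_set_bound:
  fixes \<sigma> :: "real \<Rightarrow> real"
  assumes \<sigma> [measurable]: "\<sigma> \<in> borel_measurable lebesgue" and pos: "\<And>x. 0 \<le> \<sigma> x"
    and fin: "finite_measure (weight_measure \<sigma>)"
    and ab: "0 \<le> a" "a < b" "b \<le> 1"
    and dense: "\<And>c d l. a \<le> c \<Longrightarrow> c < d \<Longrightarrow> d \<le> b \<Longrightarrow> measure (weight_measure \<sigma>) {c<..<d} = l * (d - c) \<Longrightarrow>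
       d - c \<le> 2 * measure lebesgue {x\<in>{c<..<d}. \<kappa> * l < \<sigma> x}"
    and l: "measure (weight_measure \<sigma>) {a<..<b} \<le> l * (b - a)" "0 < l"
  shows "emeasure (weight_measure \<sigma>) {x\<in>{a<..<b}. 2 * l < \<sigma> x} \<le>
    ennreal (4 * l) * emeasure lebesgue {x\<in>{a<..<b}. \<kappa> * l < \<sigma> x}"
proof -
  define \<nu> where "\<nu> = weight_measure \<sigma>"
  interpret finite_measure \<nu> using fin by (simp add: \<nu>_def)
  have [simp]: "sets \<nu> = sets lebesgue" "space \<nu> = UNIV" by (simp_all add: \<nu>_def)
  define F where "F x = integral {0..x} \<sigma>" for x
  have contF: "continuous_on {a..b} F"
  proof -
    have "continuous_on {0..1} F"
      unfolding F_def by (intro indefinite_integral_continuous_1 weight_measure_interval_eq_integral(1) \<sigma> pos fin)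
    then show ?thesis by (rule continuous_on_subset) (use ab in auto)
  qed
  have \<nu>_eq: "measure \<nu> {c<..<d} = F d - F c" if "a \<le> c" "c \<le> d" "d \<le> b" for c d
    unfolding F_def \<nu>_def using that ab by (intro weight_measure_interval_eq_integral \<sigma> pos fin) auto
  define \<F> where "\<F> = {I. \<exists>c d. I = {c<..<d} \<and> a \<le> c \<and> c < d \<and> d \<le> b \<and> measure \<nu> I = l * (d - c)}"
  define E where "E = {x\<in>{a<..<b}. 2 * l < \<sigma> x} - \<Union>\<F>"
  have lev [measurable]: "{x\<in>{a<..<b}. k < \<sigma> x} \<in> sets lebesgue" for k
    by (rule sets_lebesgue_Collect_Ioo) measurable
  have openF: "open (\<Union>\<F>)" by (intro open_Union) (auto simp: \<F>_def)
  then have FU [measurable]: "\<Union>\<F> \<in> sets lebesgue" by (simp add: borel_open)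
  have E [measurable]: "E \<in> sets lebesgue" unfolding E_def by measurable
  have short: "measure \<nu> {c<..<d} \<le> l * (d - c)" if cd: "a \<le> c" "c < d" "d \<le> b" and x: "x \<in> E" "c < x" "x < d" for c d x
  proof (rule ccontr)
    assume "\<not> measure \<nu> {c<..<d} \<le> l * (d - c)"
    then have "l * (d - c) < F d - F c" using \<nu>_eq[of c d] cd by simp
    moreover have "F b - F a \<le> l * (b - a)" using l(1) \<nu>_eq[of a b] ab by (simp add: \<nu>_def)
    ultimately obtain c' d' where c': "a \<le> c'" "c' \<le> c" "d \<le> d'" "d' \<le> b" "F d' - F c' = l * (d' - c')"
      using enlarge_interval_to_average[OF contF cd] by metis
    then have "{c'<..<d'} \<in> \<F>" unfolding \<F>_def using cd \<nu>_eq[of c' d'] by force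
    moreover have "x \<in> {c'<..<d'}" using x c' by auto
    ultimately show False using x(1) by (auto simp: E_def)
  qed
  have E_fin: "emeasure lebesgue E \<le> ennreal (b - a)"
  proof -
    have "emeasure lebesgue E \<le> emeasure lebesgue {a<..<b}" by (intro emeasure_mono) (auto simp: E_def)
    then show ?thesis using ab by simp
  qed
  have "emeasure \<nu> E \<le> ennreal (2 * l) * emeasure lebesgue E"
  proof (rule ennreal_le_epsilon)
    fix e :: real assume e: "e > 0"
    have "e / (2 * l) > 0" using e l by simp
    from sets_lebesgue_outer_open[OF E this]
    obtain U where U: "open U" "E \<subseteq> U" "emeasure lebesgue (U - E) < ennreal (e / (2 * l))"
      by metis
    \<comment> \<open>Every point of \<open>E\<close> has a small interval around it inside \<open>V\<close>, and \<open>V\<close> is hardly longer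
         than \<open>E\<close>.\<close>
    define V where "V = U \<inter> {a<..<b}"
    have V: "open V" "E \<subseteq> V" "V \<subseteq> {a<..<b}" using U(1,2) by (auto simp: V_def E_def)
    have Vs [measurable]: "V \<in> sets lebesgue" using V(1) by (simp add: borel_open)
    define \<H> where "\<H> = {I. \<exists>c d. I = {c<..<d} \<and> c < d \<and> I \<subseteq> V \<and> I \<inter> E \<noteq> {}}"
    have sub: "\<Union>\<H> \<subseteq> V" by (auto simp: \<H>_def)
    have oH: "open (\<Union>\<H>)" by (intro open_Union) (auto simp: \<H>_def)
    have EH: "E \<subseteq> \<Union>\<H>"
    proof
      fix x assume x: "x \<in> E"
      then obtain r where r: "r > 0" "ball x r \<subseteq> V" using V by (meson openE subsetD)
      have "ball x r = {x - r<..<x + r}" by (rule ball_eq_greaterThanLessThan)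
      then have "{x - r<..<x + r} \<in> \<H>" unfolding \<H>_def using r x by force
      moreover have "x \<in> {x - r<..<x + r}" using r by auto
      ultimately show "x \<in> \<Union>\<H>" by blast
    qed
    define K where "K = density lebesgue (\<lambda>_::real. ennreal l)"
    have KI: "emeasure K S = ennreal l * emeasure lebesgue S" if "S \<in> sets lebesgue" for S
      using that by (simp add: K_def emeasure_density nn_integral_cmult)
    have "emeasure \<nu> E \<le> emeasure \<nu> (\<Union>\<H>)" using EH oH by (intro emeasure_mono) (simp_all add: borel_open)
    also have "\<dots> \<le> 2 * emeasure K (\<Union>\<H>)"
    proof (rule emeasure_Union_intervals_le)
      show "sets borel \<subseteq> sets \<nu>" "sets borel \<subseteq> sets K" by (auto simp: K_def)
      fix I assume "I \<in> \<H>"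
      then obtain c d x where I: "I = {c<..<d}" "c < d" "I \<subseteq> V" "x \<in> I" "x \<in> E"
        unfolding \<H>_def by blast
      then show "\<exists>c d. I = {c<..<d}" by auto
      have "{c<..<d} \<subseteq> {a<..<b}" using I V by auto
      then have "a \<le> c" "d \<le> b" using I(2) by (auto simp: greaterThanLessThan_subseteq_greaterThanLessThan)
      then have "measure \<nu> {c<..<d} \<le> l * (d - c)" using short[of c d x] I by auto
      then have "ennreal (measure \<nu> {c<..<d}) \<le> ennreal l * ennreal (d - c)"
        using l I(2) by (simp add: ennreal_leI flip: ennreal_mult)
      then show "emeasure \<nu> I \<le> emeasure K I" using I by (simp add: emeasure_eq_measure KI)
    qed
    also have "\<dots> \<le> 2 * emeasure K V" using sub oH by (intro mult_left_mono emeasure_mono) (auto simp: K_def borel_open)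
    also have "\<dots> = ennreal (2 * l) * emeasure lebesgue V"
      using l by (simp add: KI ennreal_mult mult.assoc)
    also have "\<dots> \<le> ennreal (2 * l) * (emeasure lebesgue E + emeasure lebesgue (U - E))"
    proof (rule mult_left_mono)
      have "emeasure lebesgue V \<le> emeasure lebesgue (E \<union> (U - E))"
        using V(2) U by (intro emeasure_mono) (auto simp: V_def borel_open)
      also have "\<dots> \<le> emeasure lebesgue E + emeasure lebesgue (U - E)"
        using U by (intro emeasure_subadditive) (auto simp: borel_open)
      finally show "emeasure lebesgue V \<le> emeasure lebesgue E + emeasure lebesgue (U - E)" .
    qed simp
    also have "\<dots> \<le> ennreal (2 * l) * (emeasure lebesgue E + ennreal (e / (2 * l)))"
      using U by (intro mult_left_mono add_left_mono) auto
    also have "\<dots> = ennreal (2 * l) * emeasure lebesgue E + ennreal e"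
      using l e by (simp add: distrib_left flip: ennreal_mult)
    finally show "emeasure \<nu> E \<le> ennreal (2 * l) * emeasure lebesgue E + ennreal e" .
  qed
  moreover have "emeasure \<nu> E = (\<integral>\<^sup>+x. ennreal (\<sigma> x - 2 * l) * indicator E x \<partial>lebesgue) + ennreal (2 * l) * emeasure lebesgue E"
  proof -
    have "emeasure \<nu> E = (\<integral>\<^sup>+x. ennreal (\<sigma> x - 2 * l) * indicator E x + ennreal (2 * l) * indicator E x \<partial>lebesgue)"
      unfolding \<nu>_def emeasure_weight_measure[OF \<sigma> E] using ab l
      by (intro nn_integral_cong) (auto simp: E_def indicator_def simp flip: ennreal_plus)
    then show ?thesis by (subst (asm) nn_integral_add) (auto simp: nn_integral_cmult)
  qed
  ultimately have "ennreal (2 * l) * emeasure lebesgue E + (\<integral>\<^sup>+x. ennreal (\<sigma> x - 2 * l) * indicator E x \<partial>lebesgue) \<le> ennreal (2 * l) * emeasure lebesgue E + 0"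
    by (simp only: add.commute add_0_left add_0_right)
  moreover have "ennreal (2 * l) * emeasure lebesgue E < \<infinity>"
  proof -
    have "emeasure lebesgue E < top" by (rule le_less_trans[OF E_fin]) simp
    then show ?thesis unfolding infinity_ennreal_def ennreal_mult_less_top
      using ennreal_less_top by blast
  qed
  ultimately have "(\<integral>\<^sup>+x. ennreal (\<sigma> x - 2 * l) * indicator E x \<partial>lebesgue) = 0"
    unfolding ennreal_add_left_cancel_le le_zero_eq by (metis less_irrefl)
  then have "AE x in lebesgue. ennreal (\<sigma> x - 2 * l) * indicator E x = 0"
    by (subst (asm) nn_integral_0_iff_AE) auto
  then have "AE x in lebesgue. x \<notin> E"
    by eventually_elim (auto simp: E_def indicator_def ennreal_eq_0_iff split: if_splits)
  then have "emeasure lebesgue E = 0" by (simp add: AE_iff_measurable[OF E])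
  then have E0: "emeasure \<nu> E = 0"
    using \<open>emeasure \<nu> E \<le> ennreal (2 * l) * emeasure lebesgue E\<close> by simp
  define B where "B = {x\<in>{a<..<b}. \<kappa> * l < \<sigma> x}"
  have B [measurable]: "B \<in> sets lebesgue" unfolding B_def by (rule lev)
  define N where "N = density lebesgue (\<lambda>x. ennreal (2 * l) * indicator B x)"
  have NI: "emeasure N S = ennreal (2 * l) * emeasure lebesgue (B \<inter> S)" if [measurable]: "S \<in> sets lebesgue" for S
  proof -
    have "emeasure N S = (\<integral>\<^sup>+x. ennreal (2 * l) * indicator (B \<inter> S) x \<partial>lebesgue)"
      unfolding N_def by (subst emeasure_density) (auto intro!: nn_integral_cong simp: indicator_def)
    then show ?thesis by (simp add: nn_integral_cmult)
  qed
  have "emeasure \<nu> {x\<in>{a<..<b}. 2 * l < \<sigma> x} \<le> emeasure \<nu> (E \<union> \<Union>\<F>)"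
  proof (rule emeasure_mono)
    show "E \<union> \<Union>\<F> \<in> sets \<nu>" using sets.Un[OF E FU] by simp
  qed (auto simp: E_def)
  also have "\<dots> \<le> emeasure \<nu> E + emeasure \<nu> (\<Union>\<F>)" by (intro emeasure_subadditive) auto
  also have "\<dots> = emeasure \<nu> (\<Union>\<F>)" using E0 by simp
  also have "\<dots> \<le> 2 * emeasure N (\<Union>\<F>)"
  proof (rule emeasure_Union_intervals_le)
    show "sets borel \<subseteq> sets \<nu>" "sets borel \<subseteq> sets N" by (auto simp: N_def)
    fix I assume "I \<in> \<F>"
    then obtain c d where I: "I = {c<..<d}" "a \<le> c" "c < d" "d \<le> b" "measure \<nu> I = l * (d - c)" by (auto simp: \<F>_def)
    then show "\<exists>c d. I = {c<..<d}" by auto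
    have BI: "B \<inter> I = {x\<in>{c<..<d}. \<kappa> * l < \<sigma> x}" using I by (auto simp: B_def)
    have fmI: "emeasure lebesgue (B \<inter> I) = ennreal (measure lebesgue (B \<inter> I))"
    proof (rule emeasure_eq_ennreal_measure)
      have "emeasure lebesgue (B \<inter> I) \<le> emeasure lebesgue I" by (intro emeasure_mono) (auto simp: I(1))
      also have "\<dots> < top" using I(1,3) by simp
      finally show "emeasure lebesgue (B \<inter> I) \<noteq> top" by (rule less_imp_neq)
    qed
    have "l * (d - c) \<le> l * (2 * measure lebesgue (B \<inter> I))"
    proof (rule mult_left_mono)
      show "d - c \<le> 2 * measure lebesgue (B \<inter> I)"
        unfolding BI by (rule dense) (use I(2-5) in \<open>simp_all add: \<nu>_def I(1)\<close>)
    qed (use l in simp)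
    then have "ennreal (measure \<nu> I) \<le> ennreal (2 * l) * emeasure lebesgue (B \<inter> I)"
      using l I(5) unfolding fmI by (simp add: ennreal_leI mult_ac flip: ennreal_mult)
    then show "emeasure \<nu> I \<le> emeasure N I" using I by (simp add: emeasure_eq_measure NI)
  qed
  also have "\<dots> = ennreal (4 * l) * emeasure lebesgue (B \<inter> \<Union>\<F>)"
    using l by (simp add: NI mult.assoc[symmetric] ennreal_mult)
  also have "\<dots> \<le> ennreal (4 * l) * emeasure lebesgue B" by (intro mult_left_mono emeasure_mono) auto
  finally show ?thesis by (simp add: B_def \<nu>_def)
qed

section \<open>The reverse Hoelder inequality\<close>

text \<open>
  The level set bound is multiplied by a power of \<open>t\<close> and integrated. The right-hand side then
  contains the same integral of \<open>\<sigma> powr (1 + \<delta>)\<close>, but with a factor proportional to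
  \<open>\<delta>\<close>; the choice \<open>\<delta> = \<kappa>\<^sup>2 / 16\<close> makes this factor
  \<open>1/2\<close>, and the term can be absorbed. Absorption needs finiteness, so the argument is carried
  out for truncations of \<open>\<sigma>\<close> first.
\<close>

lemma reverse_Hoelder_of_dense_level_sets:
  fixes \<sigma> :: "real \<Rightarrow> real"
  assumes \<sigma> [measurable]: "\<sigma> \<in> borel_measurable lebesgue" and pos: "\<And>x. 0 \<le> \<sigma> x"
    and fin: "finite_measure (weight_measure \<sigma>)"
    and ab: "0 \<le> a" "a < b" "b \<le> 1" and \<kappa>: "0 < \<kappa>" "\<kappa> \<le> 1"
    and dense: "\<And>c d l. a \<le> c \<Longrightarrow> c < d \<Longrightarrow> d \<le> b \<Longrightarrow> measure (weight_measure \<sigma>) {c<..<d} = l * (d - c) \<Longrightarrow>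
       d - c \<le> 2 * measure lebesgue {x\<in>{c<..<d}. \<kappa> * l < \<sigma> x}"
    and J: "0 < measure (weight_measure \<sigma>) {a<..<b}"
    and \<delta>: "\<delta> = \<kappa>\<^sup>2 / 16"
  shows "(\<integral>\<^sup>+x\<in>{a<..<b}. ennreal (\<sigma> x powr (1 + \<delta>)) \<partial>lebesgue) \<le>
    ennreal (4 * (measure (weight_measure \<sigma>) {a<..<b} / (b - a)) powr \<delta> * measure (weight_measure \<sigma>) {a<..<b})"
proof -
  define \<nu> where "\<nu> = weight_measure \<sigma>"
  interpret finite_measure \<nu> using fin by (simp add: \<nu>_def)
  have [simp]: "sets \<nu> = sets lebesgue" "space \<nu> = UNIV" by (simp_all add: \<nu>_def)
  define m where "m = measure \<nu> {a<..<b}"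
  define L where "L = m / (b - a)"
  have m: "m > 0" and L: "L > 0" using J ab by (simp_all add: m_def L_def \<nu>_def)
  have \<delta>_pos: "\<delta> > 0" unfolding \<delta> using \<kappa> by simp
  have "\<kappa>\<^sup>2 \<le> 1" using \<kappa> by (simp add: power_le_one)
  then have \<delta>_le: "\<delta> \<le> 1" unfolding \<delta> by simp
  define L1 where "L1 = weight_measure (\<lambda>_. 1)"
  have [simp]: "sets L1 = sets lebesgue" "space L1 = UNIV" by (simp_all add: L1_def)
  have L1: "sigma_finite_measure L1"
  proof -
    have "emeasure L1 UNIV = (\<integral>\<^sup>+x. indicator {0..1::real} x \<partial>lebesgue)"
      unfolding L1_def by (subst emeasure_weight_measure) auto
    also have "\<dots> = emeasure lebesgue {0..1::real}" by (rule nn_integral_indicator) simp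
    finally have "finite_measure L1" by (intro finite_measureI) simp
    then show ?thesis by (rule finite_measure.axioms(1))
  qed
  define J where "J = {a<..<b}"
  have Js [measurable]: "J \<in> sets lebesgue" by (simp add: J_def)
  have J01: "J \<subseteq> {0..1}" using ab by (auto simp: J_def)
  define h where "h N x = min (\<sigma> x) N * indicator J x" for N x :: real
  have h_meas [measurable]: "h N \<in> borel_measurable lebesgue" for N unfolding h_def by measurable
  have h_pos: "0 \<le> h N x" if "N > 0" for N x using pos that by (auto simp: h_def indicator_def)
  have main: "(\<integral>\<^sup>+x. ennreal (h N x powr \<delta>) \<partial>\<nu>) \<le> ennreal (4 * L powr \<delta> * m)" if N: "N > 0" for N
  proof -
    define X where "X = (\<integral>\<^sup>+x. ennreal (h N x powr \<delta>) \<partial>\<nu>)"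
    have "X \<le> (\<integral>\<^sup>+x. ennreal (N powr \<delta>) \<partial>\<nu>)" unfolding X_def
      using N h_pos \<delta>_pos by (intro nn_integral_mono ennreal_leI powr_mono2) (auto simp: h_def indicator_def)
    also have "\<dots> = ennreal (N powr \<delta>) * ennreal (measure \<nu> UNIV)" by (simp add: emeasure_eq_measure)
    also have "\<dots> < top" by (simp flip: ennreal_mult)
    finally obtain X' where X': "X = ennreal X'" "X' \<ge> 0" by (cases X) auto
    define c where "c = 2 * \<delta> / (1 + \<delta>)"
    have c: "c > 0" using \<delta>_pos by (simp add: c_def)
    \<comment> \<open>Below height \<open>2 L\<close> the total mass \<open>m\<close> is good enough; above it the level set bound applies with \<open>l = t/2\<close>,
         since \<open>t/2\<close> is then at least the average \<open>L\<close> of \<open>\<sigma>\<close>.\<close>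
    have pt: "ennreal (\<delta> * t powr (\<delta> - 1)) * indicator {0<..} t * emeasure \<nu> {x \<in> space \<nu>. t < h N x} \<le>
       ennreal (\<delta> * t powr (\<delta> - 1)) * indicator {0<..<2 * L} t * ennreal m +
       ennreal c * (ennreal ((1 + \<delta>) * t powr (1 + \<delta> - 1)) * indicator {0<..} t * emeasure L1 {x \<in> space L1. t < 2 / \<kappa> * h N x})" for t
    proof (cases "t > 0")
      case t: True
      consider "t < 2 * L" | "2 * L \<le> t" "N \<le> t" | "2 * L \<le> t" "t < N" by linarith
      then show ?thesis
      proof cases
        case 1
        have "emeasure \<nu> {x \<in> space \<nu>. t < h N x} \<le> emeasure \<nu> {a<..<b}"
          using t by (intro emeasure_mono) (auto simp: h_def J_def indicator_def split: if_splits)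
        also have "\<dots> = ennreal m" by (simp add: m_def emeasure_eq_measure)
        finally have "ennreal (\<delta> * t powr (\<delta> - 1)) * emeasure \<nu> {x \<in> space \<nu>. t < h N x} \<le> ennreal (\<delta> * t powr (\<delta> - 1)) * ennreal m"
          by (rule mult_left_mono) simp
        then show ?thesis using t 1 by (simp add: add_increasing2)
      next
        case 2
        then have "{x \<in> space \<nu>. t < h N x} = {}" using t by (auto simp: h_def indicator_def)
        then show ?thesis by simp
      next
        case 3
        have tl: "measure (weight_measure \<sigma>) {a<..<b} \<le> t / 2 * (b - a)"
          using 3(1) ab unfolding L_def m_def \<nu>_def by (simp add: field_simps)
        have lev: "{x\<in>{a<..<b}. k < \<sigma> x} \<in> sets lebesgue" for k
          by (rule sets_lebesgue_Collect_Ioo) measurable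
        have "emeasure \<nu> {x \<in> space \<nu>. t < h N x} \<le> emeasure \<nu> {x\<in>{a<..<b}. 2 * (t / 2) < \<sigma> x}"
          using t lev by (intro emeasure_mono) (auto simp: h_def J_def indicator_def split: if_splits)
        also have "\<dots> \<le> ennreal (4 * (t / 2)) * emeasure lebesgue {x\<in>{a<..<b}. \<kappa> * (t / 2) < \<sigma> x}"
          unfolding \<nu>_def by (rule level_set_bound[OF \<sigma> pos fin ab dense tl]) (use t in auto)
        also have "emeasure lebesgue {x\<in>{a<..<b}. \<kappa> * (t / 2) < \<sigma> x} = emeasure L1 {x\<in>{a<..<b}. \<kappa> * (t / 2) < \<sigma> x}"
          unfolding L1_def using ab by (intro emeasure_weight_measure_one[symmetric] lev) auto
        also have "\<dots> \<le> emeasure L1 {x \<in> space L1. t < 2 / \<kappa> * h N x}"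
        proof (rule emeasure_mono)
          show "{x\<in>{a<..<b}. \<kappa> * (t / 2) < \<sigma> x} \<subseteq> {x \<in> space L1. t < 2 / \<kappa> * h N x}"
          proof safe
            fix x assume x: "x \<in> {a<..<b}" "\<kappa> * (t / 2) < \<sigma> x"
            have "\<kappa> * (t / 2) \<le> 1 * (t / 2)" using \<kappa> t by (intro mult_right_mono) auto
            also have "\<dots> < N" using t 3 by simp
            finally have "\<kappa> * (t / 2) < h N x" using x by (simp add: h_def J_def)
            then show "t < 2 / \<kappa> * h N x" using \<kappa> by (simp add: field_simps)
          qed simp
          have "{x \<in> space lebesgue. t < 2 / \<kappa> * h N x} \<in> sets lebesgue" by measurable
          then show "{x \<in> space L1. t < 2 / \<kappa> * h N x} \<in> sets L1" by simp
        qed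
        finally have le: "emeasure \<nu> {x \<in> space \<nu>. t < h N x} \<le> ennreal (4 * (t / 2)) * emeasure L1 {x \<in> space L1. t < 2 / \<kappa> * h N x}"
          by (simp add: mult_left_mono)
        have "ennreal (\<delta> * t powr (\<delta> - 1)) * emeasure \<nu> {x \<in> space \<nu>. t < h N x} \<le>
          ennreal (\<delta> * t powr (\<delta> - 1)) * (ennreal (4 * (t / 2)) * emeasure L1 {x \<in> space L1. t < 2 / \<kappa> * h N x})"
          by (rule mult_left_mono[OF le]) simp
        also have "\<dots> = ennreal (\<delta> * t powr (\<delta> - 1) * (4 * (t / 2))) * emeasure L1 {x \<in> space L1. t < 2 / \<kappa> * h N x}"
          using t \<delta>_pos by (simp add: ennreal_mult mult.assoc)
        also have "\<delta> * t powr (\<delta> - 1) * (4 * (t / 2)) = c * ((1 + \<delta>) * t powr (1 + \<delta> - 1))"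
        proof -
          have "t powr (\<delta> - 1) * t = t powr \<delta>" using t powr_add[of t "\<delta> - 1" 1] by simp
          moreover have "c * (1 + \<delta>) = 2 * \<delta>" using \<delta>_pos by (simp add: c_def)
          ultimately show ?thesis by (simp add: mult.assoc[symmetric])
        qed
        also have "ennreal (c * ((1 + \<delta>) * t powr (1 + \<delta> - 1))) * emeasure L1 {x \<in> space L1. t < 2 / \<kappa> * h N x}
          = ennreal c * (ennreal ((1 + \<delta>) * t powr (1 + \<delta> - 1)) * emeasure L1 {x \<in> space L1. t < 2 / \<kappa> * h N x})"
          using c \<delta>_pos by (subst ennreal_mult) (auto simp: mult.assoc)
        finally show ?thesis using t by (simp add: add_increasing)
      qed
    qed simp
    have h\<nu> [measurable]: "h N \<in> borel_measurable \<nu>" "h N \<in> borel_measurable L1"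
      using h_meas[of N] by (simp_all add: \<nu>_def L1_def cong: measurable_cong_sets)
    interpret L1: sigma_finite_measure L1 by fact
    have X1: "X = (\<integral>\<^sup>+t. ennreal (\<delta> * t powr (\<delta> - 1)) * indicator {0<..} t * emeasure \<nu> {x \<in> space \<nu>. t < h N x} \<partial>lborel)"
      unfolding X_def by (rule nn_integral_layer_cake) (use h_pos N \<delta>_pos sigma_finite_measure_axioms in auto)
    have [measurable]: "(\<lambda>t. emeasure L1 {x \<in> space L1. t < 2 / \<kappa> * h N x}) \<in> borel_measurable lborel"
      by measurable
    have "X \<le> (\<integral>\<^sup>+t. ennreal (\<delta> * t powr (\<delta> - 1)) * indicator {0<..<2 * L} t * ennreal m +
       ennreal c * (ennreal ((1 + \<delta>) * t powr (1 + \<delta> - 1)) * indicator {0<..} t * emeasure L1 {x \<in> space L1. t < 2 / \<kappa> * h N x}) \<partial>lborel)"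
      unfolding X1 by (intro nn_integral_mono pt)
    also have "\<dots> = (\<integral>\<^sup>+t. ennreal (\<delta> * t powr (\<delta> - 1)) * indicator {0<..<2 * L} t \<partial>lborel) * ennreal m +
       ennreal c * (\<integral>\<^sup>+t. (ennreal ((1 + \<delta>) * t powr (1 + \<delta> - 1)) * indicator {0<..} t * emeasure L1 {x \<in> space L1. t < 2 / \<kappa> * h N x}) \<partial>lborel)"
      by (simp add: nn_integral_add nn_integral_cmult nn_integral_multc)
    also have "(\<integral>\<^sup>+t. ennreal (\<delta> * t powr (\<delta> - 1)) * indicator {0<..<2 * L} t \<partial>lborel) = ennreal ((2 * L) powr \<delta>)"
      by (rule nn_integral_powr_Icc) (use \<delta>_pos L in auto)
    also have "(\<integral>\<^sup>+t. (ennreal ((1 + \<delta>) * t powr (1 + \<delta> - 1)) * indicator {0<..} t * emeasure L1 {x \<in> space L1. t < 2 / \<kappa> * h N x}) \<partial>lborel)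
       = (\<integral>\<^sup>+x. ennreal ((2 / \<kappa> * h N x) powr (1 + \<delta>)) \<partial>L1)"
      by (rule nn_integral_layer_cake[symmetric]) (use L1 h_pos N \<delta>_pos \<kappa> in auto)
    also have "\<dots> \<le> (\<integral>\<^sup>+x. ennreal (4 / \<kappa>\<^sup>2) * (ennreal (\<sigma> x) * indicator {0..1} x * ennreal (h N x powr \<delta>)) \<partial>lebesgue)"
    proof -
      have "(\<integral>\<^sup>+x. ennreal ((2 / \<kappa> * h N x) powr (1 + \<delta>)) \<partial>L1)
        = (\<integral>\<^sup>+x. ennreal 1 * indicator {0..1} x * ennreal ((2 / \<kappa> * h N x) powr (1 + \<delta>)) \<partial>lebesgue)"
        unfolding L1_def by (rule nn_integral_weight_measure) measurable
      also have "\<dots> \<le> (\<integral>\<^sup>+x. ennreal (4 / \<kappa>\<^sup>2) * (ennreal (\<sigma> x) * indicator {0..1} x * ennreal (h N x powr \<delta>)) \<partial>lebesgue)"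
      proof (rule nn_integral_mono)
        fix x
        have h\<sigma>: "h N x \<le> \<sigma> x" using pos[of x] by (auto simp: h_def indicator_def)
        have "(2 / \<kappa> * h N x) powr (1 + \<delta>) = (2 / \<kappa>) powr (1 + \<delta>) * (h N x powr \<delta> * h N x)"
        proof (cases "h N x = 0")
          case False
          then have y: "h N x > 0" using h_pos[OF N, of x] by simp
          have "(2 / \<kappa> * h N x) powr (1 + \<delta>) = (2 / \<kappa>) powr (1 + \<delta>) * h N x powr (1 + \<delta>)"
            by (rule powr_mult)
          moreover have "h N x powr (1 + \<delta>) = h N x powr \<delta> * h N x" using y by (simp add: powr_add)
          ultimately show ?thesis by simp
        qed simp
        also have "\<dots> \<le> (2 / \<kappa>) powr 2 * (h N x powr \<delta> * \<sigma> x)"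
        proof (rule mult_mono)
          show "(2 / \<kappa>) powr (1 + \<delta>) \<le> (2 / \<kappa>) powr 2" using \<kappa> \<delta>_le by (intro powr_mono) auto
          show "h N x powr \<delta> * h N x \<le> h N x powr \<delta> * \<sigma> x" using h\<sigma> by (rule mult_left_mono) simp
        qed (use h_pos[OF N, of x] in auto)
        also have "(2 / \<kappa>) powr 2 = 4 / \<kappa>\<^sup>2" using \<kappa> by (simp add: power_divide)
        finally have "ennreal ((2 / \<kappa> * h N x) powr (1 + \<delta>)) \<le> ennreal (4 / \<kappa>\<^sup>2) * (ennreal (\<sigma> x) * ennreal (h N x powr \<delta>))"
          using pos[of x] by (simp add: ennreal_leI mult_ac flip: ennreal_mult)
        then show "ennreal 1 * indicator {0..1} x * ennreal ((2 / \<kappa> * h N x) powr (1 + \<delta>)) \<le>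
           ennreal (4 / \<kappa>\<^sup>2) * (ennreal (\<sigma> x) * indicator {0..1} x * ennreal (h N x powr \<delta>))"
          by (auto simp: indicator_def)
      qed
      finally show ?thesis .
    qed
    also have "\<dots> = ennreal (4 / \<kappa>\<^sup>2) * X"
      unfolding X_def \<nu>_def by (simp add: nn_integral_cmult nn_integral_weight_measure)
    finally have "X \<le> ennreal ((2 * L) powr \<delta>) * ennreal m + ennreal c * (ennreal (4 / \<kappa>\<^sup>2) * X)"
      by (simp add: mult_left_mono)
    then have "ennreal X' \<le> ennreal ((2 * L) powr \<delta> * m + c * (4 / \<kappa>\<^sup>2 * X'))"
      unfolding X' using m c X'(2) by (simp flip: ennreal_mult ennreal_plus)
    then have "X' \<le> (2 * L) powr \<delta> * m + c * (4 / \<kappa>\<^sup>2 * X')"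
      using m c X'(2) by (subst (asm) ennreal_le_iff) auto
    also have "c * (4 / \<kappa>\<^sup>2 * X') \<le> X' / 2"
    proof -
      have "c \<le> 2 * \<delta>" using \<delta>_pos by (simp add: c_def field_simps)
      then have "c * (4 / \<kappa>\<^sup>2 * X') \<le> 2 * \<delta> * (4 / \<kappa>\<^sup>2 * X')" using X'(2) by (intro mult_right_mono) auto
      also have "\<dots> = X' / 2" using \<kappa> by (simp add: \<delta>)
      finally show ?thesis .
    qed
    finally have "X' \<le> 2 * (2 * L) powr \<delta> * m" by simp
    also have "\<dots> = 2 * 2 powr \<delta> * L powr \<delta> * m" using L by (simp add: powr_mult)
    also have "\<dots> \<le> 2 * 2 powr 1 * L powr \<delta> * m"
      using \<delta>_le m by (intro mult_right_mono mult_left_mono powr_mono) auto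
    finally show ?thesis using X' by (simp add: X_def ennreal_leI)
  qed
  have "(\<integral>\<^sup>+x\<in>J. ennreal (\<sigma> x powr (1 + \<delta>)) \<partial>lebesgue) \<le>
     (\<integral>\<^sup>+x. (SUP n. ennreal (\<sigma> x) * indicator {0..1} x * ennreal (h (real (Suc n)) x powr \<delta>)) \<partial>lebesgue)"
  proof (rule nn_integral_mono)
    fix x
    obtain n where n: "\<sigma> x \<le> real n" using real_arch_simple by blast
    have "ennreal (\<sigma> x powr (1 + \<delta>)) * indicator J x \<le> ennreal (\<sigma> x) * indicator {0..1} x * ennreal (h (real (Suc n)) x powr \<delta>)"
    proof (cases "x \<in> J")
      case True
      then have "h (real (Suc n)) x = \<sigma> x" using n by (simp add: h_def)
      moreover have "\<sigma> x powr (1 + \<delta>) = \<sigma> x * \<sigma> x powr \<delta>"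
        using pos[of x] by (cases "\<sigma> x = 0") (auto simp: powr_add)
      moreover have "x \<in> {0..1}" using True J01 by auto
      ultimately show ?thesis using pos[of x] True by (simp add: ennreal_mult)
    qed simp
    also have "\<dots> \<le> (SUP n. ennreal (\<sigma> x) * indicator {0..1} x * ennreal (h (real (Suc n)) x powr \<delta>))"
      by (rule SUP_upper) simp
    finally show "ennreal (\<sigma> x powr (1 + \<delta>)) * indicator J x \<le> \<dots>" .
  qed
  also have "\<dots> = (SUP n. \<integral>\<^sup>+x. ennreal (\<sigma> x) * indicator {0..1} x * ennreal (h (real (Suc n)) x powr \<delta>) \<partial>lebesgue)"
  proof (rule nn_integral_monotone_convergence_SUP)
    show "incseq (\<lambda>n x. ennreal (\<sigma> x) * indicator {0..1} x * ennreal (h (real (Suc n)) x powr \<delta>))"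
    proof (intro incseq_SucI le_funI mult_left_mono ennreal_leI powr_mono2)
      fix n x
      show "h (real (Suc n)) x \<le> h (real (Suc (Suc n))) x" by (auto simp: h_def indicator_def)
    qed (use \<delta>_pos h_pos in auto)
  qed measurable
  also have "\<dots> \<le> ennreal (4 * L powr \<delta> * m)"
  proof (rule SUP_least)
    fix n
    have "(\<integral>\<^sup>+x. ennreal (\<sigma> x) * indicator {0..1} x * ennreal (h (real (Suc n)) x powr \<delta>) \<partial>lebesgue)
      = (\<integral>\<^sup>+x. ennreal (h (real (Suc n)) x powr \<delta>) \<partial>\<nu>)"
      unfolding \<nu>_def by (rule nn_integral_weight_measure[symmetric]) measurable
    also have "\<dots> \<le> ennreal (4 * L powr \<delta> * m)" by (rule main) simp
    finally show "(\<integral>\<^sup>+x. ennreal (\<sigma> x) * indicator {0..1} x * ennreal (h (real (Suc n)) x powr \<delta>) \<partial>lebesgue) \<le> \<dots>" .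
  qed
  finally show ?thesis by (simp add: L_def m_def J_def \<nu>_def)
qed

section \<open>The Muckenhoupt condition: self-improvement and reverse doubling\<close>

text \<open>
  The condition \<open>A\<^sub>r\<close> with the denominators cleared and raised to the power
  \<open>r\<close>: the averages of \<open>w\<close> and of the dual weight \<open>w powr (-1/(r-1))\<close>
  over \<open>I\<close> satisfy \<open>avg w * (avg dual) powr (r - 1) \<le> A\<close>.
\<close>

definition Ap_condition :: "(real \<Rightarrow> real) \<Rightarrow> real \<Rightarrow> real \<Rightarrow> bool" where
  "Ap_condition w r A \<longleftrightarrow> finite_measure (weight_measure (\<lambda>x. w x powr (- 1 / (r - 1)))) \<and>
    (\<forall>a b. 0 \<le> a \<longrightarrow> a < b \<longrightarrow> b \<le> 1 \<longrightarrow>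
      measure (weight_measure w) {a<..<b} *
        measure (weight_measure (\<lambda>x. w x powr (- 1 / (r - 1)))) {a<..<b} powr (r - 1)
      \<le> A * (b - a) powr r)"

lemma Ap_conditionD:
  assumes "Ap_condition w r A" "0 \<le> a" "a < b" "b \<le> 1"
  shows "measure (weight_measure w) {a<..<b} *
        measure (weight_measure (\<lambda>x. w x powr (- 1 / (r - 1)))) {a<..<b} powr (r - 1)
      \<le> A * (b - a) powr r"
  using assms unfolding Ap_condition_def by blast

lemma Ap_condition_mono:
  assumes Ap: "Ap_condition w r A" and "A \<le> B"
  shows "Ap_condition w r B"
  unfolding Ap_condition_def
proof (intro conjI allI impI)
  show "finite_measure (weight_measure (\<lambda>x. w x powr (- 1 / (r - 1))))" using Ap unfolding Ap_condition_def by blast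
  fix a b :: real assume "0 \<le> a" "a < b" "b \<le> 1"
  note Ap_conditionD[OF Ap this]
  also have "A * (b - a) powr r \<le> B * (b - a) powr r" using assms(2) by (intro mult_right_mono) auto
  finally show "measure (weight_measure w) {a<..<b} *
      measure (weight_measure (\<lambda>x. w x powr (- 1 / (r - 1)))) {a<..<b} powr (r - 1) \<le> B * (b - a) powr r" .
qed

lemma measure_weight_measure_pos:
  assumes w [measurable]: "w \<in> borel_measurable lebesgue" and pos: "\<And>x. 0 < w x"
    and fin: "finite_measure (weight_measure w)"
    and S [measurable]: "S \<in> sets lebesgue" and S01: "S \<subseteq> {0..1}" and S0: "emeasure lebesgue S \<noteq> 0"
  shows "0 < measure (weight_measure w) S"
proof (rule ccontr)
  interpret finite_measure "weight_measure w" by fact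
  assume "\<not> ?thesis"
  then have "measure (weight_measure w) S = 0" using measure_nonneg[of "weight_measure w" S] by linarith
  then have "emeasure (weight_measure w) S = 0" by (simp add: emeasure_eq_measure)
  then have "(\<integral>\<^sup>+x. ennreal (w x) * indicator {0..1} x * indicator S x \<partial>lebesgue) = 0"
    by (simp add: emeasure_weight_measure)
  then have "AE x in lebesgue. ennreal (w x) * indicator {0..1} x * indicator S x = 0"
    by (subst (asm) nn_integral_0_iff_AE) auto
  then have "AE x in lebesgue. x \<notin> S"
  proof eventually_elim
    case (elim x)
    then show ?case using pos[of x] S01 by (auto simp: indicator_def ennreal_eq_0_iff not_le split: if_splits)
  qed
  then show False using S0 by (simp add: AE_iff_measurable[OF S])
qed

lemma measure_weight_measure_interval_pos:
  assumes "w \<in> borel_measurable lebesgue" "\<And>x. 0 < w x" "finite_measure (weight_measure w)"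
    and "0 \<le> a" "a < b" "b \<le> 1"
  shows "0 < measure (weight_measure w) {a<..<b}"
  by (rule measure_weight_measure_pos) (use assms in auto)

text \<open>
  By Chebyshev, \<open>w\<close> is less than twice (a bound for) its average on at least half of the
  interval. There the dual weight, being a negative power of \<open>w\<close>, is bounded below by a multiple
  of its own average \<open>l\<close>, because the condition bounds the average of \<open>w\<close> by
  \<open>A * l powr - (r - 1)\<close>.
\<close>

lemma Ap_dense_level_sets:
  fixes w :: "real \<Rightarrow> real"
  assumes w [measurable]: "w \<in> borel_measurable lebesgue" and pos: "\<And>x. 0 < w x"
    and fin: "finite_measure (weight_measure w)"
    and r: "1 < r" and A: "0 < A" and Ap: "Ap_condition w r A"
    and \<sigma>: "\<sigma> = (\<lambda>x. w x powr (- 1 / (r - 1)))"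
    and cd: "0 \<le> c" "c < d" "d \<le> 1" and l: "measure (weight_measure \<sigma>) {c<..<d} = l * (d - c)"
  shows "d - c \<le> 2 * measure lebesgue {x\<in>{c<..<d}. (2 * A) powr (- 1 / (r - 1)) * l < \<sigma> x}"
proof -
  interpret finite_measure "weight_measure w" by fact
  have \<sigma>_meas: "\<sigma> \<in> borel_measurable lebesgue" unfolding \<sigma> by measurable
  have \<sigma>_pos: "0 < \<sigma> x" for x using pos[of x] by (simp add: \<sigma>)
  have fin\<sigma>: "finite_measure (weight_measure \<sigma>)" using Ap unfolding Ap_condition_def \<sigma> by blast
  have "0 < l * (d - c)" using measure_weight_measure_interval_pos[OF \<sigma>_meas \<sigma>_pos fin\<sigma> cd] l by simp
  then have l0: "l > 0" using cd by (simp add: zero_less_mult_iff)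
  define m where "m = measure (weight_measure w) {c<..<d}"
  define H where "H = 2 * A * l powr - (r - 1)"
  have H: "H > 0" using A l0 by (simp add: H_def)
  have "m * (l * (d - c)) powr (r - 1) \<le> A * (d - c) powr r"
    using Ap_conditionD[OF Ap cd] unfolding l[symmetric] m_def \<sigma> .
  also have "(l * (d - c)) powr (r - 1) = l powr (r - 1) * (d - c) powr (r - 1)" by (rule powr_mult)
  also have "(d - c) powr r = (d - c) powr (r - 1) * (d - c)"
    using cd powr_add[of "d - c" "r - 1" 1] by simp
  finally have "(d - c) powr (r - 1) * (m * l powr (r - 1)) \<le> (d - c) powr (r - 1) * (A * (d - c))"
    by (simp add: mult_ac)
  then have "m * l powr (r - 1) \<le> A * (d - c)" using cd by simp
  then have "m * l powr (r - 1) * l powr - (r - 1) \<le> A * (d - c) * l powr - (r - 1)"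
    by (rule mult_right_mono) simp
  then have m: "2 * m \<le> H * (d - c)"
    using l0 by (simp add: H_def mult.assoc mult_ac flip: powr_add)
  define B where "B = {x\<in>{c<..<d}. w x < H}"
  define C where "C = {x\<in>{c<..<d}. H \<le> w x}"
  have Bs [measurable]: "B \<in> sets lebesgue" and Cs [measurable]: "C \<in> sets lebesgue"
    unfolding B_def C_def by (rule sets_lebesgue_Collect_Ioo; measurable)+
  have fm: "S \<in> lmeasurable" if "S \<in> sets lebesgue" "S \<subseteq> {c<..<d}" for S
    by (rule fmeasurableI2[OF _ that(2,1)]) simp
  have Cf: "C \<in> lmeasurable" and Bf: "B \<in> lmeasurable" by (rule fm[OF Cs], force simp: C_def) (rule fm[OF Bs], force simp: B_def)
  have "ennreal H * emeasure lebesgue C = (\<integral>\<^sup>+x. ennreal H * indicator C x \<partial>lebesgue)"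
    by (simp add: nn_integral_cmult)
  also have "\<dots> \<le> (\<integral>\<^sup>+x. ennreal (w x) * indicator {0..1} x * indicator {c<..<d} x \<partial>lebesgue)"
    using cd by (intro nn_integral_mono) (auto simp: C_def indicator_def ennreal_leI)
  also have "\<dots> = ennreal m" by (simp add: m_def emeasure_eq_measure flip: emeasure_weight_measure)
  finally have "ennreal (H * measure lebesgue C) \<le> ennreal m"
    using H Cf by (simp add: emeasure_eq_measure2 ennreal_mult)
  then have "H * measure lebesgue C \<le> m" by (simp add: m_def)
  then have "H * (2 * measure lebesgue C) \<le> H * (d - c)" using m by simp
  then have C: "2 * measure lebesgue C \<le> d - c" using H by simp
  have "d - c = measure lebesgue (B \<union> C)"
  proof -
    have "B \<union> C = {c<..<d}" by (auto simp: B_def C_def)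
    then show ?thesis using cd by simp
  qed
  also have "\<dots> \<le> measure lebesgue B + measure lebesgue C"
    using Bf Cf by (intro measure_Un_le) auto
  finally have "d - c \<le> 2 * measure lebesgue B" using C by simp
  moreover have "measure lebesgue B \<le> measure lebesgue {x\<in>{c<..<d}. (2 * A) powr (- 1 / (r - 1)) * l < \<sigma> x}"
  proof (rule measure_mono_fmeasurable)
    show "B \<subseteq> {x\<in>{c<..<d}. (2 * A) powr (- 1 / (r - 1)) * l < \<sigma> x}"
    proof
      fix x assume x: "x \<in> B"
      then have "H powr (- 1 / (r - 1)) < w x powr (- 1 / (r - 1))"
        using pos[of x] r by (intro powr_less_mono2_neg) (auto simp: B_def)
      moreover have "H powr (- 1 / (r - 1)) = (2 * A) powr (- 1 / (r - 1)) * l"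
      proof -
        have "H powr (- 1 / (r - 1)) = (2 * A) powr (- 1 / (r - 1)) * (l powr - (r - 1)) powr (- 1 / (r - 1))"
          unfolding H_def by (rule powr_mult)
        moreover have "- (r - 1) * (- 1 / (r - 1)) = 1" using r by (simp add: divide_simps)
        ultimately show ?thesis using l0 by (simp only: powr_powr powr_one)
      qed
      ultimately show "x \<in> {x\<in>{c<..<d}. (2 * A) powr (- 1 / (r - 1)) * l < \<sigma> x}"
        using x by (simp add: B_def \<sigma>)
    qed
    show "{x\<in>{c<..<d}. (2 * A) powr (- 1 / (r - 1)) * l < \<sigma> x} \<in> lmeasurable"
    proof (rule fm[OF sets_lebesgue_Collect_Ioo])
      show "Measurable.pred lebesgue (\<lambda>x. (2 * A) powr (- 1 / (r - 1)) * l < \<sigma> x)"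
        using \<sigma>_meas by measurable
    qed auto
  qed (rule Bs)
  ultimately show ?thesis by linarith
qed

text \<open>
  The reverse Hoelder inequality raises the dual weight \<open>\<sigma> = w powr (-1/(r-1))\<close> to the
  power \<open>1 + \<delta>\<close>, and \<open>\<sigma> powr (1 + \<delta>)\<close> is the dual weight for
  the exponent \<open>\<rho>\<close> determined by \<open>(\<rho> - 1) (1 + \<delta>) = r - 1\<close>.
\<close>

lemma Ap_condition_open:
  fixes w :: "real \<Rightarrow> real"
  assumes w [measurable]: "w \<in> borel_measurable lebesgue" and pos: "\<And>x. 0 < w x"
    and fin: "finite_measure (weight_measure w)"
    and r: "1 < r" and Ap: "Ap_condition w r A"
  obtains \<rho> B where "1 < \<rho>" "\<rho> < r" "0 < B" "Ap_condition w \<rho> B"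
proof -
  define A' where "A' = max A 1"
  have A': "A' \<ge> 1" by (simp add: A'_def)
  have Ap': "Ap_condition w r A'" using Ap by (rule Ap_condition_mono) (simp add: A'_def)
  define \<sigma> where "\<sigma> = (\<lambda>x. w x powr (- 1 / (r - 1)))"
  have \<sigma>_meas [measurable]: "\<sigma> \<in> borel_measurable lebesgue" unfolding \<sigma>_def by measurable
  have \<sigma>_pos: "0 < \<sigma> x" for x using pos[of x] by (simp add: \<sigma>_def)
  have fin\<sigma>: "finite_measure (weight_measure \<sigma>)" using Ap unfolding Ap_condition_def \<sigma>_def by blast
  define \<kappa> where "\<kappa> = (2 * A') powr (- 1 / (r - 1))"
  have \<kappa>: "0 < \<kappa>" "\<kappa> \<le> 1"
  proof -
    show "0 < \<kappa>" using A' by (simp add: \<kappa>_def)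
    have "(2 * A') powr (- 1 / (r - 1)) \<le> 1 powr (- 1 / (r - 1))" using A' r by (intro powr_mono2') auto
    then show "\<kappa> \<le> 1" by (simp add: \<kappa>_def)
  qed
  define \<delta> where "\<delta> = \<kappa>\<^sup>2 / 16"
  have \<delta>: "\<delta> > 0" using \<kappa> by (simp add: \<delta>_def)
  define \<rho> where "\<rho> = 1 + (r - 1) / (1 + \<delta>)"
  have \<rho>: "1 < \<rho>" "\<rho> < r" "(\<rho> - 1) * (1 + \<delta>) = r - 1" using r \<delta> by (auto simp: \<rho>_def field_simps)
  have \<tau>: "w x powr (- 1 / (\<rho> - 1)) = \<sigma> x powr (1 + \<delta>)" for x
  proof -
    have "- 1 / (r - 1) * (1 + \<delta>) = - 1 / (\<rho> - 1)" using \<delta> r by (simp add: \<rho>_def field_simps)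
    then show ?thesis unfolding \<sigma>_def powr_powr by simp
  qed
  define \<tau>m where "\<tau>m = weight_measure (\<lambda>x. w x powr (- 1 / (\<rho> - 1)))"
  have em: "emeasure \<tau>m {a<..<b} \<le> ennreal (4 * (measure (weight_measure \<sigma>) {a<..<b} / (b - a)) powr \<delta> * measure (weight_measure \<sigma>) {a<..<b})"
    if ab: "0 \<le> a" "a < b" "b \<le> 1" for a b
  proof -
    have "emeasure \<tau>m {a<..<b} = (\<integral>\<^sup>+x\<in>{a<..<b}. ennreal (\<sigma> x powr (1 + \<delta>)) \<partial>lebesgue)"
      unfolding \<tau>m_def \<tau> using ab
      by (subst emeasure_weight_measure) (auto intro!: nn_integral_cong simp: indicator_def)
    also have "\<dots> \<le> ennreal (4 * (measure (weight_measure \<sigma>) {a<..<b} / (b - a)) powr \<delta> * measure (weight_measure \<sigma>) {a<..<b})"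
    proof (rule reverse_Hoelder_of_dense_level_sets[where \<kappa> = \<kappa>])
      show "0 < measure (weight_measure \<sigma>) {a<..<b}"
        by (rule measure_weight_measure_interval_pos[OF \<sigma>_meas \<sigma>_pos fin\<sigma> ab])
      fix c d l :: real assume cd: "a \<le> c" "c < d" "d \<le> b" "measure (weight_measure \<sigma>) {c<..<d} = l * (d - c)"
      show "d - c \<le> 2 * measure lebesgue {x\<in>{c<..<d}. \<kappa> * l < \<sigma> x}"
        unfolding \<kappa>_def by (rule Ap_dense_level_sets[OF w pos fin r _ Ap' \<sigma>_def]) (use cd ab A' in auto)
    qed (use \<sigma>_meas \<sigma>_pos[THEN less_imp_le] fin\<sigma> ab \<kappa> \<delta>_def in auto)
    finally show ?thesis .
  qed
  have fin\<tau>: "finite_measure \<tau>m"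
  proof (rule finite_measureI)
    have "emeasure \<tau>m (space \<tau>m) = (\<integral>\<^sup>+x. ennreal (w x powr (- 1 / (\<rho> - 1))) * indicator {0..1} x * indicator UNIV x \<partial>lebesgue)"
      unfolding \<tau>m_def by (subst emeasure_weight_measure) auto
    also have "\<dots> = (\<integral>\<^sup>+x. ennreal (w x powr (- 1 / (\<rho> - 1))) * indicator {0..1} x * indicator {0<..<1} x \<partial>lebesgue)"
    proof (rule nn_integral_cong_AE)
      have "AE x in lebesgue. x \<noteq> (0::real)" "AE x in lebesgue. x \<noteq> (1::real)"
        by (rule AE_completion[OF AE_lborel_singleton])+
      then show "AE x in lebesgue. ennreal (w x powr (- 1 / (\<rho> - 1))) * indicator {0..1} x * indicator UNIV x =
        ennreal (w x powr (- 1 / (\<rho> - 1))) * indicator {0..1} x * indicator {0<..<1} x"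
        by eventually_elim (auto simp: indicator_def)
    qed
    also have "\<dots> = emeasure \<tau>m {0<..<1}" unfolding \<tau>m_def by (subst emeasure_weight_measure) auto
    also have "\<dots> < \<infinity>" using le_less_trans[OF em[of 0 1] ennreal_less_top] by simp
    finally show "emeasure \<tau>m (space \<tau>m) \<noteq> \<infinity>" by simp
  qed
  interpret \<tau>m: finite_measure \<tau>m by fact
  have "Ap_condition w \<rho> (4 powr (\<rho> - 1) * A')"
    unfolding Ap_condition_def \<tau>m_def[symmetric]
  proof (intro conjI allI impI fin\<tau>)
    fix a b :: real assume ab: "0 \<le> a" "a < b" "b \<le> 1"
    define s where "s = measure (weight_measure \<sigma>) {a<..<b}"
    define m where "m = measure (weight_measure w) {a<..<b}"
    define \<Delta> where "\<Delta> = b - a"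
    have \<Delta>: "\<Delta> > 0" using ab by (simp add: \<Delta>_def)
    have s: "s > 0" unfolding s_def by (rule measure_weight_measure_interval_pos[OF \<sigma>_meas \<sigma>_pos fin\<sigma> ab])
    have "measure \<tau>m {a<..<b} \<le> 4 * (s / \<Delta>) powr \<delta> * s"
      using em[OF ab] s \<Delta> unfolding s_def[symmetric] \<Delta>_def[symmetric] \<tau>m.emeasure_eq_measure by (subst (asm) ennreal_le_iff) auto
    also have "\<dots> = 4 * (s powr (1 + \<delta>) * \<Delta> powr - \<delta>)"
      using s \<Delta> by (simp add: powr_divide powr_add powr_minus_divide)
    finally have "measure \<tau>m {a<..<b} powr (\<rho> - 1) \<le> (4 * (s powr (1 + \<delta>) * \<Delta> powr - \<delta>)) powr (\<rho> - 1)"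
      using \<rho> by (intro powr_mono2) auto
    also have "\<dots> = 4 powr (\<rho> - 1) * (s powr (r - 1) * \<Delta> powr (- \<delta> * (\<rho> - 1)))"
      using \<rho>(3) by (simp add: powr_mult powr_powr mult.commute)
    finally have "m * measure \<tau>m {a<..<b} powr (\<rho> - 1) \<le> m * (4 powr (\<rho> - 1) * (s powr (r - 1) * \<Delta> powr (- \<delta> * (\<rho> - 1))))"
      by (rule mult_left_mono) (simp add: m_def)
    also have "\<dots> = 4 powr (\<rho> - 1) * \<Delta> powr (- \<delta> * (\<rho> - 1)) * (m * s powr (r - 1))" by simp
    also have "\<dots> \<le> 4 powr (\<rho> - 1) * \<Delta> powr (- \<delta> * (\<rho> - 1)) * (A' * \<Delta> powr r)"
      unfolding m_def s_def \<Delta>_def \<sigma>_def by (intro mult_left_mono Ap_conditionD[OF Ap' ab]) simp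
    also have "\<dots> = 4 powr (\<rho> - 1) * A' * \<Delta> powr (- \<delta> * (\<rho> - 1) + r)"
      unfolding powr_add by (simp only: mult_ac)
    also have "- \<delta> * (\<rho> - 1) + r = \<rho>" using \<rho>(3) by (simp add: algebra_simps)
    finally show "measure (weight_measure w) {a<..<b} * measure \<tau>m {a<..<b} powr (\<rho> - 1) \<le> 4 powr (\<rho> - 1) * A' * (b - a) powr \<rho>"
      by (simp add: m_def \<Delta>_def)
  qed
  then show ?thesis using that[of \<rho> "4 powr (\<rho> - 1) * A'"] \<rho> A' by simp
qed

text \<open>
  The complement \<open>F\<close> of \<open>(c, d)\<close> in \<open>(a, b)\<close> has at least half the
  length, and a subset of comparable length carries a comparable share of the mass: write \<open>1 = w powr
  (1/r) * w powr (-1/r)\<close> on \<open>F\<close> and apply the inequality of Hoelder and the condition. So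
  \<open>F\<close> takes away a fixed proportion of the mass.
\<close>

lemma Ap_reverse_doubling:
  fixes w :: "real \<Rightarrow> real"
  assumes w [measurable]: "w \<in> borel_measurable lebesgue" and pos: "\<And>x. 0 < w x"
    and fin: "finite_measure (weight_measure w)"
    and r: "1 < r" and A: "0 < A" and Ap: "Ap_condition w r A"
    and ab: "0 \<le> a" "a \<le> c" "c < d" "d \<le> b" "b \<le> 1" and half: "2 * (d - c) \<le> b - a"
  shows "measure (weight_measure w) {c<..<d} \<le> (1 - 1 / (2 powr r * A)) * measure (weight_measure w) {a<..<b}"
proof -
  interpret finite_measure "weight_measure w" by fact
  define \<sigma> where "\<sigma> = (\<lambda>x. w x powr (- 1 / (r - 1)))"
  have \<sigma>_meas [measurable]: "\<sigma> \<in> borel_measurable lebesgue" unfolding \<sigma>_def by measurable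
  have \<sigma>_pos: "0 < \<sigma> x" for x using pos[of x] by (simp add: \<sigma>_def)
  have fin\<sigma>: "finite_measure (weight_measure \<sigma>)" using Ap unfolding Ap_condition_def \<sigma>_def by blast
  interpret \<sigma>: finite_measure "weight_measure \<sigma>" by fact
  define F where "F = {a<..<b} - {c<..<d}"
  have Fs [measurable]: "F \<in> sets lebesgue" by (simp add: F_def)
  have F01: "F \<subseteq> {0..1}" using ab by (auto simp: F_def)
  have Flen: "measure lebesgue F = (b - a) - (d - c)"
    unfolding F_def using ab by (subst measurable_measure_Diff) auto
  define \<Delta> where "\<Delta> = b - a"
  have \<Delta>: "\<Delta> > 0" using ab by (simp add: \<Delta>_def)
  have Ff: "F \<in> lmeasurable" by (rule fmeasurableI2[of "{a<..<b}"]) (auto simp: F_def)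
  have eF: "emeasure lebesgue F = ennreal (measure lebesgue F)" using Ff by (rule emeasure_eq_measure2)
  have Fpos: "measure lebesgue F \<ge> \<Delta> / 2" using Flen half by (simp add: \<Delta>_def)
  define f where "f = measure (weight_measure w) F"
  have f: "f > 0" unfolding f_def using Fpos \<Delta> eF
    by (intro measure_weight_measure_pos[OF w pos fin Fs F01]) auto
  define s where "s = measure (weight_measure \<sigma>) {a<..<b}"
  have s: "s > 0" unfolding s_def using ab by (intro measure_weight_measure_interval_pos[OF \<sigma>_meas \<sigma>_pos fin\<sigma>]) auto
  define m where "m = measure (weight_measure w) {a<..<b}"
  have m: "m > 0" unfolding m_def using ab by (intro measure_weight_measure_interval_pos[OF w pos fin]) auto
  define b' where "b' = r / (r - 1)"
  have b': "1 < b'" "1 / r + 1 / b' = 1" using r by (auto simp: b'_def field_simps)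
  have "ennreal (measure lebesgue F) = (\<integral>\<^sup>+x. indicator F x \<partial>lebesgue)" by (simp add: eF)
  also have "\<dots> = (\<integral>\<^sup>+x. ennreal ((w x powr (1 / r) * indicator F x) * (w x powr (- 1 / r) * indicator F x)) \<partial>lebesgue)"
  proof (rule nn_integral_cong)
    fix x
    have "w x powr (1 / r) * w x powr (- 1 / r) = 1"
      using pos[of x] by (simp flip: powr_add add: add_divide_distrib[symmetric])
    then show "indicator F x = ennreal ((w x powr (1 / r) * indicator F x) * (w x powr (- 1 / r) * indicator F x))"
      by (auto simp: indicator_def)
  qed
  also have "\<dots> \<le> ennreal (f powr (1 / r) * s powr (1 / b'))"
  proof (rule nn_integral_Hoelder)
    have "(\<integral>\<^sup>+x. ennreal ((w x powr (1 / r) * indicator F x) powr r) \<partial>lebesgue) = emeasure (weight_measure w) F"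
      unfolding emeasure_weight_measure[OF w Fs]
    proof (rule nn_integral_cong)
      fix x show "ennreal ((w x powr (1 / r) * indicator F x) powr r) = ennreal (w x) * indicator {0..1} x * indicator F x"
        using F01 pos[of x] r by (cases "x \<in> F") (auto simp: powr_powr)
    qed
    then show "(\<integral>\<^sup>+x. ennreal ((w x powr (1 / r) * indicator F x) powr r) \<partial>lebesgue) \<le> ennreal f"
      by (simp add: f_def emeasure_eq_measure)
    have "(\<integral>\<^sup>+x. ennreal ((w x powr (- 1 / r) * indicator F x) powr b') \<partial>lebesgue) \<le> emeasure (weight_measure \<sigma>) {a<..<b}"
    proof -
      have "(\<integral>\<^sup>+x. ennreal ((w x powr (- 1 / r) * indicator F x) powr b') \<partial>lebesgue) \<le>
        (\<integral>\<^sup>+x. ennreal (\<sigma> x) * indicator {0..1} x * indicator {a<..<b} x \<partial>lebesgue)"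
      proof (rule nn_integral_mono)
        fix x
        have "- 1 / r * b' = - 1 / (r - 1)" using r by (simp add: b'_def field_simps)
        then have "(w x powr (- 1 / r)) powr b' = \<sigma> x" by (simp add: \<sigma>_def powr_powr)
        then show "ennreal ((w x powr (- 1 / r) * indicator F x) powr b') \<le> ennreal (\<sigma> x) * indicator {0..1} x * indicator {a<..<b} x"
          using F01 by (cases "x \<in> F") (auto simp: F_def indicator_def)
      qed
      then show ?thesis by (simp add: emeasure_weight_measure)
    qed
    then show "(\<integral>\<^sup>+x. ennreal ((w x powr (- 1 / r) * indicator F x) powr b') \<partial>lebesgue) \<le> ennreal s"
      by (simp add: s_def \<sigma>.emeasure_eq_measure)
  qed (use r b' f s in auto)
  finally have "measure lebesgue F \<le> f powr (1 / r) * s powr (1 / b')" by (subst (asm) ennreal_le_iff) auto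
  then have "\<Delta> / 2 \<le> f powr (1 / r) * s powr (1 / b')" using Fpos by simp
  then have "(\<Delta> / 2) powr r \<le> (f powr (1 / r) * s powr (1 / b')) powr r"
    using \<Delta> r by (intro powr_mono2) auto
  also have "\<dots> = f * s powr (r - 1)"
    using r f by (simp add: powr_mult powr_powr b'_def)
  finally have 1: "(\<Delta> / 2) powr r \<le> f * s powr (r - 1)" .
  have "m * (\<Delta> / 2) powr r \<le> m * (f * s powr (r - 1))" by (rule mult_left_mono[OF 1]) (use m in simp)
  also have "\<dots> = f * (m * s powr (r - 1))" by simp
  also have "\<dots> \<le> f * (A * \<Delta> powr r)"
    unfolding m_def s_def \<Delta>_def \<sigma>_def using ab f by (intro mult_left_mono Ap_conditionD[OF Ap]) auto
  finally have "m * (\<Delta> powr r / 2 powr r) \<le> f * A * \<Delta> powr r" using \<Delta> by (simp add: powr_divide)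
  then have "m / (2 powr r * A) \<le> f" using \<Delta> A by (simp add: field_simps)
  moreover have "m = measure (weight_measure w) {c<..<d} + f"
  proof -
    have "{a<..<b} = {c<..<d} \<union> F" using ab by (auto simp: F_def)
    then have "m = measure (weight_measure w) ({c<..<d} \<union> F)" by (simp add: m_def)
    also have "\<dots> = measure (weight_measure w) {c<..<d} + f"
      unfolding f_def by (rule finite_measure_Union) (auto simp: F_def)
    finally show ?thesis .
  qed
  ultimately show ?thesis by (simp add: m_def algebra_simps)
qed

section \<open>A local estimate and the summation over scales\<close>

lemma reverse_doubling_constant:
  assumes "1 < (r::real)" "1 \<le> A"
  shows "0 < 1 - 1 / (2 powr r * A)" "1 - 1 / (2 powr r * A) < 1"
proof -
  have "(2::real) powr 0 < 2 powr r" using assms by (intro powr_less_mono) auto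
  also have "2 powr r * 1 \<le> 2 powr r * A" using assms by (intro mult_left_mono) auto
  finally have "2 powr r * A > 1" by simp
  then show "0 < 1 - 1 / (2 powr r * A)" "1 - 1 / (2 powr r * A) < 1" using assms by (auto simp: field_simps)
qed

text \<open>
  The point where the exponents fit: by Hoelder applied to the factors \<open>f * w powr (1/s)\<close> and
  \<open>w powr (\<alpha> - 1/s)\<close>, the second factor is raised to the power \<open>s/(s-1)\<close>, and
  \<open>(\<alpha> - 1/s) s/(s-1) = -1/(r-1)\<close>. It thus becomes the dual weight, whose mass the
  condition bounds in terms of that of \<open>w\<close>.
\<close>

lemma Ap_local_estimate:
  fixes w f :: "real \<Rightarrow> real"
  assumes w [measurable]: "w \<in> borel_measurable lebesgue" and pos: "\<And>x. 0 < w x"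
    and fin: "finite_measure (weight_measure w)"
    and s: "1 < s" "\<alpha> * s < 1" and r: "r = 1 + (s - 1) / (1 - \<alpha> * s)"
    and A: "0 < A" and Ap: "Ap_condition w r A"
    and ab: "0 \<le> a" "a < b" "b \<le> 1"
    and f [measurable]: "f \<in> borel_measurable lebesgue" and f0: "\<And>x. 0 \<le> f x" and B: "0 < B"
    and fB: "(\<integral>\<^sup>+x\<in>{a<..<b}. ennreal (f x powr s) \<partial>weight_measure w) \<le> ennreal B"
  shows "(\<integral>\<^sup>+x\<in>{a<..<b}. ennreal (f x * w x powr \<alpha>) \<partial>lebesgue) \<le>
    ennreal (A powr (1 / s - \<alpha>) * (b - a) powr (1 - \<alpha>) *
      measure (weight_measure w) {a<..<b} powr (\<alpha> - 1 / s) * B powr (1 / s))"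
proof -
  define \<sigma> where "\<sigma> = (\<lambda>x. w x powr (- 1 / (r - 1)))"
  have \<sigma>_meas [measurable]: "\<sigma> \<in> borel_measurable lebesgue" unfolding \<sigma>_def by measurable
  have \<sigma>_pos: "0 < \<sigma> x" for x using pos[of x] by (simp add: \<sigma>_def)
  have fin\<sigma>: "finite_measure (weight_measure \<sigma>)" using Ap unfolding Ap_condition_def \<sigma>_def by blast
  interpret \<sigma>: finite_measure "weight_measure \<sigma>" by fact
  define S where "S = measure (weight_measure \<sigma>) {a<..<b}"
  have S: "S > 0" unfolding S_def by (rule measure_weight_measure_interval_pos[OF \<sigma>_meas \<sigma>_pos fin\<sigma> ab])
  define m where "m = measure (weight_measure w) {a<..<b}"
  have m: "m > 0" unfolding m_def by (rule measure_weight_measure_interval_pos[OF w pos fin ab])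
  define s' where "s' = s / (s - 1)"
  have s': "1 < s'" "1 / s + 1 / s' = 1" using s by (auto simp: s'_def field_simps)
  define e where "e = 1 / s - \<alpha>"
  have e: "e > 0" using s by (simp add: e_def field_simps)
  have r1: "r > 1" using s by (simp add: r)
  have ind [measurable]: "{a<..<b} \<in> sets lebesgue" "{0..1::real} \<in> sets lebesgue" by simp_all
  have "(\<integral>\<^sup>+x\<in>{a<..<b}. ennreal (f x * w x powr \<alpha>) \<partial>lebesgue) =
    (\<integral>\<^sup>+x. ennreal ((f x * w x powr (1 / s) * indicator {a<..<b} x) * (w x powr (\<alpha> - 1 / s) * indicator {a<..<b} x)) \<partial>lebesgue)"
  proof (rule nn_integral_cong)
    fix x
    have "w x powr (1 / s) * w x powr (\<alpha> - 1 / s) = w x powr \<alpha>"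
      by (simp flip: powr_add)
    then show "ennreal (f x * w x powr \<alpha>) * indicator {a<..<b} x =
      ennreal ((f x * w x powr (1 / s) * indicator {a<..<b} x) * (w x powr (\<alpha> - 1 / s) * indicator {a<..<b} x))"
      by (auto simp: indicator_def mult.assoc)
  qed
  also have "\<dots> \<le> ennreal (B powr (1 / s) * S powr (1 / s'))"
  proof (rule nn_integral_Hoelder)
    have "(\<integral>\<^sup>+x. ennreal ((f x * w x powr (1 / s) * indicator {a<..<b} x) powr s) \<partial>lebesgue)
      = (\<integral>\<^sup>+x\<in>{a<..<b}. ennreal (f x powr s) \<partial>weight_measure w)"
    proof -
      have "(\<integral>\<^sup>+x\<in>{a<..<b}. ennreal (f x powr s) \<partial>weight_measure w) =
        (\<integral>\<^sup>+x. ennreal (w x) * indicator {0..1} x * (ennreal (f x powr s) * indicator {a<..<b} x) \<partial>lebesgue)"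
        by (rule nn_integral_weight_measure) measurable
      also have "\<dots> = (\<integral>\<^sup>+x. ennreal ((f x * w x powr (1 / s) * indicator {a<..<b} x) powr s) \<partial>lebesgue)"
      proof (rule nn_integral_cong)
        fix x
        have "(f x * w x powr (1 / s)) powr s = w x * f x powr s"
          using pos[of x] s by (simp add: powr_mult powr_powr)
        then show "ennreal (w x) * indicator {0..1} x * (ennreal (f x powr s) * indicator {a<..<b} x) =
           ennreal ((f x * w x powr (1 / s) * indicator {a<..<b} x) powr s)"
          using ab pos[of x] by (auto simp: indicator_def ennreal_mult)
      qed
      finally show ?thesis by simp
    qed
    then show "(\<integral>\<^sup>+x. ennreal ((f x * w x powr (1 / s) * indicator {a<..<b} x) powr s) \<partial>lebesgue) \<le> ennreal B"
      using fB by simp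
    have "(\<integral>\<^sup>+x. ennreal ((w x powr (\<alpha> - 1 / s) * indicator {a<..<b} x) powr s') \<partial>lebesgue) = emeasure (weight_measure \<sigma>) {a<..<b}"
      unfolding emeasure_weight_measure[OF \<sigma>_meas ind(1)]
    proof (rule nn_integral_cong)
      fix x
      have "(\<alpha> - 1 / s) * s' = - 1 / (r - 1)" using s by (simp add: s'_def r field_simps)
      then have "(w x powr (\<alpha> - 1 / s)) powr s' = \<sigma> x" by (simp add: \<sigma>_def powr_powr)
      then show "ennreal ((w x powr (\<alpha> - 1 / s) * indicator {a<..<b} x) powr s') = ennreal (\<sigma> x) * indicator {0..1} x * indicator {a<..<b} x"
        using ab by (auto simp: indicator_def)
    qed
    then show "(\<integral>\<^sup>+x. ennreal ((w x powr (\<alpha> - 1 / s) * indicator {a<..<b} x) powr s') \<partial>lebesgue) \<le> ennreal S"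
      by (simp add: S_def \<sigma>.emeasure_eq_measure)
  qed (use s s' f0 S B in auto)
  also have "\<dots> \<le> ennreal (A powr e * (b - a) powr (1 - \<alpha>) * m powr - e * B powr (1 / s))"
  proof (rule ennreal_leI)
    have "m * S powr (r - 1) \<le> A * (b - a) powr r"
      using Ap_conditionD[OF Ap ab] unfolding m_def S_def \<sigma>_def .
    then have "S powr (r - 1) \<le> A * (b - a) powr r / m" using m by (simp add: field_simps)
    then have "(S powr (r - 1)) powr (e / 1) \<le> (A * (b - a) powr r / m) powr (e / 1)"
      using e by (intro powr_mono2) auto
    moreover have "(S powr (r - 1)) powr (e / 1) = S powr (1 / s')"
    proof -
      have "(r - 1) * e = 1 / s'" using s by (simp add: r e_def s'_def field_simps)
      then show ?thesis by (simp add: powr_powr)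
    qed
    moreover have "(A * (b - a) powr r / m) powr (e / 1) = A powr e * (b - a) powr (1 - \<alpha>) * m powr - e"
    proof -
      have "r * e = 1 - \<alpha>" using s by (simp add: r e_def field_simps)
      then have "((b - a) powr r) powr e = (b - a) powr (1 - \<alpha>)" by (simp add: powr_powr)
      then show ?thesis using A m ab by (simp add: powr_mult powr_divide powr_minus_divide)
    qed
    ultimately have "S powr (1 / s') \<le> A powr e * (b - a) powr (1 - \<alpha>) * m powr - e" by simp
    then show "B powr (1 / s) * S powr (1 / s') \<le> A powr e * (b - a) powr (1 - \<alpha>) * m powr - e * B powr (1 / s)"
      by (subst mult.commute) (rule mult_right_mono, auto)
  qed
  finally show ?thesis by (simp add: m_def e_def)
qed

text \<open>
  A telescoping argument which does not need to know for which \<open>k\<close> the value 1 is passed.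
\<close>

lemma sum_geometric_below_one:
  fixes v :: "nat \<Rightarrow> real"
  assumes v: "\<And>k. 0 \<le> v k" "\<And>k. v (Suc k) \<le> \<rho> * v k" and \<rho>: "0 < \<rho>" "\<rho> < 1"
  shows "(\<Sum>k<n. if v k \<le> 1 then v k else 0) \<le> 1 / (1 - \<rho>)"
proof -
  have step: "(1 - \<rho>) * (if v k \<le> 1 then v k else 0) \<le> min (v k) 1 - min (v (Suc k)) 1" for k
  proof -
    have "v (Suc k) \<le> v k" using v(2)[of k] mult_right_mono[of \<rho> 1 "v k"] v(1)[of k] \<rho> by simp
    then show ?thesis using v(2)[of k] by (auto simp: algebra_simps min_def)
  qed
  have "(1 - \<rho>) * (\<Sum>k<n. if v k \<le> 1 then v k else 0) \<le> (\<Sum>k<n. min (v k) 1 - min (v (Suc k)) 1)"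
    unfolding sum_distrib_left by (rule sum_mono) (rule step)
  also have "\<dots> = min (v 0) 1 - min (v n) 1" by (rule sum_lessThan_telescope')
  also have "\<dots> \<le> 1" using v(1)[of n] by (simp add: min_def)
  finally show ?thesis using \<rho> by (simp add: field_simps)
qed

lemma sum_geometric_growth_below_one:
  fixes v :: "nat \<Rightarrow> real"
  assumes v: "\<And>k. 0 \<le> v k" "\<And>k. v k \<le> \<rho> * v (Suc k)" and \<rho>: "0 < \<rho>" "\<rho> < 1"
  shows "(\<Sum>k<n. if v k \<le> 1 then v k else 0) \<le> 1 / (1 - \<rho>)"
proof -
  define \<Phi> where "\<Phi> k = min (\<rho> * v k) 1" for k
  have step: "(1 - \<rho>) * (if v k \<le> 1 then v k else 0) \<le> \<Phi> (Suc k) - \<Phi> k" for k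
  proof -
    have "\<rho> * v (Suc k) \<le> v (Suc k)" using mult_right_mono[of \<rho> 1 "v (Suc k)"] v(1) \<rho> by simp
    then have "v k \<le> v (Suc k)" using v(2)[of k] by simp
    then have "\<rho> * v k \<le> \<rho> * v (Suc k)" using \<rho> by simp
    then show ?thesis using v(2)[of k] by (auto simp: algebra_simps min_def \<Phi>_def)
  qed
  have "(1 - \<rho>) * (\<Sum>k<n. if v k \<le> 1 then v k else 0) \<le> (\<Sum>k<n. \<Phi> (Suc k) - \<Phi> k)"
    unfolding sum_distrib_left by (rule sum_mono) (rule step)
  also have "\<dots> = \<Phi> n - \<Phi> 0" by (rule sum_lessThan_telescope)
  also have "\<dots> \<le> 1"
  proof -
    have "0 \<le> \<Phi> 0" "\<Phi> n \<le> 1" using v(1)[of 0] \<rho> by (auto simp: \<Phi>_def)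
    then show ?thesis by linarith
  qed
  finally show ?thesis using \<rho> by (simp add: field_simps)
qed

text \<open>
  As functions of \<open>m k\<close>, one of the two terms increases, the other decreases, and they agree at a
  single value \<open>R\<close>, where both are equal to \<open>T powr (\<beta>/(\<alpha> + \<beta>)) * N powr
  (\<alpha>/(\<alpha> + \<beta>))\<close>. Relative to this number, the minimum decays geometrically on either
  side of \<open>R\<close>.
\<close>

lemma Hedberg_sum:
  fixes m :: "nat \<Rightarrow> real"
  assumes m: "\<And>k. 0 < m k" "\<And>k. m (Suc k) \<le> \<gamma> * m k" and \<gamma>: "0 < \<gamma>" "\<gamma> < 1"
    and \<alpha>\<beta>: "0 < \<alpha>" "0 < \<beta>" and TN: "0 < T" "0 < N"
  shows "(\<Sum>k<n. min (T * m k powr \<alpha>) (N * m k powr - \<beta>)) \<le>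
    (1 / (1 - \<gamma> powr \<alpha>) + 1 / (1 - \<gamma> powr \<beta>)) * (T powr (\<beta> / (\<alpha> + \<beta>)) * N powr (\<alpha> / (\<alpha> + \<beta>)))"
proof -
  define R where "R = (N / T) powr (1 / (\<alpha> + \<beta>))"
  define D where "D = T powr (\<beta> / (\<alpha> + \<beta>)) * N powr (\<alpha> / (\<alpha> + \<beta>))"
  have R: "R > 0" using TN by (simp add: R_def)
  have D: "D > 0" using TN by (simp add: D_def)
  have ab: "1 - \<beta> / (\<alpha> + \<beta>) = \<alpha> / (\<alpha> + \<beta>)" using \<alpha>\<beta> by (simp add: field_simps)
  have T: "T = D * R powr - \<alpha>"
  proof -
    have "D * R powr - \<alpha> = T powr (\<beta> / (\<alpha> + \<beta>)) * N powr (\<alpha> / (\<alpha> + \<beta>)) * (T powr (\<alpha> / (\<alpha> + \<beta>)) / N powr (\<alpha> / (\<alpha> + \<beta>)))"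
      using TN by (simp add: D_def R_def powr_powr powr_divide powr_minus_divide)
    also have "\<dots> = T powr (\<beta> / (\<alpha> + \<beta>) + \<alpha> / (\<alpha> + \<beta>))" using TN by (simp add: powr_add)
    also have "\<beta> / (\<alpha> + \<beta>) + \<alpha> / (\<alpha> + \<beta>) = 1" using \<alpha>\<beta> by (simp flip: add_divide_distrib)
    finally show ?thesis using TN by simp
  qed
  have N: "N = D * R powr \<beta>"
  proof -
    have "D * R powr \<beta> = T powr (\<beta> / (\<alpha> + \<beta>)) * N powr (\<alpha> / (\<alpha> + \<beta>)) * (N powr (\<beta> / (\<alpha> + \<beta>)) / T powr (\<beta> / (\<alpha> + \<beta>)))"
      using TN by (simp add: D_def R_def powr_powr powr_divide)
    also have "\<dots> = N powr (\<alpha> / (\<alpha> + \<beta>) + \<beta> / (\<alpha> + \<beta>))" using TN by (simp add: powr_add)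
    also have "\<alpha> / (\<alpha> + \<beta>) + \<beta> / (\<alpha> + \<beta>) = 1" using \<alpha>\<beta> by (simp flip: add_divide_distrib)
    finally show ?thesis using TN by simp
  qed
  define x where "x k = (m k / R) powr \<alpha>" for k
  define y where "y k = (m k / R) powr - \<beta>" for k
  have x: "0 \<le> x k" "x (Suc k) \<le> \<gamma> powr \<alpha> * x k" for k
  proof -
    show "0 \<le> x k" by (simp add: x_def)
    have "x (Suc k) \<le> (\<gamma> * (m k / R)) powr \<alpha>"
      unfolding x_def using m(1)[of "Suc k"] m(2)[of k] R \<alpha>\<beta> by (intro powr_mono2) (auto simp: field_simps)
    then show "x (Suc k) \<le> \<gamma> powr \<alpha> * x k" by (simp only: x_def powr_mult)
  qed
  have y: "0 \<le> y k" "y k \<le> \<gamma> powr \<beta> * y (Suc k)" for k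
  proof -
    show "0 \<le> y k" by (simp add: y_def)
    have "m (Suc k) / (\<gamma> * R) \<le> m k / R" using m(2)[of k] R \<gamma> by (simp add: field_simps)
    then have "y k \<le> (m (Suc k) / (\<gamma> * R)) powr - \<beta>"
      unfolding y_def using m(1)[of "Suc k"] R \<gamma> \<alpha>\<beta> by (intro powr_mono2') auto
    also have "m (Suc k) / (\<gamma> * R) = (1 / \<gamma>) * (m (Suc k) / R)" by simp
    also have "\<dots> powr - \<beta> = \<gamma> powr \<beta> * y (Suc k)"
      unfolding y_def powr_mult using \<gamma> by (simp add: powr_divide powr_minus_divide)
    finally show "y k \<le> \<gamma> powr \<beta> * y (Suc k)" .
  qed
  have g: "0 < \<gamma> powr c" "\<gamma> powr c < 1" if "c > 0" for c
    using \<gamma> that powr_less_mono2[of c \<gamma> 1] by auto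
  have summand: "min (T * m k powr \<alpha>) (N * m k powr - \<beta>) \<le> D * ((if x k \<le> 1 then x k else 0) + (if y k \<le> 1 then y k else 0))" for k
  proof -
    have 1: "T * m k powr \<alpha> = D * x k"
      unfolding T x_def using m(1)[of k] R by (simp add: powr_divide powr_minus_divide)
    have 2: "N * m k powr - \<beta> = D * y k"
      using m(1)[of k] R by (subst N) (simp add: y_def powr_divide powr_minus_divide)
    have "x k \<le> 1 \<or> y k \<le> 1"
    proof (cases "m k / R \<le> 1")
      case True
      then have "x k \<le> 1 powr \<alpha>" unfolding x_def using m(1)[of k] R \<alpha>\<beta> by (intro powr_mono2) auto
      then show ?thesis by simp
    next
      case False
      then have "y k \<le> 1 powr - \<beta>" unfolding y_def using \<alpha>\<beta> by (intro powr_mono2') auto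
      then show ?thesis by simp
    qed
    then have "min (x k) (y k) \<le> (if x k \<le> 1 then x k else 0) + (if y k \<le> 1 then y k else 0)"
      using x(1)[of k] y(1)[of k] by auto
    then have "D * min (x k) (y k) \<le> D * ((if x k \<le> 1 then x k else 0) + (if y k \<le> 1 then y k else 0))"
      using D by simp
    moreover have "min (D * x k) (D * y k) = D * min (x k) (y k)" using D by (simp add: min_mult_distrib_left)
    ultimately show ?thesis by (simp only: 1 2)
  qed
  have "(\<Sum>k<n. min (T * m k powr \<alpha>) (N * m k powr - \<beta>)) \<le>
    (\<Sum>k<n. D * ((if x k \<le> 1 then x k else 0) + (if y k \<le> 1 then y k else 0)))"
    by (rule sum_mono) (rule summand)
  also have "\<dots> = D * ((\<Sum>k<n. if x k \<le> 1 then x k else 0) + (\<Sum>k<n. if y k \<le> 1 then y k else 0))"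
    by (simp only: sum_distrib_left[symmetric] sum.distrib)
  also have "\<dots> \<le> D * (1 / (1 - \<gamma> powr \<alpha>) + 1 / (1 - \<gamma> powr \<beta>))"
    using D g \<alpha>\<beta> by (intro mult_left_mono add_mono sum_geometric_below_one sum_geometric_growth_below_one x y) auto
  finally show ?thesis by (simp add: D_def mult.commute)
qed

section \<open>Strong type estimates with uniform constants\<close>

text \<open>
  For nonnegative \<open>g\<close> the Riesz potential as a value in \<open>[0, \<infinity>]\<close>, without
  a convergence requirement.
\<close>

definition riesz_majorant :: "real \<Rightarrow> (real \<Rightarrow> real) \<Rightarrow> real \<Rightarrow> ennreal" where
  "riesz_majorant \<alpha> g x = (\<integral>\<^sup>+y\<in>{0..1}. ennreal (g y / \<bar>x - y\<bar> powr (1 - \<alpha>)) \<partial>lebesgue)"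

text \<open>
  Hedberg's inequality. Here \<open>t\<close> stands for the value at \<open>x\<close> of the maximal function
  of \<open>f\<^sup>s\<close>, and \<open>N\<close> for the norm of \<open>f\<close> in
  \<open>L\<^sup>u(\<mu>)\<close>.
\<close>

lemma Riesz_pointwise_Hedberg:
  fixes w f :: "real \<Rightarrow> real"
  assumes w [measurable]: "w \<in> borel_measurable lebesgue" and pos: "\<And>x. 0 < w x"
    and fin: "finite_measure (weight_measure w)"
    and s: "1 < s" "s < u" and \<alpha>: "0 < \<alpha>" "\<alpha> * u < 1" and r: "r = 1 + (s - 1) / (1 - \<alpha> * s)"
    and A: "1 \<le> A" and Ap: "Ap_condition w r A" and \<gamma>: "\<gamma> = 1 - 1 / (2 powr r * A)"
    and x: "0 < x" "x < 1"
    and f [measurable]: "f \<in> borel_measurable lebesgue" and f0: "\<And>x. 0 \<le> f x"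
    and t: "0 < t" and N: "0 < N"
    and avg: "\<And>a b. a < x \<Longrightarrow> x < b \<Longrightarrow> (\<integral>\<^sup>+y\<in>{a<..<b}. ennreal (f y powr s) \<partial>weight_measure w)
       \<le> ennreal t * emeasure (weight_measure w) {a<..<b}"
    and fN: "(\<integral>\<^sup>+y. ennreal (f y powr u) \<partial>weight_measure w) \<le> ennreal (N powr u)"
  shows "riesz_majorant \<alpha> (\<lambda>y. f y * w y powr \<alpha>) x \<le>
    ennreal (8 powr (1 - \<alpha>) * A powr (1 / s - \<alpha>) * ((1 / (1 - \<gamma> powr \<alpha>) + 1 / (1 - \<gamma> powr (1 / u - \<alpha>))) *
       ((t powr (1 / s)) powr (1 - \<alpha> * u) * N powr (\<alpha> * u))))"
proof -
  interpret finite_measure "weight_measure w" by fact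
  have \<alpha>s: "\<alpha> * s < 1" using \<alpha> s mult_strict_left_mono[of s u \<alpha>] by linarith
  have "\<alpha> * 1 < \<alpha> * s" using \<alpha> s by (intro mult_strict_left_mono) auto
  then have \<alpha>1: "\<alpha> < 1" using \<alpha>s by simp
  have r1: "r > 1" using s \<alpha>s by (simp add: r)
  have \<gamma>01: "0 < \<gamma>" "\<gamma> < 1" unfolding \<gamma> by (rule reverse_doubling_constant[OF r1 A])+
  \<comment> \<open>Radii decreasing by the factor 4, and not 2, make each interval at most half as long as its
       predecessor, although near 0 and 1 the intervals are cut off on one side.\<close>
  define d where "d k = (1/4::real) ^ k" for k :: nat
  have d0: "0 < d k" and d1: "d k \<le> 1" and dS: "d (Suc k) = d k / 4" for k
    by (auto simp: d_def power_le_one)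
  define a where "a k = max 0 (x - d k)" for k
  define b where "b k = min 1 (x + d k)" for k
  have ab: "0 \<le> a k" "a k < x" "x < b k" "b k \<le> 1" for k
    using x d0[of k] by (auto simp: a_def b_def)
  then have ab': "a k < b k" for k by (meson less_trans)
  have len1: "d k \<le> b k - a k" for k using x d0[of k] d1[of k] by (auto simp: a_def b_def)
  have len2: "b k - a k \<le> 2 * d k" for k using x d0[of k] by (auto simp: a_def b_def)
  have ends: "a k \<le> a (Suc k)" "b (Suc k) \<le> b k" for k
    using d0[of k] unfolding a_def b_def dS by auto
  define m where "m k = measure (weight_measure w) {a k<..<b k}" for k
  have m0: "0 < m k" for k unfolding m_def by (rule measure_weight_measure_interval_pos[OF w pos fin ab(1) ab' ab(4)])
  have mS: "m (Suc k) \<le> \<gamma> * m k" for k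
    unfolding m_def \<gamma>
  proof (rule Ap_reverse_doubling[OF w pos fin r1 _ Ap ab(1) ends(1) ab' ends(2) ab(4)])
    show "2 * (b (Suc k) - a (Suc k)) \<le> b k - a k" using len1[of k] len2[of "Suc k"] dS[of k] by simp
  qed (use A in auto)
  define P where "P k = A powr (1 / s - \<alpha>) * (b k - a k) powr (1 - \<alpha>)" for k
  define F where "F k = (\<integral>\<^sup>+y\<in>{a k<..<b k}. ennreal (f y * w y powr \<alpha>) \<partial>lebesgue)" for k
  \<comment> \<open>The bound for small intervals: the average of \<open>f\<^sup>s\<close> is at most \<open>t\<close>.\<close>
  have F1: "F k \<le> ennreal (P k * (t powr (1 / s) * m k powr \<alpha>))" for k
  proof -
    have "F k \<le> ennreal (A powr (1 / s - \<alpha>) * (b k - a k) powr (1 - \<alpha>) *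
      measure (weight_measure w) {a k<..<b k} powr (\<alpha> - 1 / s) * (t * m k) powr (1 / s))"
      unfolding F_def
    proof (rule Ap_local_estimate[OF w pos fin s(1) \<alpha>s r _ Ap ab(1) ab' ab(4) f f0])
      show "(\<integral>\<^sup>+y\<in>{a k<..<b k}. ennreal (f y powr s) \<partial>weight_measure w) \<le> ennreal (t * m k)"
        using avg[OF ab(2) ab(3)] t by (simp add: m_def emeasure_eq_measure ennreal_mult)
    qed (use A t m0 in auto)
    also have "A powr (1 / s - \<alpha>) * (b k - a k) powr (1 - \<alpha>) *
      measure (weight_measure w) {a k<..<b k} powr (\<alpha> - 1 / s) * (t * m k) powr (1 / s) = P k * (t powr (1 / s) * m k powr \<alpha>)"
    proof -
      have "m k powr (\<alpha> - 1 / s) * m k powr (1 / s) = m k powr \<alpha>" by (simp flip: powr_add)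
      then show ?thesis by (simp add: P_def powr_mult m_def[symmetric] mult_ac)
    qed
    finally show ?thesis .
  qed
  \<comment> \<open>The bound for large intervals: by Hoelder the average of \<open>f\<^sup>s\<close> is at most
       \<open>N\<^sup>s * m k powr - (s / u)\<close>.\<close>
  have F2: "F k \<le> ennreal (P k * (N * m k powr - (1 / u - \<alpha>)))" for k
  proof -
    define c where "c = u / s"
    have c: "1 < c" "1 / c + 1 / (c / (c - 1)) = 1" "1 < c / (c - 1)" using s by (auto simp: c_def field_simps)
    define B where "B = (N powr u) powr (1 / c) * m k powr (1 / (c / (c - 1)))"
    have "F k \<le> ennreal (A powr (1 / s - \<alpha>) * (b k - a k) powr (1 - \<alpha>) *
      measure (weight_measure w) {a k<..<b k} powr (\<alpha> - 1 / s) * B powr (1 / s))"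
      unfolding F_def
    proof (rule Ap_local_estimate[OF w pos fin s(1) \<alpha>s r _ Ap ab(1) ab' ab(4) f f0])
      have [measurable]: "{a k<..<b k} \<in> sets (weight_measure w)" by simp
      have [measurable]: "f \<in> borel_measurable (weight_measure w)" using f by (simp cong: measurable_cong_sets)
      have "(\<integral>\<^sup>+y\<in>{a k<..<b k}. ennreal (f y powr s) \<partial>weight_measure w) =
         (\<integral>\<^sup>+y. ennreal (f y powr s * indicator {a k<..<b k} y) \<partial>weight_measure w)"
        by (intro nn_integral_cong) (auto simp: indicator_def)
      also have "\<dots> \<le> ennreal B"
        unfolding B_def
      proof (rule nn_integral_Hoelder)
        show "(\<integral>\<^sup>+y. ennreal ((f y powr s) powr c) \<partial>weight_measure w) \<le> ennreal (N powr u)"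
          using fN s by (simp add: powr_powr c_def)
        have "(\<integral>\<^sup>+y. ennreal (indicator {a k<..<b k} y powr (c / (c - 1))) \<partial>weight_measure w)
          = (\<integral>\<^sup>+y. indicator {a k<..<b k} y \<partial>weight_measure w)"
          using c by (intro nn_integral_cong) (auto simp: indicator_def)
        then show "(\<integral>\<^sup>+y. ennreal (indicator {a k<..<b k} y powr (c / (c - 1))) \<partial>weight_measure w) \<le> ennreal (m k)"
          by (simp add: m_def emeasure_eq_measure)
      qed (use c N m0 in auto)
      finally show "(\<integral>\<^sup>+y\<in>{a k<..<b k}. ennreal (f y powr s) \<partial>weight_measure w) \<le> ennreal B" .
    next
      show "B > 0" using N m0[of k] by (simp add: B_def)
    qed (use A in auto)
    also have "A powr (1 / s - \<alpha>) * (b k - a k) powr (1 - \<alpha>) *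
      measure (weight_measure w) {a k<..<b k} powr (\<alpha> - 1 / s) * B powr (1 / s) = P k * (m k powr (\<alpha> - 1 / s) * B powr (1 / s))"
      by (simp add: P_def m_def)
    also have "m k powr (\<alpha> - 1 / s) * B powr (1 / s) = N * m k powr - (1 / u - \<alpha>)"
    proof -
      have "u * (1 / c) * (1 / s) = 1" using s by (simp add: c_def)
      moreover have "1 / (c / (c - 1)) * (1 / s) = 1 / s - 1 / u" using s by (simp add: c_def field_simps)
      ultimately have "B powr (1 / s) = N powr 1 * m k powr (1 / s - 1 / u)"
        unfolding B_def powr_mult powr_powr by (simp only: powr_powr)
      moreover have "m k powr (\<alpha> - 1 / s) * m k powr (1 / s - 1 / u) = m k powr - (1 / u - \<alpha>)" by (simp flip: powr_add)
      ultimately show ?thesis using N by (simp add: mult_ac)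
    qed
    finally show ?thesis .
  qed
  define Q where "Q k = min (t powr (1 / s) * m k powr \<alpha>) (N * m k powr - (1 / u - \<alpha>))" for k
  have Q0: "0 \<le> Q k" for k using N by (simp add: Q_def)
  define K where "K = 8 powr (1 - \<alpha>) * A powr (1 / s - \<alpha>)"
  have K0: "0 \<le> K" using A by (simp add: K_def)
  have FQ: "ennreal (1 / d (Suc k) powr (1 - \<alpha>)) * F k \<le> ennreal (K * Q k)" for k
  proof -
    have "F k \<le> ennreal (P k * Q k)"
      using F1[of k] F2[of k] by (cases "t powr (1 / s) * m k powr \<alpha> \<le> N * m k powr - (1 / u - \<alpha>)") (auto simp: Q_def min_def)
    then have "ennreal (1 / d (Suc k) powr (1 - \<alpha>)) * F k \<le> ennreal (1 / d (Suc k) powr (1 - \<alpha>)) * ennreal (P k * Q k)"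
      by (rule mult_left_mono) simp
    also have "\<dots> = ennreal ((1 / d (Suc k) powr (1 - \<alpha>)) * (P k * Q k))"
      using Q0[of k] by (simp add: P_def flip: ennreal_mult)
    also have "\<dots> \<le> ennreal (K * Q k)"
    proof (rule ennreal_leI)
      have "(b k - a k) powr (1 - \<alpha>) \<le> (8 * d (Suc k)) powr (1 - \<alpha>)"
        using len2[of k] dS[of k] \<alpha>1 ab'[of k] by (intro powr_mono2) auto
      also have "\<dots> = 8 powr (1 - \<alpha>) * d (Suc k) powr (1 - \<alpha>)" by (rule powr_mult)
      finally have "(1 / d (Suc k) powr (1 - \<alpha>)) * P k \<le> K"
        using d0[of "Suc k"] A by (simp add: P_def K_def field_simps)
      then have "(1 / d (Suc k) powr (1 - \<alpha>)) * P k * Q k \<le> K * Q k" using Q0 by (rule mult_right_mono)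
      then show "(1 / d (Suc k) powr (1 - \<alpha>)) * (P k * Q k) \<le> K * Q k" by (simp add: mult.assoc)
    qed
    finally show ?thesis .
  qed
  define h where "h k y = ennreal (1 / d (Suc k) powr (1 - \<alpha>)) * (ennreal (f y * w y powr \<alpha>) * indicator {a k<..<b k} y)" for k y
  have ae: "AE y in lebesgue. ennreal (f y * w y powr \<alpha> / \<bar>x - y\<bar> powr (1 - \<alpha>)) * indicator {0..1} y \<le>
     (\<Sum>k. h k y)"
  proof -
    have "AE y in lebesgue. y \<noteq> (0::real)" "AE y in lebesgue. y \<noteq> (1::real)"
      by (rule AE_completion[OF AE_lborel_singleton])+
    then show ?thesis
    proof eventually_elim
      case (elim y)
      show ?case
      proof (cases "y \<in> {0<..<1} \<and> y \<noteq> x")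
        case True
        then have dist: "\<bar>x - y\<bar> < 1" "\<bar>x - y\<bar> > 0" using x by auto
        obtain n where "(1/4::real) ^ n < \<bar>x - y\<bar>" using real_arch_pow_inv[OF dist(2), of "1/4"] by auto
        then have "d n \<le> \<bar>x - y\<bar>" by (simp add: d_def)
        moreover have "\<not> d 0 \<le> \<bar>x - y\<bar>" using dist by (simp add: d_def)
        ultimately obtain k where k: "\<not> d k \<le> \<bar>x - y\<bar>" "d (Suc k) \<le> \<bar>x - y\<bar>"
          using ex_least_nat_less[of "\<lambda>n. d n \<le> \<bar>x - y\<bar>" n] by auto
        have yI: "y \<in> {a k<..<b k}" using k True by (auto simp: a_def b_def)
        have "f y * w y powr \<alpha> / \<bar>x - y\<bar> powr (1 - \<alpha>) \<le> f y * w y powr \<alpha> / d (Suc k) powr (1 - \<alpha>)"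
        proof (rule divide_left_mono)
          show "d (Suc k) powr (1 - \<alpha>) \<le> \<bar>x - y\<bar> powr (1 - \<alpha>)"
            using k(2) d0[of "Suc k"] \<alpha>1 by (intro powr_mono2) auto
        qed (use f0[of y] dist d0[of "Suc k"] in auto)
        then have "ennreal (f y * w y powr \<alpha> / \<bar>x - y\<bar> powr (1 - \<alpha>)) * indicator {0..1} y \<le>
          h k y"
          using yI True f0[of y] by (simp add: h_def ennreal_leI flip: ennreal_mult)
        also have "\<dots> = (\<Sum>j\<in>{k}. h j y)" by simp
        also have "\<dots> \<le> (\<Sum>k. h k y)"
          by (rule sum_le_suminf) auto
        finally show ?thesis .
      next
        case False
        then show ?thesis using elim by (auto simp: indicator_def)
      qed
    qed
  qed
  have [measurable]: "{a k<..<b k} \<in> sets lebesgue" for k by simp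
  have "riesz_majorant \<alpha> (\<lambda>y. f y * w y powr \<alpha>) x \<le>
     (\<integral>\<^sup>+y. (\<Sum>k. h k y) \<partial>lebesgue)"
    unfolding riesz_majorant_def by (rule nn_integral_mono_AE[OF ae])
  also have "\<dots> = (\<Sum>k. \<integral>\<^sup>+y. h k y \<partial>lebesgue)"
    unfolding h_def by (rule nn_integral_suminf) measurable
  also have "\<dots> = (\<Sum>k. ennreal (1 / d (Suc k) powr (1 - \<alpha>)) * F k)"
    unfolding F_def h_def by (subst nn_integral_cmult) measurable
  also have "\<dots> \<le> ennreal (K * ((1 / (1 - \<gamma> powr \<alpha>) + 1 / (1 - \<gamma> powr (1 / u - \<alpha>))) *
       ((t powr (1 / s)) powr (1 - \<alpha> * u) * N powr (\<alpha> * u))))"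
  proof (rule suminf_le_const[OF summableI], goal_cases)
    case (1 n)
    have "(\<Sum>k<n. ennreal (1 / d (Suc k) powr (1 - \<alpha>)) * F k) \<le> (\<Sum>k<n. ennreal (K * Q k))"
      by (intro sum_mono FQ)
    also have "\<dots> = ennreal (K * (\<Sum>k<n. Q k))"
      using K0 Q0 by (subst sum_ennreal) (auto simp: sum_distrib_left)
    also have "\<dots> \<le> ennreal (K * ((1 / (1 - \<gamma> powr \<alpha>) + 1 / (1 - \<gamma> powr (1 / u - \<alpha>))) *
       ((t powr (1 / s)) powr (1 - \<alpha> * u) * N powr (\<alpha> * u))))"
    proof (intro ennreal_leI mult_left_mono K0)
      have e: "\<alpha> + (1 / u - \<alpha>) = 1 / u" "(1 / u - \<alpha>) / (1 / u) = 1 - \<alpha> * u" "\<alpha> / (1 / u) = \<alpha> * u"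
        using s by (auto simp: field_simps)
      have "1 / u - \<alpha> > 0" using \<alpha> s by (simp add: field_simps)
      then show "(\<Sum>k<n. Q k) \<le> (1 / (1 - \<gamma> powr \<alpha>) + 1 / (1 - \<gamma> powr (1 / u - \<alpha>))) *
       ((t powr (1 / s)) powr (1 - \<alpha> * u) * N powr (\<alpha> * u))"
        using Hedberg_sum[of m, OF m0 mS \<gamma>01 \<alpha>(1), of "1 / u - \<alpha>" "t powr (1 / s)" N n] t N
        unfolding e Q_def by simp
    qed
    finally show ?case .
  qed
  finally show ?thesis by (simp add: K_def)
qed

lemma AE_weight_measure_01:
  assumes [measurable]: "w \<in> borel_measurable lebesgue"
  shows "AE x in weight_measure w. 0 < x \<and> x < 1"
proof -
  have "AE y in lebesgue. y \<noteq> (0::real)" "AE y in lebesgue. y \<noteq> (1::real)"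
    by (rule AE_completion[OF AE_lborel_singleton])+
  then have "AE x in lebesgue. 0 < ennreal (w x) * indicator {0..1} x \<longrightarrow> 0 < x \<and> x < 1"
    by eventually_elim (auto simp: indicator_def split: if_splits)
  then show ?thesis unfolding weight_measure_def by (subst AE_density) auto
qed

text \<open>
  Hedberg's inequality raised to the power \<open>v = u/(1 - \<alpha> u)\<close> has the maximal function of
  \<open>f\<^sup>s\<close> with the exponent \<open>u/s \<ge> p0/s > 1\<close> on its right-hand side, so the
  maximal theorem applies. All constants are monotone in \<open>u\<close> and can be taken at the end points
  of \<open>[p0, p1]\<close>. The potential is only dominated by a measurable \<open>g\<close>, which suffices
  for upper bounds and spares a measurability proof for the potential.
\<close>

lemma Riesz_strong_type_uniform:
  fixes w :: "real \<Rightarrow> real"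
  assumes w [measurable]: "w \<in> borel_measurable lebesgue" and pos: "\<And>x. 0 < w x"
    and fin: "finite_measure (weight_measure w)"
    and s: "1 < s" "s < p0" "p0 \<le> p1" and \<alpha>: "0 < \<alpha>" "\<alpha> * p1 < 1" and r: "r = 1 + (s - 1) / (1 - \<alpha> * s)"
    and Ap: "Ap_condition w r A"
  obtains C where "0 < C" "\<And>u f N. p0 \<le> u \<Longrightarrow> u \<le> p1 \<Longrightarrow> f \<in> borel_measurable lebesgue \<Longrightarrow> (\<And>x. 0 \<le> f x) \<Longrightarrow> 0 < N \<Longrightarrow>
     (\<integral>\<^sup>+y. ennreal (f y powr u) \<partial>weight_measure w) \<le> ennreal (N powr u) \<Longrightarrow>
     \<exists>g. g \<in> borel_measurable lebesgue \<and> (\<forall>x. 0 \<le> g x) \<and>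
       (AE x in weight_measure w. riesz_majorant \<alpha> (\<lambda>y. f y * w y powr \<alpha>) x \<le> ennreal (g x)) \<and>
       (\<integral>\<^sup>+x. ennreal (g x powr (u / (1 - \<alpha> * u))) \<partial>weight_measure w) \<le> ennreal ((C * N) powr (u / (1 - \<alpha> * u)))"
proof -
  interpret finite_measure "weight_measure w" by fact
  define A' where "A' = max A 1"
  have A': "A' \<ge> 1" by (simp add: A'_def)
  have Ap': "Ap_condition w r A'" using Ap by (rule Ap_condition_mono) (simp add: A'_def)
  define \<gamma> where "\<gamma> = 1 - 1 / (2 powr r * A')"
  have "s < p1" using s by simp
  then have "\<alpha> * s < 1" using \<alpha> mult_strict_left_mono[of s p1 \<alpha>] by linarith
  then have r1: "r > 1" using s by (simp add: r)
  have \<gamma>01: "0 < \<gamma>" "\<gamma> < 1" unfolding \<gamma>_def by (rule reverse_doubling_constant[OF r1 A'])+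
  define C1 where "C1 = 8 powr (1 - \<alpha>) * A' powr (1 / s - \<alpha>) * (1 / (1 - \<gamma> powr \<alpha>) + 1 / (1 - \<gamma> powr (1 / p1 - \<alpha>)))"
  have g: "0 < \<gamma> powr c" "\<gamma> powr c < 1" if "c > 0" for c
    using \<gamma>01 that powr_less_mono2[of c \<gamma> 1] by auto
  have p1: "1 / p1 - \<alpha> > 0" using \<alpha> s by (simp add: field_simps)
  have C1: "C1 > 0"
  proof -
    have "1 / (1 - \<gamma> powr \<alpha>) > 0" "1 / (1 - \<gamma> powr (1 / p1 - \<alpha>)) > 0" using g p1 \<alpha> by auto
    then show ?thesis using A' by (auto simp: C1_def intro!: mult_pos_pos add_pos_pos)
  qed
  define CM where "CM = 4 * (p1 / s) * 2 powr (p1 / s) / (p0 / s - 1)"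
  define K where "K = max 1 (CM + measure (weight_measure w) UNIV)"
  show ?thesis
  proof (rule that[of "C1 * K"])
    show "0 < C1 * K" using C1 by (simp add: K_def)
    fix u f N
    assume u: "p0 \<le> u" "u \<le> p1" and f [measurable]: "f \<in> borel_measurable lebesgue" and f0: "\<And>x. (0::real) \<le> f x"
      and N: "(0::real) < N" and fN: "(\<integral>\<^sup>+y. ennreal (f y powr u) \<partial>weight_measure w) \<le> ennreal (N powr u)"
    define v where "v = u / (1 - \<alpha> * u)"
    have su: "s < u" using s u by simp
    have "\<alpha> * u \<le> \<alpha> * p1" using u \<alpha> by (intro mult_left_mono) auto
    then have \<alpha>u: "\<alpha> * u < 1" using \<alpha>(2) by linarith
    have \<alpha>u0: "0 < \<alpha> * u" using \<alpha> s su by simp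
    have v: "v > 1"
    proof -
      have "1 - \<alpha> * u \<le> 1" using \<alpha>u0 by simp
      then have "1 - \<alpha> * u < u" using su s by simp
      then show ?thesis using \<alpha>u by (simp add: v_def)
    qed
    define k where "k = u / s"
    have k: "1 < k" "p0 / s \<le> k" "k \<le> p1 / s" using s su u by (auto simp: k_def field_simps)
    have fk: "(\<integral>\<^sup>+x. ennreal ((f x powr s) powr k) \<partial>weight_measure w) = (\<integral>\<^sup>+y. ennreal (f y powr u) \<partial>weight_measure w)"
      using s by (simp add: powr_powr k_def)
    obtain h where h: "h \<in> borel_measurable (weight_measure w)" "\<And>x. 0 \<le> h x"
      "AE x in weight_measure w. \<forall>a b. a < x \<and> x < b \<longrightarrow>
       (\<integral>\<^sup>+y\<in>{a<..<b}. ennreal (f y powr s) \<partial>weight_measure w) \<le> ennreal (h x) * emeasure (weight_measure w) {a<..<b}"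
      "(\<integral>\<^sup>+x. ennreal (h x powr k) \<partial>weight_measure w) \<le>
       ennreal (4 * k * 2 powr (k - 1) / (k - 1)) * (\<integral>\<^sup>+x. ennreal ((f x powr s) powr k) \<partial>weight_measure w)"
    proof (rule maximal_function_bound[OF fin, of "\<lambda>x. f x powr s" k])
      show "(\<lambda>x. f x powr s) \<in> borel_measurable (weight_measure w)" by (simp cong: measurable_cong_sets)
      show "(\<integral>\<^sup>+x. ennreal ((f x powr s) powr k) \<partial>weight_measure w) < \<infinity>"
        unfolding fk using le_less_trans[OF fN ennreal_less_top] by simp
    qed (use k in auto)
    have hm [measurable]: "h \<in> borel_measurable lebesgue" using h(1) by (simp cong: measurable_cong_sets)
    \<comment> \<open>The lower cut-off makes \<open>t\<close> positive; its contribution to the integral is at most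
         \<open>N powr u\<close> times the total mass.\<close>
    define t where "t x = max (h x) (N powr s)" for x
    have t: "0 < t x" for x using N by (simp add: t_def less_max_iff_disj)
    define gg where "gg x = C1 * ((t x powr (1 / s)) powr (1 - \<alpha> * u) * N powr (\<alpha> * u))" for x
    have g_meas: "gg \<in> borel_measurable lebesgue" unfolding gg_def t_def by measurable
    have g0: "0 \<le> gg x" for x using C1 by (simp add: gg_def)
    have dom: "AE x in weight_measure w. riesz_majorant \<alpha> (\<lambda>y. f y * w y powr \<alpha>) x \<le> ennreal (gg x)"
      using h(3) AE_weight_measure_01[OF w]
    proof eventually_elim
      case (elim x)
      have "riesz_majorant \<alpha> (\<lambda>y. f y * w y powr \<alpha>) x \<le>
        ennreal (8 powr (1 - \<alpha>) * A' powr (1 / s - \<alpha>) * ((1 / (1 - \<gamma> powr \<alpha>) + 1 / (1 - \<gamma> powr (1 / u - \<alpha>))) *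
         ((t x powr (1 / s)) powr (1 - \<alpha> * u) * N powr (\<alpha> * u))))"
      proof (rule Riesz_pointwise_Hedberg[OF w pos fin s(1) su \<alpha>(1) \<alpha>u r A' Ap' \<gamma>_def _ _ f f0 t N _ fN])
        fix a b assume "a < x" "x < b"
        then have "(\<integral>\<^sup>+y\<in>{a<..<b}. ennreal (f y powr s) \<partial>weight_measure w) \<le> ennreal (h x) * emeasure (weight_measure w) {a<..<b}"
          using elim by blast
        also have "\<dots> \<le> ennreal (t x) * emeasure (weight_measure w) {a<..<b}"
          by (intro mult_right_mono ennreal_leI) (auto simp: t_def)
        finally show "(\<integral>\<^sup>+y\<in>{a<..<b}. ennreal (f y powr s) \<partial>weight_measure w) \<le> ennreal (t x) * emeasure (weight_measure w) {a<..<b}" .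
      qed (use elim in auto)
      also have "\<dots> \<le> ennreal (gg x)"
      proof (rule ennreal_leI)
        define D where "D = (t x powr (1 / s)) powr (1 - \<alpha> * u) * N powr (\<alpha> * u)"
        have D: "D \<ge> 0" by (simp add: D_def)
        have "1 / p1 - \<alpha> \<le> 1 / u - \<alpha>" using u su s by (simp add: field_simps)
        then have "\<gamma> powr (1 / u - \<alpha>) \<le> \<gamma> powr (1 / p1 - \<alpha>)" using \<gamma>01 by (intro powr_mono') auto
        then have "1 / (1 - \<gamma> powr (1 / u - \<alpha>)) \<le> 1 / (1 - \<gamma> powr (1 / p1 - \<alpha>))"
          using g[OF p1] by (intro divide_left_mono) auto
        then have "8 powr (1 - \<alpha>) * A' powr (1 / s - \<alpha>) * ((1 / (1 - \<gamma> powr \<alpha>) + 1 / (1 - \<gamma> powr (1 / u - \<alpha>))) * D) \<le>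
          8 powr (1 - \<alpha>) * A' powr (1 / s - \<alpha>) * ((1 / (1 - \<gamma> powr \<alpha>) + 1 / (1 - \<gamma> powr (1 / p1 - \<alpha>))) * D)"
          using D by (intro mult_left_mono mult_right_mono add_left_mono) auto
        also have "\<dots> = gg x" by (simp add: gg_def C1_def D_def)
        finally show "8 powr (1 - \<alpha>) * A' powr (1 / s - \<alpha>) * ((1 / (1 - \<gamma> powr \<alpha>) + 1 / (1 - \<gamma> powr (1 / u - \<alpha>))) * ((t x powr (1 / s)) powr (1 - \<alpha> * u) * N powr (\<alpha> * u))) \<le> gg x"
          by (simp only: D_def)
      qed
      finally show ?case .
    qed
    have gv: "gg x powr v = C1 powr v * N powr (v - u) * t x powr k" for x
    proof -
      have e1: "1 / s * (1 - \<alpha> * u) * v = k" using \<alpha>u by (simp add: v_def k_def)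
      have e2: "\<alpha> * u * v = v - u" using \<alpha>u by (simp add: v_def field_simps)
      show ?thesis unfolding gg_def powr_mult powr_powr e1 e2 by (simp only: mult_ac)
    qed
    have tk: "t x powr k \<le> h x powr k + N powr u" for x
    proof -
      have "(N powr s) powr k = N powr u" using s by (simp add: powr_powr k_def)
      then show ?thesis by (auto simp: t_def max_def)
    qed
    have CMk: "4 * k * 2 powr (k - 1) / (k - 1) \<le> CM"
    proof -
      have "4 * k * 2 powr (k - 1) / (k - 1) \<le> 4 * (p1 / s) * 2 powr (p1 / s) / (k - 1)"
        using k by (intro divide_right_mono mult_mono powr_mono) auto
      also have "\<dots> \<le> CM" unfolding CM_def
        using k s by (intro divide_left_mono mult_nonneg_nonneg mult_pos_pos) (auto simp: field_simps)
      finally show ?thesis .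
    qed
    have CM0: "CM \<ge> 0" using s by (auto simp: CM_def field_simps)
    define D where "D = C1 powr v * N powr (v - u)"
    have D: "D \<ge> 0" by (simp add: D_def)
    have "(\<integral>\<^sup>+x. ennreal (gg x powr v) \<partial>weight_measure w) \<le> (\<integral>\<^sup>+x. ennreal D * (ennreal (h x powr k) + ennreal (N powr u)) \<partial>weight_measure w)"
      unfolding gv D_def[symmetric] using D tk
      by (intro nn_integral_mono) (simp add: ennreal_leI mult_left_mono flip: ennreal_plus ennreal_mult)
    also have "\<dots> = ennreal D * ((\<integral>\<^sup>+x. ennreal (h x powr k) \<partial>weight_measure w) + ennreal (N powr u) * emeasure (weight_measure w) UNIV)"
      using h(1) by (simp add: nn_integral_cmult nn_integral_add)
    also have "\<dots> \<le> ennreal D * (ennreal CM * ennreal (N powr u) + ennreal (N powr u) * emeasure (weight_measure w) UNIV)"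
    proof (intro mult_left_mono add_right_mono)
      note h(4)
      also have "ennreal (4 * k * 2 powr (k - 1) / (k - 1)) * (\<integral>\<^sup>+x. ennreal ((f x powr s) powr k) \<partial>weight_measure w) \<le> ennreal CM * ennreal (N powr u)"
        unfolding fk by (intro mult_mono ennreal_leI CMk fN) auto
      finally show "(\<integral>\<^sup>+x. ennreal (h x powr k) \<partial>weight_measure w) \<le> ennreal CM * ennreal (N powr u)" .
    qed simp
    also have "\<dots> = ennreal (D * (CM * N powr u + N powr u * measure (weight_measure w) UNIV))"
      using D CM0 by (simp add: emeasure_eq_measure flip: ennreal_mult ennreal_plus)
    also have "\<dots> \<le> ennreal ((C1 * K * N) powr v)"
    proof (rule ennreal_leI)
      have "D * (CM * N powr u + N powr u * measure (weight_measure w) UNIV) = D * N powr u * (CM + measure (weight_measure w) UNIV)"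
        by (simp add: algebra_simps)
      also have "\<dots> \<le> D * N powr u * K powr v"
      proof (rule mult_left_mono)
        have "CM + measure (weight_measure w) UNIV \<le> K powr 1" by (simp add: K_def)
        also have "\<dots> \<le> K powr v" using v by (intro powr_mono) (auto simp: K_def)
        finally show "CM + measure (weight_measure w) UNIV \<le> K powr v" .
      qed (use D in simp)
      also have "D * N powr u = C1 powr v * N powr v" by (simp add: D_def mult.assoc flip: powr_add)
      also have "C1 powr v * N powr v * K powr v = (C1 * K * N) powr v" by (simp only: powr_mult mult_ac)
      finally show "D * (CM * N powr u + N powr u * measure (weight_measure w) UNIV) \<le> (C1 * K * N) powr v" .
    qed
    finally show "\<exists>g. g \<in> borel_measurable lebesgue \<and> (\<forall>x. 0 \<le> g x) \<and>
       (AE x in weight_measure w. riesz_majorant \<alpha> (\<lambda>y. f y * w y powr \<alpha>) x \<le> ennreal (g x)) \<and>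
       (\<integral>\<^sup>+x. ennreal (g x powr (u / (1 - \<alpha> * u))) \<partial>weight_measure w) \<le> ennreal ((C1 * K * N) powr (u / (1 - \<alpha> * u)))"
      unfolding v_def[symmetric] using g_meas g0 dom by blast
  qed
qed

section \<open>Positive representatives of weights\<close>

text \<open>
  A weight is positive only almost everywhere on \<open>[0, 1]\<close>, and nothing is known about it outside;
  this representative is positive everywhere and measurable on the line, so that negative powers cause no case
  distinctions.
\<close>

definition positive_version :: "(real \<Rightarrow> real) \<Rightarrow> real \<Rightarrow> real" where
  "positive_version w x = (if x \<in> {0..1} \<and> 0 < w x then w x else 1)"

lemma positive_version_pos: "0 < positive_version w x"
  by (simp add: positive_version_def)

lemma AE_unit_leb_iff: "(AE x in unit_leb. P x) \<longleftrightarrow> (AE x in lebesgue. x \<in> {0..1} \<longrightarrow> P x)"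
  by (rule AE_restrict_space_iff) simp

lemma measurable_extend_unit_leb:
  fixes f :: "real \<Rightarrow> real"
  assumes "f \<in> borel_measurable unit_leb"
  shows "(\<lambda>x. if x \<in> {0..1} then f x else 0) \<in> borel_measurable lebesgue"
  by (rule measurable_restrict_space_iff[THEN iffD1, OF _ _ assms]) auto

lemma weight_unit_leb_measurable: "weight w \<Longrightarrow> w \<in> borel_measurable unit_leb"
  unfolding weight_def by (auto intro: borel_measurable_integrable)

lemma positive_version_measurable:
  assumes "weight w"
  shows "positive_version w \<in> borel_measurable lebesgue"
proof -
  have [measurable]: "(\<lambda>x. if x \<in> {0..1} then w x else 0) \<in> borel_measurable lebesgue"
    by (rule measurable_extend_unit_leb[OF weight_unit_leb_measurable[OF assms]])
  have "positive_version w = (\<lambda>x. if 0 < (if x \<in> {0..1} then w x else 0) then (if x \<in> {0..1} then w x else 0) else 1)"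
    by (auto simp: positive_version_def fun_eq_iff)
  also have "\<dots> \<in> borel_measurable lebesgue" by measurable
  finally show ?thesis .
qed

lemma AE_positive_version:
  assumes "weight w"
  shows "AE x in unit_leb. positive_version w x = w x"
proof -
  have "AE x in unit_leb. 0 < w x" using assms by (simp add: weight_def)
  then show ?thesis unfolding AE_unit_leb_iff by eventually_elim (auto simp: positive_version_def)
qed

lemma nn_integral_unit_leb_weight:
  assumes w: "weight w" and F [measurable]: "F \<in> borel_measurable lebesgue" and F0: "\<And>x. 0 \<le> F x"
  shows "(\<integral>\<^sup>+t. ennreal (F t * w t) \<partial>unit_leb) = (\<integral>\<^sup>+t. ennreal (F t) \<partial>weight_measure (positive_version w))"
proof -
  note [measurable] = positive_version_measurable[OF w]
  have "(\<integral>\<^sup>+t. ennreal (F t * w t) \<partial>unit_leb) = (\<integral>\<^sup>+t. ennreal (F t * positive_version w t) \<partial>unit_leb)"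
    by (rule nn_integral_cong_AE, rule eventually_mono[OF AE_positive_version[OF w]]) simp
  also have "\<dots> = (\<integral>\<^sup>+t. ennreal (F t * positive_version w t) * indicator {0..1} t \<partial>lebesgue)"
    by (rule nn_integral_restrict_space) simp
  also have "\<dots> = (\<integral>\<^sup>+t. ennreal (positive_version w t) * indicator {0..1} t * ennreal (F t) \<partial>lebesgue)"
    using F0 positive_version_pos[of w, THEN less_imp_le]
    by (intro nn_integral_cong) (auto simp: ennreal_mult indicator_def mult.commute)
  also have "\<dots> = (\<integral>\<^sup>+t. ennreal (F t) \<partial>weight_measure (positive_version w))"
    by (rule nn_integral_weight_measure[symmetric]) measurable
  finally show ?thesis .
qed

lemma AE_weight_measure_iff:
  assumes w: "weight w"
  shows "(AE x in weight_measure (positive_version w). P x) \<longleftrightarrow> (AE x in unit_leb. P x)"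
proof -
  note [measurable] = positive_version_measurable[OF w]
  have "(AE x in weight_measure (positive_version w). P x) \<longleftrightarrow>
    (AE x in lebesgue. 0 < ennreal (positive_version w x) * indicator {0..1} x \<longrightarrow> P x)"
    unfolding weight_measure_def by (rule AE_density) measurable
  also have "\<dots> \<longleftrightarrow> (AE x in lebesgue. x \<in> {0..1} \<longrightarrow> P x)"
    using positive_version_pos[of w] by (intro AE_cong) (auto simp: indicator_def)
  finally show ?thesis by (simp add: AE_unit_leb_iff)
qed

lemma finite_weight_measure:
  assumes w: "weight w"
  shows "finite_measure (weight_measure (positive_version w))"
proof (rule finite_measureI)
  have "emeasure (weight_measure (positive_version w)) (space (weight_measure (positive_version w)))
     = (\<integral>\<^sup>+t. ennreal 1 \<partial>weight_measure (positive_version w))" by simp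
  also have "\<dots> = (\<integral>\<^sup>+t. ennreal (1 * w t) \<partial>unit_leb)"
    by (rule nn_integral_unit_leb_weight[OF w, symmetric]) auto
  also have "\<dots> \<le> (\<integral>\<^sup>+t. ennreal (norm (w t)) \<partial>unit_leb)" by (intro nn_integral_mono ennreal_leI) auto
  also have "\<dots> < \<infinity>" using w unfolding weight_def integrable_iff_bounded by blast
  finally show "emeasure (weight_measure (positive_version w)) (space (weight_measure (positive_version w))) \<noteq> \<infinity>" by simp
qed

lemma finite_measure_weight_measure_if_interval:
  assumes [measurable]: "\<sigma> \<in> borel_measurable lebesgue" and "emeasure (weight_measure \<sigma>) {0<..<1} < \<infinity>"
  shows "finite_measure (weight_measure \<sigma>)"
proof (rule finite_measureI)
  have "emeasure (weight_measure \<sigma>) (space (weight_measure \<sigma>)) = emeasure (weight_measure \<sigma>) {0<..<1}"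
    by (rule emeasure_eq_AE) (use AE_weight_measure_01[OF assms(1)] in \<open>auto elim: eventually_mono\<close>)
  then show "emeasure (weight_measure \<sigma>) (space (weight_measure \<sigma>)) \<noteq> \<infinity>" using assms by simp
qed

section \<open>The Muckenhoupt class in terms of open intervals\<close>

lemma interval_between_Ioo_Icc:
  assumes J: "is_interval J" "J \<subseteq> {0..1::real}" "0 < measure lebesgue J"
  obtains a b where "0 \<le> a" "a < b" "b \<le> 1" "{a<..<b} \<subseteq> J" "J \<subseteq> {a..b}"
proof -
  have ne: "J \<noteq> {}" using J(3) by auto
  have bdd: "bdd_below J" "bdd_above J" using J(2) by (meson bdd_below_mono bdd_below_Icc, meson bdd_above_mono bdd_above_Icc)
  define a where "a = Inf J"
  define b where "b = Sup J"
  have sub: "J \<subseteq> {a..b}" using bdd by (auto simp: a_def b_def intro: cInf_lower cSup_upper)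
  have "{a<..<b} \<subseteq> J"
  proof
    fix x assume x: "x \<in> {a<..<b}"
    obtain y where y: "y \<in> J" "y < x" using x ne cInf_lessD[of J x] by (auto simp: a_def)
    obtain z where z: "z \<in> J" "x < z" using x ne less_cSupD[of J x] by (auto simp: b_def)
    show "x \<in> J" using mem_is_interval_1_I[OF J(1) y(1) z(1)] y z by simp
  qed
  moreover have "0 \<le> a" unfolding a_def using J(2) ne by (intro cInf_greatest) auto
  moreover have "b \<le> 1" unfolding b_def using J(2) ne by (intro cSup_least) auto
  moreover have "a < b"
  proof (rule ccontr)
    assume "\<not> a < b"
    then have "J \<subseteq> {a}" using sub by force
    then have "J = {a}" using ne by auto
    then show False using J(3) by simp
  qed
  ultimately show ?thesis using that sub by blast
qed

lemma interval_between_sets: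
  assumes ab: "(a::real) < b" and J: "{a<..<b} \<subseteq> J" "J \<subseteq> {a..b}"
  shows "J \<in> sets lebesgue" "measure lebesgue J = b - a"
proof -
  have "J = {a<..<b} \<union> (J \<inter> {a, b})" using J by (auto simp: less_le)
  moreover have "J \<inter> {a, b} \<in> sets borel" by (intro borel_closed finite_imp_closed) auto
  ultimately have b: "J \<in> sets borel" by (metis borel_open open_greaterThanLessThan sets.Un)
  then show s: "J \<in> sets lebesgue" by simp
  have Jf: "J \<in> lmeasurable" by (rule fmeasurableI2[of "{a..b}"]) (use J s in auto)
  have "measure lebesgue {a<..<b} \<le> measure lebesgue J" using J s Jf by (intro measure_mono_fmeasurable) auto
  moreover have "measure lebesgue J \<le> measure lebesgue {a..b}" using J s by (intro measure_mono_fmeasurable) auto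
  ultimately show "measure lebesgue J = b - a" using ab by simp
qed

lemma nn_integral_lebesgue_on_interval:
  fixes F :: "real \<Rightarrow> real"
  assumes w: "weight w" and [measurable]: "F \<in> borel_measurable borel"
    and ab: "0 \<le> a" "a < b" "b \<le> 1" and J: "{a<..<b} \<subseteq> J" "J \<subseteq> {a..b}"
  shows "(\<integral>\<^sup>+t. ennreal (F (w t)) \<partial>lebesgue_on J) = emeasure (weight_measure (\<lambda>x. F (positive_version w x))) {a<..<b}"
proof -
  note [measurable] = positive_version_measurable[OF w]
  have "(\<integral>\<^sup>+t. ennreal (F (w t)) \<partial>lebesgue_on J) = (\<integral>\<^sup>+t. ennreal (F (w t)) * indicator J t \<partial>lebesgue)"
    by (rule nn_integral_restrict_space) (use interval_between_sets[OF ab(2) J] in simp)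
  also have "\<dots> = (\<integral>\<^sup>+t. ennreal (F (positive_version w t)) * indicator {0..1} t * indicator {a<..<b} t \<partial>lebesgue)"
  proof (rule nn_integral_cong_AE)
    have "AE y in lebesgue. y \<noteq> a" "AE y in lebesgue. y \<noteq> b"
      by (rule AE_completion[OF AE_lborel_singleton])+
    moreover have "AE x in lebesgue. x \<in> {0..1} \<longrightarrow> positive_version w x = w x"
      using AE_positive_version[OF w] by (simp only: AE_unit_leb_iff)
    ultimately show "AE t in lebesgue. ennreal (F (w t)) * indicator J t = ennreal (F (positive_version w t)) * indicator {0..1} t * indicator {a<..<b} t"
    proof eventually_elim
      case (elim t)
      have "t \<in> J \<longleftrightarrow> t \<in> {a<..<b}" using J elim by (auto simp: less_le)
      then show ?case using elim ab by (auto simp: indicator_def)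
    qed
  qed
  also have "\<dots> = emeasure (weight_measure (\<lambda>x. F (positive_version w x))) {a<..<b}"
    by (rule emeasure_weight_measure[symmetric]) auto
  finally show ?thesis .
qed

lemma ennpowr_ennreal: "ennpowr (ennreal x) a = ennreal (x powr a)" if "0 \<le> x"
  using that by (simp add: ennpowr_def)

lemma Muckenhoupt_product:
  assumes r: "1 < r" and D: "0 < D" and m: "0 \<le> m" and S: "0 \<le> S"
  shows "ennpowr (ennreal (1 / D) * ennreal m) (1 / r) * ennpowr (ennreal (1 / D) * ennreal S) (1 / conj_exponent r)
    = ennreal ((m * S powr (r - 1) / D powr r) powr (1 / r))"
proof -
  have e: "1 / conj_exponent r = (r - 1) * (1 / r)" using r by (simp add: conj_exponent_def)
  have "ennpowr (ennreal (1 / D) * ennreal m) (1 / r) * ennpowr (ennreal (1 / D) * ennreal S) (1 / conj_exponent r)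
    = ennreal ((m / D) powr (1 / r) * (S / D) powr (1 / conj_exponent r))"
    using D m S by (simp add: ennpowr_ennreal flip: ennreal_mult)
  also have "(S / D) powr (1 / conj_exponent r) = ((S / D) powr (r - 1)) powr (1 / r)"
    unfolding e powr_powr ..
  also have "(m / D) powr (1 / r) * ((S / D) powr (r - 1)) powr (1 / r) = ((m / D) * (S / D) powr (r - 1)) powr (1 / r)"
    by (rule powr_mult[symmetric])
  also have "(m / D) * (S / D) powr (r - 1) = m * S powr (r - 1) / D powr r"
  proof -
    have "D powr r = D * D powr (r - 1)" using D powr_add[of D 1 "r - 1"] by simp
    then show ?thesis by (simp add: powr_divide)
  qed
  finally show ?thesis .
qed

lemma one_minus_conj_exponent: "1 < r \<Longrightarrow> 1 - conj_exponent r = - 1 / (r - 1)"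
  by (simp add: conj_exponent_def field_simps)

text \<open>
  End points of intervals are null sets, so open intervals suffice. If the dual weight were not integrable
  over \<open>(0, 1)\<close>, the product for that interval would be infinite, as the average of
  \<open>w\<close> is positive.
\<close>

lemma Muckenhoupt_iff_Ap_condition:
  assumes w: "weight w" and r: "1 < r"
  shows "w \<in> Muckenhoupt r \<longleftrightarrow> (\<exists>A. Ap_condition (positive_version w) r A)"
proof -
  define W where "W = positive_version w"
  define \<sigma> where "\<sigma> = (\<lambda>x. W x powr (- 1 / (r - 1)))"
  have W [measurable]: "W \<in> borel_measurable lebesgue" and W0: "\<And>x. 0 < W x"
    using positive_version_measurable[OF w] positive_version_pos by (simp_all add: W_def)
  have \<sigma> [measurable]: "\<sigma> \<in> borel_measurable lebesgue" unfolding \<sigma>_def by measurable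
  have finW: "finite_measure (weight_measure W)" using finite_weight_measure[OF w] by (simp add: W_def)
  interpret W: finite_measure "weight_measure W" by fact
  have I1: "(\<integral>\<^sup>+t. ennreal (w t) \<partial>lebesgue_on J) = emeasure (weight_measure W) {a<..<b}"
    if "0 \<le> a" "a < b" "b \<le> 1" "{a<..<b} \<subseteq> J" "J \<subseteq> {a..b}" for a b J
    using nn_integral_lebesgue_on_interval[OF w, of "\<lambda>x. x", OF _ that] by (simp add: W_def)
  have I2: "(\<integral>\<^sup>+t. ennreal (w t powr (1 - conj_exponent r)) \<partial>lebesgue_on J) = emeasure (weight_measure \<sigma>) {a<..<b}"
    if "0 \<le> a" "a < b" "b \<le> 1" "{a<..<b} \<subseteq> J" "J \<subseteq> {a..b}" for a b J
    using nn_integral_lebesgue_on_interval[OF w, of "\<lambda>x. x powr (- 1 / (r - 1))", OF _ that] one_minus_conj_exponent[OF r]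
    by (simp add: W_def \<sigma>_def)
  define \<J> where "\<J> = {J. is_interval J \<and> J \<subseteq> {0..1::real} \<and> 0 < measure lebesgue J}"
  define \<Phi> where "\<Phi> J = ennpowr (ennreal (1 / measure lebesgue J) * (\<integral>\<^sup>+t. ennreal (w t) \<partial>lebesgue_on J)) (1 / r) *
      ennpowr (ennreal (1 / measure lebesgue J) *
        (\<integral>\<^sup>+t. ennreal (w t powr (1 - conj_exponent r)) \<partial>lebesgue_on J)) (1 / conj_exponent r)" for J
  have M: "w \<in> Muckenhoupt r \<longleftrightarrow> (SUP J\<in>\<J>. \<Phi> J) < \<infinity>"
    using w by (simp add: Muckenhoupt_def \<J>_def \<Phi>_def)
  have \<Phi>: "\<Phi> J = ennpowr (ennreal (1 / (b - a)) * emeasure (weight_measure W) {a<..<b}) (1 / r) *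
      ennpowr (ennreal (1 / (b - a)) * emeasure (weight_measure \<sigma>) {a<..<b}) (1 / conj_exponent r)"
    if "0 \<le> a" "a < b" "b \<le> 1" "{a<..<b} \<subseteq> J" "J \<subseteq> {a..b}" for a b J
    unfolding \<Phi>_def I1[OF that] I2[OF that] interval_between_sets(2)[OF that(2,4,5)] ..
  show ?thesis
  proof
    assume "w \<in> Muckenhoupt r"
    then have "(SUP J\<in>\<J>. \<Phi> J) < \<infinity>" by (simp add: M)
    then obtain K where K: "(SUP J\<in>\<J>. \<Phi> J) = ennreal K" "K \<ge> 0" by (cases "SUP J\<in>\<J>. \<Phi> J") auto
    have *: "ennpowr (ennreal (1 / (b - a)) * emeasure (weight_measure W) {a<..<b}) (1 / r) *
      ennpowr (ennreal (1 / (b - a)) * emeasure (weight_measure \<sigma>) {a<..<b}) (1 / conj_exponent r) \<le> ennreal K"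
      if ab: "0 \<le> a" "a < b" "b \<le> 1" for a b
    proof -
      have "{a<..<b} \<in> \<J>" using ab by (auto simp: \<J>_def is_interval_1)
      then have "\<Phi> {a<..<b} \<le> ennreal K" unfolding K(1)[symmetric] by (rule SUP_upper)
      then show ?thesis by (subst (asm) \<Phi>[OF ab]) auto
    qed
    have W_pos: "0 < measure (weight_measure W) {a<..<b}" if "0 \<le> a" "a < b" "b \<le> 1" for a b
      by (rule measure_weight_measure_interval_pos[OF W W0 finW that])
    have fin\<sigma>: "finite_measure (weight_measure \<sigma>)"
    proof (rule finite_measure_weight_measure_if_interval[OF \<sigma>], rule ccontr)
      assume "\<not> emeasure (weight_measure \<sigma>) {0<..<1} < \<infinity>"
      then have inf: "emeasure (weight_measure \<sigma>) {0<..<1} = top"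
        unfolding infinity_ennreal_def by (simp only: less_top[symmetric] not_not)
      have "ennpowr (ennreal (1 / (1 - 0)) * emeasure (weight_measure W) {0<..<1}) (1 / r) * top \<le> ennreal K"
        using *[of 0 1] by (simp add: inf ennpowr_def)
      moreover have "ennpowr (ennreal (1 / (1 - 0)) * emeasure (weight_measure W) {0<..<1}) (1 / r) \<noteq> 0"
        using W_pos[of 0 1] by (simp add: W.emeasure_eq_measure ennpowr_ennreal ennreal_eq_0_iff not_le)
      ultimately show False by (simp add: ennreal_mult_top top_unique)
    qed
    interpret \<sigma>: finite_measure "weight_measure \<sigma>" by fact
    have "Ap_condition W r (K powr r)"
      unfolding Ap_condition_def \<sigma>_def[symmetric]
    proof (intro conjI allI impI fin\<sigma>)
      fix a b :: real assume ab: "0 \<le> a" "a < b" "b \<le> 1"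
      define X where "X = measure (weight_measure W) {a<..<b} * measure (weight_measure \<sigma>) {a<..<b} powr (r - 1)"
      have X: "X \<ge> 0" by (simp add: X_def)
      have "ennreal ((X / (b - a) powr r) powr (1 / r)) \<le> ennreal K"
        using *[OF ab] unfolding W.emeasure_eq_measure \<sigma>.emeasure_eq_measure X_def
        by (subst (asm) Muckenhoupt_product) (use r ab in auto)
      then have "(X / (b - a) powr r) powr (1 / r) \<le> K" using K by simp
      then have "((X / (b - a) powr r) powr (1 / r)) powr r \<le> K powr r" using r by (intro powr_mono2) auto
      then have "X / (b - a) powr r \<le> K powr r" using r X by (simp add: powr_powr)
      then show "X \<le> K powr r * (b - a) powr r" using ab by (simp add: divide_le_eq)
    qed
    then show "\<exists>A. Ap_condition (positive_version w) r A" unfolding W_def by blast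
  next
    assume "\<exists>A. Ap_condition (positive_version w) r A"
    then obtain A where A: "Ap_condition W r A" by (auto simp: W_def)
    then have fin\<sigma>: "finite_measure (weight_measure \<sigma>)" unfolding Ap_condition_def \<sigma>_def by blast
    interpret \<sigma>: finite_measure "weight_measure \<sigma>" by fact
    have "(SUP J\<in>\<J>. \<Phi> J) \<le> ennreal (A powr (1 / r))"
    proof (rule SUP_least)
      fix J assume "J \<in> \<J>"
      then obtain a b where ab: "0 \<le> a" "a < b" "b \<le> 1" "{a<..<b} \<subseteq> J" "J \<subseteq> {a..b}"
        unfolding \<J>_def using interval_between_Ioo_Icc by blast
      have "\<Phi> J = ennreal ((measure (weight_measure W) {a<..<b} * measure (weight_measure \<sigma>) {a<..<b} powr (r - 1) / (b - a) powr r) powr (1 / r))"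
        unfolding \<Phi>[OF ab] W.emeasure_eq_measure \<sigma>.emeasure_eq_measure
        by (rule Muckenhoupt_product) (use r ab in auto)
      also have "\<dots> \<le> ennreal (A powr (1 / r))"
        using Ap_conditionD[OF A ab(1-3)] ab r unfolding \<sigma>_def
        by (intro ennreal_leI powr_mono2) (auto simp: divide_le_eq)
      finally show "\<Phi> J \<le> ennreal (A powr (1 / r))" .
    qed
    then show "w \<in> Muckenhoupt r" unfolding M using le_less_trans[OF _ ennreal_less_top] by simp
  qed
qed

section \<open>Comparison of the two grand norms\<close>

text \<open>
  Put \<open>v = u/(1 - \<alpha> u)\<close>, \<open>\<epsilon> = p - u\<close> and \<open>\<eta> = q -
  v\<close>. Then \<open>\<eta> = \<epsilon> / ((1 - \<alpha> p) (1 - \<alpha> u))\<close> is comparable to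
  \<open>\<epsilon>\<close>. The exponent of \<open>\<eta>\<close> is \<open>\<theta> (1 + \<alpha> q)/v =
  \<theta>/u + \<theta> \<alpha> \<eta>/v\<close>, and the additional factor \<open>\<eta> powr (\<theta>
  \<alpha> \<eta>/v)\<close> stays between two positive constants since \<open>\<eta> ln \<eta>\<close> is
  bounded for \<open>0 < \<eta> < q\<close>.
\<close>

lemma exponent_comparison:
  fixes p \<alpha> \<theta> q :: real
  assumes p: "1 < p" and \<alpha>: "0 < \<alpha>" "\<alpha> * p < 1" and \<theta>: "0 < \<theta>" and q: "q = p / (1 - \<alpha> * p)"
  obtains K where "1 \<le> K" "\<And>u. 1 < u \<Longrightarrow> u < p \<Longrightarrow>
      (q - u / (1 - \<alpha> * u)) powr (\<theta> * (1 + \<alpha> * q) / (u / (1 - \<alpha> * u))) \<le> K * (p - u) powr (\<theta> / u) \<and>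
      (p - u) powr (\<theta> / u) \<le> K * (q - u / (1 - \<alpha> * u)) powr (\<theta> * (1 + \<alpha> * q) / (u / (1 - \<alpha> * u)))"
proof -
  define E where "E = 1 / (1 - \<alpha> * p)\<^sup>2"
  define K where "K = max 1 (max (E powr \<theta> * q powr (\<theta> * \<alpha> * q)) (exp (\<theta> * \<alpha>)))"
  have ap: "0 < \<alpha> * p" using p \<alpha> by simp
  have q1: "q > 1"
  proof -
    have "1 - \<alpha> * p < p" using ap p by linarith
    then show ?thesis using \<alpha> by (simp add: q)
  qed
  have E1: "E \<ge> 1"
  proof -
    have "(1 - \<alpha> * p)\<^sup>2 \<le> 1" using ap \<alpha> by (intro power_le_one) auto
    then show ?thesis using \<alpha> by (simp add: E_def)
  qed
  show ?thesis
  proof (rule that[of K])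
    show "1 \<le> K" by (simp add: K_def)
    fix u assume u: "1 < u" "u < p"
    define v where "v = u / (1 - \<alpha> * u)"
    define \<eta> where "\<eta> = q - v"
    define \<epsilon> where "\<epsilon> = p - u"
    have "\<alpha> * u < \<alpha> * p" using u \<alpha> by simp
    then have au: "\<alpha> * u < 1" "0 < \<alpha> * u" using \<alpha> u by (linarith, simp)
    have v1: "v > 1"
    proof -
      have "1 - \<alpha> * u < u" using au u by linarith
      then show ?thesis using au by (simp add: v_def)
    qed
    have \<epsilon>0: "\<epsilon> > 0" using u by (simp add: \<epsilon>_def)
    have \<eta>_eq: "\<eta> = \<epsilon> / ((1 - \<alpha> * p) * (1 - \<alpha> * u))"
      using au \<alpha> by (simp add: \<eta>_def \<epsilon>_def v_def q field_simps)
    have den: "(1 - \<alpha> * p)\<^sup>2 \<le> (1 - \<alpha> * p) * (1 - \<alpha> * u)" "(1 - \<alpha> * p) * (1 - \<alpha> * u) \<le> 1" "0 < (1 - \<alpha> * p) * (1 - \<alpha> * u)"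
    proof -
      show "(1 - \<alpha> * p)\<^sup>2 \<le> (1 - \<alpha> * p) * (1 - \<alpha> * u)"
        unfolding power2_eq_square using \<open>\<alpha> * u < \<alpha> * p\<close> \<alpha> by (intro mult_left_mono) auto
      show "(1 - \<alpha> * p) * (1 - \<alpha> * u) \<le> 1" using au ap \<alpha> by (intro mult_le_one) auto
      show "0 < (1 - \<alpha> * p) * (1 - \<alpha> * u)" using au \<alpha> by simp
    qed
    have \<epsilon>\<eta>: "\<epsilon> \<le> \<eta>"
    proof -
      have "\<epsilon> / 1 \<le> \<eta>" unfolding \<eta>_eq using den \<epsilon>0 by (intro divide_left_mono) auto
      then show ?thesis by simp
    qed
    have \<eta>\<epsilon>: "\<eta> \<le> E * \<epsilon>"
    proof -
      have "\<eta> \<le> \<epsilon> / (1 - \<alpha> * p)\<^sup>2" unfolding \<eta>_eq using den \<epsilon>0 \<alpha> au by (intro divide_left_mono mult_pos_pos) auto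
      then show ?thesis by (simp add: E_def)
    qed
    have \<eta>0: "0 < \<eta>" using \<epsilon>0 \<epsilon>\<eta> by simp
    have \<eta>q: "\<eta> < q" using v1 by (simp add: \<eta>_def)
    define c where "c = \<theta> * \<alpha> / v"
    have c: "0 < c" "c \<le> \<theta> * \<alpha>"
    proof -
      show "0 < c" using \<theta> \<alpha> v1 by (simp add: c_def)
      have "\<theta> * \<alpha> / v \<le> \<theta> * \<alpha> / 1" using \<theta> \<alpha> v1 by (intro divide_left_mono) auto
      then show "c \<le> \<theta> * \<alpha>" by (simp add: c_def)
    qed
    have ex: "\<theta> * (1 + \<alpha> * q) / v = \<theta> / u + c * \<eta>"
    proof -
      have "1 / u = 1 / v + \<alpha>" using u au by (simp add: v_def field_simps)
      then have "\<theta> / u = \<theta> / v + \<theta> * \<alpha>" by (metis (no_types, opaque_lifting) distrib_left mult.right_neutral times_divide_eq_right)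
      moreover have "\<theta> * (1 + \<alpha> * q) / v = \<theta> / v + \<theta> * \<alpha> + c * \<eta>"
        using v1 by (simp add: c_def \<eta>_def field_simps)
      ultimately show ?thesis by simp
    qed
    have split: "\<eta> powr (\<theta> * (1 + \<alpha> * q) / v) = \<eta> powr (\<theta> / u) * \<eta> powr (c * \<eta>)"
      unfolding ex by (rule powr_add)
    have up: "\<eta> powr (c * \<eta>) \<le> q powr (\<theta> * \<alpha> * q)"
    proof -
      have "\<eta> powr (c * \<eta>) \<le> q powr (c * \<eta>)" using c \<eta>0 \<eta>q by (intro powr_mono2) auto
      also have "\<dots> \<le> q powr (\<theta> * \<alpha> * q)" using c \<eta>0 \<eta>q q1 by (intro powr_mono mult_mono) auto
      finally show ?thesis .
    qed
    have low: "exp (- (\<theta> * \<alpha>)) \<le> \<eta> powr (c * \<eta>)"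
    proof -
      have "ln (1 / \<eta>) \<le> 1 / \<eta> - 1" using \<eta>0 by (intro ln_le_minus_one) auto
      then have "- ln \<eta> \<le> 1 / \<eta> - 1" using \<eta>0 by (simp add: ln_div)
      then have "\<eta> * - ln \<eta> \<le> \<eta> * (1 / \<eta> - 1)" using \<eta>0 by (intro mult_left_mono) auto
      then have "- 1 \<le> \<eta> * ln \<eta>" using \<eta>0 by (simp add: algebra_simps)
      then have "c * - 1 \<le> c * (\<eta> * ln \<eta>)" using c by (intro mult_left_mono) auto
      then have "- (\<theta> * \<alpha>) \<le> c * \<eta> * ln \<eta>" using c by (simp add: mult.assoc)
      then show ?thesis using \<eta>0 by (simp add: powr_def)
    qed
    have "\<eta> powr (\<theta> / u) \<le> (E * \<epsilon>) powr (\<theta> / u)" using \<eta>0 \<eta>\<epsilon> \<theta> u by (intro powr_mono2) auto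
    also have "\<dots> = E powr (\<theta> / u) * \<epsilon> powr (\<theta> / u)" by (rule powr_mult)
    also have "\<dots> \<le> E powr \<theta> * \<epsilon> powr (\<theta> / u)"
      using E1 u \<theta> by (intro mult_right_mono powr_mono) (auto simp: field_simps)
    finally have "\<eta> powr (\<theta> * (1 + \<alpha> * q) / v) \<le> E powr \<theta> * \<epsilon> powr (\<theta> / u) * q powr (\<theta> * \<alpha> * q)"
      unfolding split using up by (intro mult_mono) auto
    also have "\<dots> = (E powr \<theta> * q powr (\<theta> * \<alpha> * q)) * \<epsilon> powr (\<theta> / u)" by simp
    also have "\<dots> \<le> K * \<epsilon> powr (\<theta> / u)" by (intro mult_right_mono) (auto simp: K_def)
    finally have 1: "\<eta> powr (\<theta> * (1 + \<alpha> * q) / v) \<le> K * \<epsilon> powr (\<theta> / u)" .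
    have "\<epsilon> powr (\<theta> / u) \<le> \<eta> powr (\<theta> / u)" using \<epsilon>0 \<epsilon>\<eta> \<theta> u by (intro powr_mono2) auto
    also have "\<dots> = exp (\<theta> * \<alpha>) * (\<eta> powr (\<theta> / u) * exp (- (\<theta> * \<alpha>)))" by (simp add: exp_minus)
    also have "\<dots> \<le> exp (\<theta> * \<alpha>) * (\<eta> powr (\<theta> / u) * \<eta> powr (c * \<eta>))"
      using low by (intro mult_left_mono) auto
    also have "\<dots> \<le> K * \<eta> powr (\<theta> * (1 + \<alpha> * q) / v)"
      unfolding split by (intro mult_right_mono) (auto simp: K_def)
    finally have 2: "\<epsilon> powr (\<theta> / u) \<le> K * \<eta> powr (\<theta> * (1 + \<alpha> * q) / v)" .
    show "(q - u / (1 - \<alpha> * u)) powr (\<theta> * (1 + \<alpha> * q) / (u / (1 - \<alpha> * u))) \<le> K * (p - u) powr (\<theta> / u) \<and>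
      (p - u) powr (\<theta> / u) \<le> K * (q - u / (1 - \<alpha> * u)) powr (\<theta> * (1 + \<alpha> * q) / (u / (1 - \<alpha> * u)))"
      using 1 2 unfolding \<eta>_def \<epsilon>_def v_def by blast
  qed
qed

section \<open>Sufficiency of the Muckenhoupt condition\<close>

lemma le_of_ennpowr_le:
  assumes "ennpowr (ennreal c * I) (1 / u) \<le> ennreal g" "0 < c" "0 < u" "0 \<le> g"
  shows "I \<le> ennreal (g powr u / c)"
proof -
  have "ennreal c * I \<noteq> \<infinity>"
  proof
    assume "ennreal c * I = \<infinity>"
    then have "ennpowr (ennreal c * I) (1 / u) = \<infinity>" by (simp add: ennpowr_def)
    then show False using assms(1) by (simp add: top_unique)
  qed
  then have "I \<noteq> top" using assms(2) by (auto simp: ennreal_mult_top)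
  then obtain I' where I: "I = ennreal I'" "0 \<le> I'" by (cases I) auto
  have "ennreal c * I = ennreal (c * I')" using I assms(2) by (simp add: ennreal_mult)
  then have "ennreal ((c * I') powr (1 / u)) \<le> ennreal g" using assms(1,2) I by (simp add: ennpowr_ennreal)
  then have "(c * I') powr (1 / u) \<le> g" using assms(4) by simp
  then have "((c * I') powr (1 / u)) powr u \<le> g powr u" using assms(3) by (intro powr_mono2) auto
  then have "c * I' \<le> g powr u" using assms(2,3) I by (simp add: powr_powr)
  then show ?thesis using I assms(2) by (auto intro!: ennreal_leI simp: field_simps)
qed

lemma ennpowr_le_of_le:
  assumes "I \<le> ennreal B" "0 \<le> c" "0 < u" "0 \<le> B"
  shows "ennpowr (ennreal c * I) (1 / u) \<le> ennreal ((c * B) powr (1 / u))"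
proof -
  obtain I' where I: "I = ennreal I'" "0 \<le> I'"
    using le_less_trans[OF assms(1) ennreal_less_top] by (cases I) auto
  then have "I' \<le> B" using assms by simp
  then show ?thesis using I assms(2,3)
    by (auto simp: ennpowr_ennreal simp flip: ennreal_mult intro!: ennreal_leI powr_mono2 mult_left_mono)
qed

lemma ennpowr_ge_of_ge:
  assumes "ennreal B \<le> I" "0 \<le> c" "0 < u" "0 \<le> B"
  shows "ennreal ((c * B) powr (1 / u)) \<le> ennpowr (ennreal c * I) (1 / u)"
proof (cases "ennreal c * I = \<infinity>")
  case True then show ?thesis by (simp add: ennpowr_def)
next
  case False
  then obtain x where x: "ennreal c * I = ennreal x" "0 \<le> x" by (cases "ennreal c * I") auto
  have "ennreal (c * B) \<le> ennreal x"
    unfolding x(1)[symmetric] using assms by (simp add: ennreal_mult mult_left_mono)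
  then have "c * B \<le> x" using x by simp
  then show ?thesis using x assms by (auto simp: ennpowr_ennreal intro!: ennreal_leI powr_mono2)
qed

lemma riesz_potential_bound:
  assumes w: "weight w" and f [measurable]: "f \<in> borel_measurable unit_leb"
    and fin: "riesz_majorant \<alpha> (\<lambda>y. (if y \<in> {0..1} then \<bar>f y\<bar> else 0) * positive_version w y powr \<alpha>) x \<le> ennreal G"
    and G: "0 \<le> G"
  shows "integrable unit_leb (\<lambda>y. f y * w y powr \<alpha> / \<bar>x - y\<bar> powr (1 - \<alpha>))"
    and "\<bar>riesz_potential \<alpha> (\<lambda>y. f y * w y powr \<alpha>) x\<bar> \<le> G"
proof -
  note [measurable] = weight_unit_leb_measurable[OF w]
  have [measurable]: "(\<lambda>y::real. y) \<in> borel_measurable unit_leb"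
    by (intro measurable_restrict_space1 measurable_completion) simp
  have "(\<integral>\<^sup>+y. ennreal (norm (f y * w y powr \<alpha> / \<bar>x - y\<bar> powr (1 - \<alpha>))) \<partial>unit_leb) =
     (\<integral>\<^sup>+y. ennreal ((if y \<in> {0..1} then \<bar>f y\<bar> else 0) * positive_version w y powr \<alpha> / \<bar>x - y\<bar> powr (1 - \<alpha>)) \<partial>unit_leb)"
    by (rule nn_integral_cong_AE)
       (use AE_positive_version[OF w] AE_space[of unit_leb] in eventually_elim, auto simp: abs_mult abs_divide)
  also have "\<dots> = riesz_majorant \<alpha> (\<lambda>y. (if y \<in> {0..1} then \<bar>f y\<bar> else 0) * positive_version w y powr \<alpha>) x"
    unfolding riesz_majorant_def by (rule nn_integral_restrict_space) simp
  also note fin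
  finally have le: "(\<integral>\<^sup>+y. ennreal (norm (f y * w y powr \<alpha> / \<bar>x - y\<bar> powr (1 - \<alpha>))) \<partial>unit_leb) \<le> ennreal G" .
  show int: "integrable unit_leb (\<lambda>y. f y * w y powr \<alpha> / \<bar>x - y\<bar> powr (1 - \<alpha>))"
  proof (rule integrableI_bounded)
    show "(\<lambda>y. f y * w y powr \<alpha> / \<bar>x - y\<bar> powr (1 - \<alpha>)) \<in> borel_measurable unit_leb" by measurable
  qed (use le_less_trans[OF le ennreal_less_top] in simp)
  have "ennreal (norm (riesz_potential \<alpha> (\<lambda>y. f y * w y powr \<alpha>) x)) \<le> ennreal G"
    unfolding riesz_potential_def by (rule order_trans[OF integral_norm_bound_ennreal[OF int] le])
  then show "\<bar>riesz_potential \<alpha> (\<lambda>y. f y * w y powr \<alpha>) x\<bar> \<le> G" using G by simp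
qed

text \<open>
  For \<open>v\<close> close to \<open>q\<close> the strong type estimate at the corresponding
  \<open>u\<close> is combined with the comparison of prefactors. For the remaining \<open>v\<close>, which
  lie below a fixed \<open>v0 < q\<close>, the estimate at \<open>v0\<close> is used on the finite measure
  space.
\<close>

lemma grand_inequality_if_Ap_condition:
  fixes p \<alpha> \<theta> q :: real
  assumes p: "1 < p" and \<alpha>: "0 < \<alpha>" "\<alpha> * p < 1" and \<theta>: "0 < \<theta>" and q: "q = p / (1 - \<alpha> * p)"
    and w: "weight w" and r: "r = 1 + (p - 1) / (1 - \<alpha> * p)" and Ap: "Ap_condition (positive_version w) r A"
  shows "\<exists>c::real. 0 < c \<and> (\<forall>f \<in> grand_Lebesgue p \<theta> w.
        riesz_potential_defined \<alpha> (\<lambda>y. f y * w y powr \<alpha>) \<and>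
        grand_norm q (\<theta> * (1 + \<alpha> * q)) w (riesz_potential \<alpha> (\<lambda>y. f y * w y powr \<alpha>))
          \<le> ennreal c * grand_norm p \<theta> w f)"
proof -
  define W where "W = positive_version w"
  have W [measurable]: "W \<in> borel_measurable lebesgue" and W0: "\<And>x. 0 < W x"
    using positive_version_measurable[OF w] positive_version_pos by (simp_all add: W_def)
  have finW: "finite_measure (weight_measure W)" using finite_weight_measure[OF w] by (simp add: W_def)
  interpret W: finite_measure "weight_measure W" by fact
  define \<mu> where "\<mu> = measure (weight_measure W) UNIV"
  have r1: "1 < r" using p \<alpha> by (simp add: r)
  obtain \<rho> B where \<rho>: "1 < \<rho>" "\<rho> < r" and B: "Ap_condition W \<rho> B"
    using Ap_condition_open[OF W W0 finW r1] Ap unfolding W_def by metis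
  \<comment> \<open>The solution of \<open>\<rho> = 1 + (s - 1)/(1 - \<alpha> s)\<close>; as \<open>\<rho> < r\<close>, it is smaller than \<open>p\<close>.\<close>
  define s where "s = \<rho> / (1 + \<alpha> * (\<rho> - 1))"
  have \<alpha>1: "\<alpha> < 1" using p \<alpha> mult_strict_left_mono[of 1 p \<alpha>] by linarith
  have den: "0 < 1 + \<alpha> * (\<rho> - 1)" using \<alpha> \<rho> by (simp add: add_pos_pos)
  have s1: "1 < s"
  proof -
    have "\<alpha> * (\<rho> - 1) < 1 * (\<rho> - 1)" using \<alpha>1 \<rho> by (intro mult_strict_right_mono) auto
    then show ?thesis using den by (simp add: s_def)
  qed
  have sp: "s < p"
  proof -
    have "\<rho> - 1 < (p - 1) / (1 - \<alpha> * p)" using \<rho>(2) by (simp add: r)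
    then have "(\<rho> - 1) * (1 - \<alpha> * p) < p - 1" using \<alpha> by (simp only: pos_less_divide_eq)
    then have "\<rho> < p * (1 + \<alpha> * (\<rho> - 1))" by (simp add: algebra_simps)
    then show ?thesis using den by (simp add: s_def pos_divide_less_eq)
  qed
  have \<rho>s: "\<rho> = 1 + (s - 1) / (1 - \<alpha> * s)"
  proof -
    have "1 - \<alpha> * s = (1 - \<alpha>) / (1 + \<alpha> * (\<rho> - 1))" using den by (simp add: s_def field_simps)
    moreover have "s - 1 = (\<rho> - 1) * (1 - \<alpha>) / (1 + \<alpha> * (\<rho> - 1))" using den by (simp add: s_def field_simps)
    ultimately show ?thesis using den \<alpha>1 by simp
  qed
  define p0 where "p0 = (s + p) / 2"
  have p0: "s < p0" "p0 < p" using sp by (auto simp: p0_def)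
  obtain C where C: "0 < C" and strong: "\<And>u f N. p0 \<le> u \<Longrightarrow> u \<le> p \<Longrightarrow> f \<in> borel_measurable lebesgue \<Longrightarrow> (\<And>x. 0 \<le> f x) \<Longrightarrow> 0 < N \<Longrightarrow>
     (\<integral>\<^sup>+y. ennreal (f y powr u) \<partial>weight_measure W) \<le> ennreal (N powr u) \<Longrightarrow>
     \<exists>g. g \<in> borel_measurable lebesgue \<and> (\<forall>x. 0 \<le> g x) \<and>
       (AE x in weight_measure W. riesz_majorant \<alpha> (\<lambda>y. f y * W y powr \<alpha>) x \<le> ennreal (g x)) \<and>
       (\<integral>\<^sup>+x. ennreal (g x powr (u / (1 - \<alpha> * u))) \<partial>weight_measure W) \<le> ennreal ((C * N) powr (u / (1 - \<alpha> * u)))"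
  proof (rule Riesz_strong_type_uniform[OF W W0 finW s1 p0(1) less_imp_le[OF p0(2)] \<alpha> \<rho>s B], goal_cases)
    case (1 C)
    show ?case by (rule 1(1)) (fact 1)+
  qed
  define \<theta>' where "\<theta>' = \<theta> * (1 + \<alpha> * q)"
  obtain K where K: "1 \<le> K" and Kc: "\<And>u. 1 < u \<Longrightarrow> u < p \<Longrightarrow>
      (q - u / (1 - \<alpha> * u)) powr (\<theta>' / (u / (1 - \<alpha> * u))) \<le> K * (p - u) powr (\<theta> / u)"
    unfolding \<theta>'_def by (rule exponent_comparison[OF p \<alpha> \<theta> q]) blast
  have ap: "0 < \<alpha> * p" using p \<alpha> by simp
  have q1: "q > 1"
  proof -
    have "1 - \<alpha> * p < p" using ap p by linarith
    then show ?thesis using \<alpha> by (simp add: q)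
  qed
  have \<theta>'0: "0 < \<theta>'" using \<theta> \<alpha> q1 by (simp add: \<theta>'_def add_pos_pos)
  have ap0: "\<alpha> * p0 < 1" using \<alpha> p0 mult_strict_left_mono[of p0 p \<alpha>] by linarith
  define v0 where "v0 = p0 / (1 - \<alpha> * p0)"
  define \<tau> where "\<tau> = (p - p0) powr - (\<theta> / p0)"
  define c where "c = max (C * K) (q powr \<theta>' * (\<mu> + 1) * C * \<tau>)"
  have c: "c > 0" using C K by (simp add: c_def less_max_iff_disj)
  \<comment> \<open>An upper bound \<open>g > 0\<close> replaces the norm of \<open>f\<close>, which may vanish.\<close>
  have main: "riesz_potential_defined \<alpha> (\<lambda>y. f y * w y powr \<alpha>) \<and>
        grand_norm q \<theta>' w (riesz_potential \<alpha> (\<lambda>y. f y * w y powr \<alpha>)) \<le> ennreal (c * g)"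
    if f: "f \<in> grand_Lebesgue p \<theta> w" and g: "0 < g" "grand_norm p \<theta> w f \<le> ennreal g" for f g
  proof -
    have f_meas: "f \<in> borel_measurable unit_leb" using f by (simp add: grand_Lebesgue_def)
    define F where "F y = (if y \<in> {0..1} then \<bar>f y\<bar> else 0)" for y
    have F [measurable]: "F \<in> borel_measurable lebesgue"
      using measurable_extend_unit_leb[of "\<lambda>y. \<bar>f y\<bar>"] f_meas unfolding F_def by measurable
    have F0: "0 \<le> F y" for y by (simp add: F_def)
    define R where "R = riesz_potential \<alpha> (\<lambda>y. f y * w y powr \<alpha>)"
    have FN: "(\<integral>\<^sup>+y. ennreal (F y powr u) \<partial>weight_measure W) \<le> ennreal ((g * (p - u) powr - (\<theta> / u)) powr u)"
      if u: "1 < u" "u < p" for u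
    proof -
      have "ennpowr (ennreal ((p - u) powr \<theta>) * (\<integral>\<^sup>+t. ennreal (\<bar>f t\<bar> powr (p - (p - u)) * w t) \<partial>unit_leb)) (1 / (p - (p - u))) \<le> grand_norm p \<theta> w f"
        unfolding grand_norm_def by (rule SUP_upper) (use u in auto)
      then have "ennpowr (ennreal ((p - u) powr \<theta>) * (\<integral>\<^sup>+t. ennreal (\<bar>f t\<bar> powr u * w t) \<partial>unit_leb)) (1 / u) \<le> ennreal g"
        using g by simp
      then have "(\<integral>\<^sup>+t. ennreal (\<bar>f t\<bar> powr u * w t) \<partial>unit_leb) \<le> ennreal (g powr u / (p - u) powr \<theta>)"
        by (rule le_of_ennpowr_le) (use u g in auto)
      also have "g powr u / (p - u) powr \<theta> = (g * (p - u) powr - (\<theta> / u)) powr u"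
        unfolding powr_mult powr_powr using u by (simp add: powr_minus_divide)
      also have "(\<integral>\<^sup>+t. ennreal (\<bar>f t\<bar> powr u * w t) \<partial>unit_leb) = (\<integral>\<^sup>+t. ennreal (F t powr u * w t) \<partial>unit_leb)"
        by (intro nn_integral_cong) (auto simp: F_def)
      also have "\<dots> = (\<integral>\<^sup>+y. ennreal (F y powr u) \<partial>weight_measure W)"
        unfolding W_def by (rule nn_integral_unit_leb_weight[OF w]) auto
      finally show ?thesis .
    qed
    have bound: "\<exists>G. G \<in> borel_measurable lebesgue \<and> (\<forall>x. 0 \<le> G x) \<and>
        (AE x in unit_leb. integrable unit_leb (\<lambda>y. f y * w y powr \<alpha> / \<bar>x - y\<bar> powr (1 - \<alpha>)) \<and> \<bar>R x\<bar> \<le> G x) \<and>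
        (\<integral>\<^sup>+x. ennreal (G x powr (u / (1 - \<alpha> * u))) \<partial>weight_measure W) \<le> ennreal ((C * (g * (p - u) powr - (\<theta> / u))) powr (u / (1 - \<alpha> * u)))"
      if u: "p0 \<le> u" "u < p" for u
    proof -
      have u1: "1 < u" using u p0 s1 by simp
      obtain G where G: "G \<in> borel_measurable lebesgue" "\<forall>x. 0 \<le> G x"
       "AE x in weight_measure W. riesz_majorant \<alpha> (\<lambda>y. F y * W y powr \<alpha>) x \<le> ennreal (G x)"
       "(\<integral>\<^sup>+x. ennreal (G x powr (u / (1 - \<alpha> * u))) \<partial>weight_measure W) \<le> ennreal ((C * (g * (p - u) powr - (\<theta> / u))) powr (u / (1 - \<alpha> * u)))"
        using strong[of u F "g * (p - u) powr - (\<theta> / u)", OF u(1) less_imp_le[OF u(2)] F F0 _ FN[OF u1 u(2)]] g u by auto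
      have "AE x in unit_leb. riesz_majorant \<alpha> (\<lambda>y. F y * W y powr \<alpha>) x \<le> ennreal (G x)"
        using G(3) unfolding W_def AE_weight_measure_iff[OF w] .
      then have "AE x in unit_leb. integrable unit_leb (\<lambda>y. f y * w y powr \<alpha> / \<bar>x - y\<bar> powr (1 - \<alpha>)) \<and> \<bar>R x\<bar> \<le> G x"
      proof eventually_elim
        case (elim x)
        note rb = riesz_potential_bound[OF w f_meas elim[unfolded F_def W_def] G(2)[rule_format]]
        then show ?case by (simp add: R_def)
      qed
      then show ?thesis using G by blast
    qed
    have defined: "riesz_potential_defined \<alpha> (\<lambda>y. f y * w y powr \<alpha>)"
      unfolding riesz_potential_defined_def using bound[OF order.refl p0(2)] by (auto elim: eventually_mono)
    have R_le: "(\<integral>\<^sup>+t. ennreal (\<bar>R t\<bar> powr v * w t) \<partial>unit_leb) \<le> (\<integral>\<^sup>+t. ennreal (H t) \<partial>weight_measure W)"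
      if H: "H \<in> borel_measurable lebesgue" "\<And>x. 0 \<le> H x" "AE x in unit_leb. \<bar>R x\<bar> powr v \<le> H x" for H v
    proof -
      have "AE x in unit_leb. 0 < w x" using w by (simp add: weight_def)
      then have "AE t in unit_leb. ennreal (\<bar>R t\<bar> powr v * w t) \<le> ennreal (H t * w t)"
        using H(3) by eventually_elim (auto intro!: ennreal_leI mult_right_mono)
      then have "(\<integral>\<^sup>+t. ennreal (\<bar>R t\<bar> powr v * w t) \<partial>unit_leb) \<le> (\<integral>\<^sup>+t. ennreal (H t * w t) \<partial>unit_leb)"
        by (rule nn_integral_mono_AE)
      also have "\<dots> = (\<integral>\<^sup>+t. ennreal (H t) \<partial>weight_measure W)"
        unfolding W_def by (rule nn_integral_unit_leb_weight[OF w H(1,2)])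
      finally show ?thesis .
    qed
    have "grand_norm q \<theta>' w R \<le> ennreal (c * g)"
      unfolding grand_norm_def
    proof (rule SUP_least)
      fix \<eta> assume "\<eta> \<in> {0<..<q - 1}"
      then have \<eta>: "0 < \<eta>" "\<eta> < q - 1" by auto
      define v where "v = q - \<eta>"
      have v: "1 < v" "v < q" using \<eta> by (auto simp: v_def)
      have "ennpowr (ennreal (\<eta> powr \<theta>') * (\<integral>\<^sup>+t. ennreal (\<bar>R t\<bar> powr v * w t) \<partial>unit_leb)) (1 / v) \<le> ennreal (c * g)"
      proof (cases "v0 \<le> v")
        case True
        \<comment> \<open>The solution of \<open>v = u/(1 - \<alpha> u)\<close>.\<close>
        define u where "u = v / (1 + \<alpha> * v)"
        have dv: "0 < 1 + \<alpha> * v" using v \<alpha> by (simp add: add_pos_pos)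
        have au: "1 - \<alpha> * u = 1 / (1 + \<alpha> * v)" using dv by (simp add: u_def field_simps)
        have vu: "v = u / (1 - \<alpha> * u)" unfolding au using dv by (simp add: u_def)
        have pu: "p0 \<le> u"
        proof -
          have "p0 \<le> v * (1 - \<alpha> * p0)" using True ap0 by (simp add: v0_def pos_divide_le_eq)
          then have "p0 * (1 + \<alpha> * v) \<le> v" by (simp add: algebra_simps)
          then show ?thesis using dv by (simp add: u_def pos_le_divide_eq)
        qed
        have up: "u < p"
        proof -
          have "v * (1 - \<alpha> * p) < p" using v(2) \<alpha> by (simp add: q pos_less_divide_eq)
          then have "v < p * (1 + \<alpha> * v)" by (simp add: algebra_simps)
          then show ?thesis using dv by (simp add: u_def pos_divide_less_eq)
        qed
        have u1: "1 < u" using pu p0 s1 by simp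
        obtain G where G: "G \<in> borel_measurable lebesgue" "\<forall>x. 0 \<le> G x"
          "AE x in unit_leb. integrable unit_leb (\<lambda>y. f y * w y powr \<alpha> / \<bar>x - y\<bar> powr (1 - \<alpha>)) \<and> \<bar>R x\<bar> \<le> G x"
          "(\<integral>\<^sup>+x. ennreal (G x powr v) \<partial>weight_measure W) \<le> ennreal ((C * (g * (p - u) powr - (\<theta> / u))) powr v)"
          using bound[OF pu up] unfolding vu[symmetric] by blast
        have "(\<integral>\<^sup>+t. ennreal (\<bar>R t\<bar> powr v * w t) \<partial>unit_leb) \<le> (\<integral>\<^sup>+t. ennreal (G t powr v) \<partial>weight_measure W)"
        proof (rule R_le)
          show "(\<lambda>t. G t powr v) \<in> borel_measurable lebesgue" using G(1) by measurable
          show "AE x in unit_leb. \<bar>R x\<bar> powr v \<le> G x powr v"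
            using G(3) by eventually_elim (use v in \<open>auto intro!: powr_mono2\<close>)
        qed simp
        also note G(4)
        finally have "ennpowr (ennreal (\<eta> powr \<theta>') * (\<integral>\<^sup>+t. ennreal (\<bar>R t\<bar> powr v * w t) \<partial>unit_leb)) (1 / v) \<le>
          ennreal ((\<eta> powr \<theta>' * (C * (g * (p - u) powr - (\<theta> / u))) powr v) powr (1 / v))"
          by (rule ennpowr_le_of_le) (use v in auto)
        also have "\<dots> \<le> ennreal (c * g)"
        proof (rule ennreal_leI)
          have "(\<eta> powr \<theta>' * (C * (g * (p - u) powr - (\<theta> / u))) powr v) powr (1 / v) = \<eta> powr (\<theta>' / v) * (C * (g * (p - u) powr - (\<theta> / u)))"
            using v C g unfolding powr_mult[of "\<eta> powr \<theta>'"] by (simp add: powr_powr)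
          also have "\<eta> = q - u / (1 - \<alpha> * u)" by (simp add: v_def flip: vu)
          also have "(q - u / (1 - \<alpha> * u)) powr (\<theta>' / v) \<le> K * (p - u) powr (\<theta> / u)"
            unfolding vu using Kc[OF u1 up] unfolding vu[symmetric] .
          finally have "(\<eta> powr \<theta>' * (C * (g * (p - u) powr - (\<theta> / u))) powr v) powr (1 / v) \<le>
             K * (p - u) powr (\<theta> / u) * (C * (g * (p - u) powr - (\<theta> / u)))"
            using C g by (simp add: mult_right_mono v_def flip: vu)
          also have "\<dots> = C * K * g * ((p - u) powr (\<theta> / u) * (p - u) powr - (\<theta> / u))" by (simp only: mult_ac)
          also have "(p - u) powr (\<theta> / u) * (p - u) powr - (\<theta> / u) = 1" using up by (simp flip: powr_add)
          also have "C * K * g * 1 \<le> c * g" using g by (simp add: c_def mult_right_mono)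
          finally show "(\<eta> powr \<theta>' * (C * (g * (p - u) powr - (\<theta> / u))) powr v) powr (1 / v) \<le> c * g" .
        qed
        finally show ?thesis .
      next
        case False
        then have vv: "v < v0" by simp
        \<comment> \<open>A bound for the norm of the potential at the exponent \<open>v0\<close>; smaller exponents are reached by
             splitting the values of the potential at height \<open>\<kappa>\<close>.\<close>
        define \<kappa> where "\<kappa> = C * (g * \<tau>)"
        have \<kappa>: "\<kappa> > 0" using C g p0 by (simp add: \<kappa>_def \<tau>_def)
        obtain G where G: "G \<in> borel_measurable lebesgue" "\<forall>x. 0 \<le> G x"
          "AE x in unit_leb. integrable unit_leb (\<lambda>y. f y * w y powr \<alpha> / \<bar>x - y\<bar> powr (1 - \<alpha>)) \<and> \<bar>R x\<bar> \<le> G x"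
          "(\<integral>\<^sup>+x. ennreal (G x powr v0) \<partial>weight_measure W) \<le> ennreal (\<kappa> powr v0)"
          using bound[OF order.refl p0(2)] unfolding v0_def[symmetric] \<tau>_def[symmetric] \<kappa>_def by blast
        have [measurable]: "G \<in> borel_measurable (weight_measure W)" using G(1) by (simp cong: measurable_cong_sets)
        have pw: "a powr v \<le> \<kappa> powr v + \<kappa> powr (v - v0) * a powr v0" if "0 \<le> a" for a
        proof (cases "a \<le> \<kappa>")
          case True
          then have "a powr v \<le> \<kappa> powr v" using that v by (intro powr_mono2) auto
          then show ?thesis by (simp add: add_increasing2)
        next
          case False
          have "a powr v = a powr (v - v0) * a powr v0" by (simp flip: powr_add)
          also have "\<dots> \<le> \<kappa> powr (v - v0) * a powr v0"
            using False \<kappa> vv by (intro mult_right_mono powr_mono2') auto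
          finally show ?thesis by (simp add: add_increasing)
        qed
        have "(\<integral>\<^sup>+t. ennreal (\<bar>R t\<bar> powr v * w t) \<partial>unit_leb) \<le> (\<integral>\<^sup>+t. ennreal (\<kappa> powr v + \<kappa> powr (v - v0) * G t powr v0) \<partial>weight_measure W)"
        proof (rule R_le)
          show "(\<lambda>t. \<kappa> powr v + \<kappa> powr (v - v0) * G t powr v0) \<in> borel_measurable lebesgue" using G(1) by measurable
          show "AE x in unit_leb. \<bar>R x\<bar> powr v \<le> \<kappa> powr v + \<kappa> powr (v - v0) * G x powr v0"
            using G(3)
          proof eventually_elim
            case (elim x)
            have "\<bar>R x\<bar> powr v0 \<le> G x powr v0" using elim v vv by (intro powr_mono2) auto
            then have "\<kappa> powr (v - v0) * \<bar>R x\<bar> powr v0 \<le> \<kappa> powr (v - v0) * G x powr v0" by (rule mult_left_mono) simp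
            then show ?case using pw[of "\<bar>R x\<bar>"] by simp
          qed
        qed simp
        also have "\<dots> = (\<integral>\<^sup>+t. ennreal (\<kappa> powr v) + ennreal (\<kappa> powr (v - v0)) * ennreal (G t powr v0) \<partial>weight_measure W)"
          by (simp flip: ennreal_mult ennreal_plus)
        also have "\<dots> = ennreal (\<kappa> powr v) * ennreal \<mu> + ennreal (\<kappa> powr (v - v0)) * (\<integral>\<^sup>+t. ennreal (G t powr v0) \<partial>weight_measure W)"
          by (subst nn_integral_add) (auto simp: nn_integral_cmult \<mu>_def W.emeasure_eq_measure)
        also have "\<dots> \<le> ennreal (\<kappa> powr v) * ennreal \<mu> + ennreal (\<kappa> powr (v - v0)) * ennreal (\<kappa> powr v0)"
          by (intro add_left_mono mult_left_mono G(4)) simp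
        also have "\<dots> = ennreal (\<kappa> powr v * \<mu> + \<kappa> powr (v - v0) * \<kappa> powr v0)"
          by (simp add: \<mu>_def flip: ennreal_mult ennreal_plus)
        also have "\<kappa> powr v * \<mu> + \<kappa> powr (v - v0) * \<kappa> powr v0 = \<kappa> powr v * (\<mu> + 1)"
          by (simp add: algebra_simps flip: powr_add)
        finally have "ennpowr (ennreal (\<eta> powr \<theta>') * (\<integral>\<^sup>+t. ennreal (\<bar>R t\<bar> powr v * w t) \<partial>unit_leb)) (1 / v) \<le>
          ennreal ((\<eta> powr \<theta>' * (\<kappa> powr v * (\<mu> + 1))) powr (1 / v))"
          by (rule ennpowr_le_of_le) (use v in \<open>auto simp: \<mu>_def\<close>)
        also have "\<dots> \<le> ennreal (c * g)"
        proof (rule ennreal_leI)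
          have \<mu>0: "\<mu> \<ge> 0" by (simp add: \<mu>_def)
          have "(\<eta> powr \<theta>' * (\<kappa> powr v * (\<mu> + 1))) powr (1 / v) = \<eta> powr (\<theta>' / v) * (\<kappa> * (\<mu> + 1) powr (1 / v))"
            unfolding powr_mult powr_powr using v \<kappa> by simp
          also have "\<dots> \<le> q powr \<theta>' * (\<kappa> * (\<mu> + 1))"
          proof (intro mult_mono)
            have "\<eta> powr (\<theta>' / v) \<le> q powr (\<theta>' / v)" using \<eta> \<theta>'0 v by (intro powr_mono2) auto
            also have "\<dots> \<le> q powr \<theta>'" using q1 v \<theta>'0 by (intro powr_mono) (auto simp: field_simps)
            finally show "\<eta> powr (\<theta>' / v) \<le> q powr \<theta>'" .
            have "(\<mu> + 1) powr (1 / v) \<le> (\<mu> + 1) powr 1" using \<mu>0 v by (intro powr_mono) auto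
            then show "(\<mu> + 1) powr (1 / v) \<le> \<mu> + 1" using \<mu>0 by simp
          qed (use \<kappa> \<mu>0 in auto)
          also have "\<dots> = q powr \<theta>' * (\<mu> + 1) * C * \<tau> * g" by (simp add: \<kappa>_def)
          also have "\<dots> \<le> c * g" using g by (intro mult_right_mono) (auto simp: c_def)
          finally show "(\<eta> powr \<theta>' * (\<kappa> powr v * (\<mu> + 1))) powr (1 / v) \<le> c * g" .
        qed
        finally show ?thesis .
      qed
      then show "ennpowr (ennreal (\<eta> powr \<theta>') * (\<integral>\<^sup>+t. ennreal (\<bar>R t\<bar> powr (q - \<eta>) * w t) \<partial>unit_leb)) (1 / (q - \<eta>)) \<le> ennreal (c * g)"
        by (simp add: v_def)
    qed
    then show ?thesis using defined by (simp add: R_def)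
  qed
  show ?thesis
  proof (intro exI[of _ c] conjI ballI c)
    fix f assume f: "f \<in> grand_Lebesgue p \<theta> w"
    then obtain G where G: "grand_norm p \<theta> w f = ennreal G" "0 \<le> G"
      by (cases "grand_norm p \<theta> w f") (auto simp: grand_Lebesgue_def)
    show "riesz_potential_defined \<alpha> (\<lambda>y. f y * w y powr \<alpha>)"
      using main[OF f, of "G + 1"] G by (auto intro: ennreal_leI)
    show "grand_norm q (\<theta> * (1 + \<alpha> * q)) w (riesz_potential \<alpha> (\<lambda>y. f y * w y powr \<alpha>)) \<le> ennreal c * grand_norm p \<theta> w f"
    proof (rule ennreal_le_epsilon)
      fix e :: real assume e: "0 < e"
      have "grand_norm p \<theta> w f \<le> ennreal (G + e / c)" unfolding G using e c by (intro ennreal_leI) simp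
      moreover have "0 < G + e / c" using G e c by (simp add: add_nonneg_pos)
      ultimately have "grand_norm q \<theta>' w (riesz_potential \<alpha> (\<lambda>y. f y * w y powr \<alpha>)) \<le> ennreal (c * (G + e / c))"
        using main[OF f] by blast
      also have "c * (G + e / c) = c * G + e" using c by (simp add: field_simps)
      also have "ennreal (c * G + e) = ennreal c * grand_norm p \<theta> w f + ennreal e"
        unfolding G using c G(2) e by (simp add: ennreal_mult)
      finally show "grand_norm q (\<theta> * (1 + \<alpha> * q)) w (riesz_potential \<alpha> (\<lambda>y. f y * w y powr \<alpha>)) \<le> ennreal c * grand_norm p \<theta> w f + ennreal e"
        by (simp add: \<theta>'_def)
    qed
  qed
qed

section \<open>Necessity of the Muckenhoupt condition\<close>

text \<open>
  With \<open>\<tau> = min \<sigma> n\<close> on \<open>J = (a, b)\<close>, where \<open>\<sigma>\<close> is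
  the dual weight, the test function is \<open>f = \<tau> * w powr - \<alpha>\<close>: then \<open>f
  w\<^sup>\<alpha> = \<tau>\<close>, and \<open>f\<^sup>p w \<le> \<tau>\<close> because \<open>w powr (1 -
  \<alpha> p) = \<sigma> powr - (p - 1)\<close>. The truncation makes \<open>S\<close>, the integral of
  \<open>\<tau>\<close>, finite before anything is known about the integrability of \<open>\<sigma>\<close>.
  The supremum \<open>Y\<close> of the numbers \<open>y \<eta>\<close> is the norm of the indicator of
  \<open>J\<close> in the target space; it occurs on both sides and cancels.
\<close>

lemma truncated_dual_weight_test:
  fixes p \<alpha> \<theta> q c a b n :: real
  assumes p: "1 < p" and \<alpha>: "0 < \<alpha>" "\<alpha> * p < 1" and \<theta>: "0 < \<theta>" and q: "q = p / (1 - \<alpha> * p)"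
    and w: "weight w" and r: "r = 1 + (p - 1) / (1 - \<alpha> * p)" and c: "0 < c"
    and ineq: "\<forall>f \<in> grand_Lebesgue p \<theta> w.
        riesz_potential_defined \<alpha> (\<lambda>y. f y * w y powr \<alpha>) \<and>
        grand_norm q (\<theta> * (1 + \<alpha> * q)) w (riesz_potential \<alpha> (\<lambda>y. f y * w y powr \<alpha>))
          \<le> ennreal c * grand_norm p \<theta> w f"
    and K: "1 \<le> K" and Kc: "\<And>u. 1 < u \<Longrightarrow> u < p \<Longrightarrow>
      (p - u) powr (\<theta> / u) \<le> K * (q - u / (1 - \<alpha> * u)) powr (\<theta> * (1 + \<alpha> * q) / (u / (1 - \<alpha> * u)))"
    and ab: "0 \<le> a" "a < b" "b \<le> 1" and n: "0 < n"
    and S: "(\<integral>\<^sup>+x. ennreal (min (positive_version w x powr (- 1 / (r - 1))) n * indicator {a<..<b} x) \<partial>lebesgue) = ennreal S" "0 < S"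
  shows "measure (weight_measure (positive_version w)) {a<..<b} * S powr (r - 1) \<le> (c * K) powr q * (b - a) powr r"
proof -
  define W where "W = positive_version w"
  have W [measurable]: "W \<in> borel_measurable lebesgue" and W0: "\<And>x. 0 < W x"
    using positive_version_measurable[OF w] positive_version_pos by (simp_all add: W_def)
  have finW: "finite_measure (weight_measure W)" using finite_weight_measure[OF w] by (simp add: W_def)
  interpret W: finite_measure "weight_measure W" by fact
  define J where "J = {a<..<b}"
  have J [measurable]: "J \<in> sets lebesgue" and J': "J \<in> sets (weight_measure W)" by (simp_all add: J_def)
  have J01: "J \<subseteq> {0..1}" using ab by (auto simp: J_def)
  define m where "m = measure (weight_measure W) J"
  have m: "0 < m" unfolding m_def J_def by (rule measure_weight_measure_interval_pos[OF W W0 finW ab])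
  define D where "D = b - a"
  have D: "0 < D" using ab by (simp add: D_def)
  define \<sigma> where "\<sigma> x = W x powr (- 1 / (r - 1))" for x
  have \<sigma> [measurable]: "\<sigma> \<in> borel_measurable lebesgue" unfolding \<sigma>_def by measurable
  have \<sigma>0: "0 < \<sigma> x" for x using W0[of x] by (simp add: \<sigma>_def)
  define \<tau> where "\<tau> x = min (\<sigma> x) n * indicator J x" for x
  have \<tau> [measurable]: "\<tau> \<in> borel_measurable lebesgue" unfolding \<tau>_def by measurable
  have \<tau>0: "0 \<le> \<tau> x" for x using \<sigma>0[of x] n by (auto simp: \<tau>_def indicator_def)
  have \<tau>S: "(\<integral>\<^sup>+x. ennreal (\<tau> x) \<partial>lebesgue) = ennreal S"
    using S(1) by (simp add: \<tau>_def \<sigma>_def W_def J_def)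
  define f where "f x = \<tau> x * W x powr - \<alpha>" for x
  have f [measurable]: "f \<in> borel_measurable lebesgue" unfolding f_def by measurable
  have f0: "0 \<le> f x" for x using \<tau>0[of x] by (simp add: f_def)
  have fJ: "x \<notin> J \<Longrightarrow> f x = 0" for x by (simp add: f_def \<tau>_def)
  have f_unit: "f \<in> borel_measurable unit_leb" by (rule measurable_restrict_space1[OF f])
  have f_\<mu> [measurable]: "f \<in> borel_measurable (weight_measure W)" using f by (simp cong: measurable_cong_sets)
  have den: "0 < 1 - \<alpha> * p" using \<alpha> by simp
  have rm1: "r - 1 = (p - 1) / (1 - \<alpha> * p)" by (simp add: r)
  have r1: "0 < r - 1" using p den by (simp add: rm1)
  have q1: "q > 1"
  proof -
    have "0 < \<alpha> * p" using p \<alpha> by simp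
    then have "1 - \<alpha> * p < p" using p by linarith
    then show ?thesis using den by (simp add: q)
  qed
  have iq: "1 / q = 1 / p - \<alpha>" using p den by (simp add: q field_simps)
  define \<theta>' where "\<theta>' = \<theta> * (1 + \<alpha> * q)"
  have \<theta>'0: "0 < \<theta>'" using \<theta> \<alpha> q1 by (simp add: \<theta>'_def add_pos_pos)
  have \<alpha>1: "\<alpha> < 1" using p \<alpha> mult_strict_left_mono[of 1 p \<alpha>] by linarith

  have fp: "W x * f x powr p \<le> \<tau> x" for x
  proof (cases "x \<in> J")
    case True
    then have t: "0 < \<tau> x" "\<tau> x \<le> \<sigma> x" using \<sigma>0[of x] n by (auto simp: \<tau>_def)
    have "W x powr (1 - \<alpha> * p) = \<sigma> x powr - (p - 1)"
    proof -
      have "- 1 / (r - 1) * - (p - 1) = 1 - \<alpha> * p" using p den by (simp add: rm1 divide_simps) (simp add: algebra_simps)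
      then show ?thesis by (simp only: \<sigma>_def powr_powr)
    qed
    moreover have "W x * f x powr p = \<tau> x powr p * W x powr (1 - \<alpha> * p)"
    proof -
      have "W x * f x powr p = \<tau> x powr p * (W x powr 1 * W x powr (- \<alpha> * p))"
        using W0[of x] by (simp add: f_def powr_mult powr_powr)
      also have "W x powr 1 * W x powr (- \<alpha> * p) = W x powr (1 - \<alpha> * p)"
        unfolding powr_add[symmetric] by simp
      finally show ?thesis .
    qed
    ultimately have "W x * f x powr p = \<tau> x powr p * \<sigma> x powr - (p - 1)" by simp
    also have "\<dots> \<le> \<tau> x powr p * \<tau> x powr - (p - 1)"
      using t p by (intro mult_left_mono powr_mono2') auto
    also have "\<dots> = \<tau> x" using t by (simp flip: powr_add)
    finally show ?thesis .
  qed (use fJ \<tau>0 in auto)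
  have Ifp: "(\<integral>\<^sup>+x. ennreal (f x powr p) \<partial>weight_measure W) \<le> ennreal S"
  proof -
    have "(\<integral>\<^sup>+x. ennreal (f x powr p) \<partial>weight_measure W) = (\<integral>\<^sup>+x. ennreal (W x) * indicator {0..1} x * ennreal (f x powr p) \<partial>lebesgue)"
      by (rule nn_integral_weight_measure) measurable
    also have "\<dots> \<le> (\<integral>\<^sup>+x. ennreal (\<tau> x) \<partial>lebesgue)"
      using fp W0[THEN less_imp_le] by (intro nn_integral_mono) (auto simp: indicator_def ennreal_leI simp flip: ennreal_mult)
    finally show ?thesis by (simp add: \<tau>S)
  qed

  define y where "y \<eta> = (\<eta> powr \<theta>' * m) powr (1 / (q - \<eta>))" for \<eta>
  define Y where "Y = (SUP \<eta>\<in>{0<..<q - 1}. y \<eta>)"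
  have y0: "0 < y \<eta>" if "\<eta> \<in> {0<..<q - 1}" for \<eta> using that m by (simp add: y_def)
  have bdd: "bdd_above (y ` {0<..<q - 1})"
  proof (rule bdd_aboveI2)
    fix \<eta> assume \<eta>: "\<eta> \<in> {0<..<q - 1}"
    have "y \<eta> \<le> (max 1 (q powr \<theta>' * m)) powr (1 / (q - \<eta>))"
      unfolding y_def using \<eta> m \<theta>'0
      by (intro powr_mono2) (auto intro!: max.coboundedI2 mult_right_mono powr_mono2)
    also have "\<dots> \<le> (max 1 (q powr \<theta>' * m)) powr 1" using \<eta> by (intro powr_mono) auto
    finally show "y \<eta> \<le> max 1 (q powr \<theta>' * m)" by simp
  qed
  have yY: "y \<eta> \<le> Y" if "\<eta> \<in> {0<..<q - 1}" for \<eta> unfolding Y_def using that bdd by (rule cSUP_upper)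
  have ne: "{0<..<q - 1} \<noteq> {}" using q1 by simp
  then obtain \<eta>0 where "\<eta>0 \<in> {0<..<q - 1}" by blast
  then have Y: "0 < Y" using y0 yY by (meson less_le_trans)

  define Z where "Z = K * Y * (S powr (1 / p) * m powr - (1 / q))"
  have Z0: "0 \<le> Z" using K Y by (simp add: Z_def)
  have gp: "grand_norm p \<theta> w f \<le> ennreal Z"
    unfolding grand_norm_def
  proof (rule SUP_least)
    fix \<epsilon> assume \<epsilon>: "\<epsilon> \<in> {0<..<p - 1}"
    define u where "u = p - \<epsilon>"
    have u: "1 < u" "u < p" using \<epsilon> by (auto simp: u_def)
    have "\<alpha> * u < \<alpha> * p" using u \<alpha> by simp
    then have au: "\<alpha> * u < 1" "0 < \<alpha> * u" using \<alpha> u by (linarith, simp)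
    define v where "v = u / (1 - \<alpha> * u)"
    have v1: "1 < v"
    proof -
      have "1 - \<alpha> * u < u" using au u by linarith
      then show ?thesis using au by (simp add: v_def)
    qed
    have vq: "v < q"
    proof -
      have "u / (1 - \<alpha> * u) < p / (1 - \<alpha> * u)" using u au by (simp add: divide_strict_right_mono)
      also have "\<dots> \<le> p / (1 - \<alpha> * p)" using \<open>\<alpha> * u < \<alpha> * p\<close> p den by (intro divide_left_mono) auto
      finally show ?thesis by (simp add: v_def q)
    qed
    define k where "k = p / u"
    have k: "1 < k" "1 / k + 1 / (k / (k - 1)) = 1" "1 < k / (k - 1)" using u by (auto simp: k_def field_simps)
    define B where "B = S powr (1 / k) * m powr (1 / (k / (k - 1)))"
    have "(\<integral>\<^sup>+t. ennreal (\<bar>f t\<bar> powr u * w t) \<partial>unit_leb) = (\<integral>\<^sup>+t. ennreal (f t powr u) \<partial>weight_measure W)"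
      using nn_integral_unit_leb_weight[OF w, of "\<lambda>t. f t powr u"] f0 by (simp add: W_def)
    also have "\<dots> = (\<integral>\<^sup>+t. ennreal (f t powr u * indicator J t) \<partial>weight_measure W)"
      using fJ u by (intro nn_integral_cong) (auto simp: indicator_def)
    also have "\<dots> \<le> ennreal B"
      unfolding B_def
    proof (rule nn_integral_Hoelder)
      show "(\<integral>\<^sup>+x. ennreal ((f x powr u) powr k) \<partial>weight_measure W) \<le> ennreal S"
        using Ifp u by (simp add: powr_powr k_def)
      have "(\<integral>\<^sup>+x. ennreal (indicator J x powr (k / (k - 1))) \<partial>weight_measure W) = (\<integral>\<^sup>+x. indicator J x \<partial>weight_measure W)"
        using k by (intro nn_integral_cong) (auto simp: indicator_def)
      then show "(\<integral>\<^sup>+x. ennreal (indicator J x powr (k / (k - 1))) \<partial>weight_measure W) \<le> ennreal m"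
        using J' by (simp add: m_def W.emeasure_eq_measure)
    qed (use k S m J' in auto)
    finally have "ennpowr (ennreal (\<epsilon> powr \<theta>) * (\<integral>\<^sup>+t. ennreal (\<bar>f t\<bar> powr u * w t) \<partial>unit_leb)) (1 / u) \<le>
      ennreal ((\<epsilon> powr \<theta> * B) powr (1 / u))"
      by (rule ennpowr_le_of_le) (use u in \<open>auto simp: B_def\<close>)
    \<comment> \<open>Since \<open>1/u - 1/p = 1/v - 1/q\<close>, the factor \<open>m powr (1/v)\<close> of \<open>y (q - v)\<close> splits off below.\<close>
    also have "(\<epsilon> powr \<theta> * B) powr (1 / u) = \<epsilon> powr (\<theta> / u) * (S powr (1 / p) * m powr (1 / u - 1 / p))"
    proof -
      have "1 / k * (1 / u) = 1 / p" "1 / (k / (k - 1)) * (1 / u) = 1 / u - 1 / p"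
        using u by (auto simp: k_def field_simps)
      then show ?thesis unfolding B_def powr_mult powr_powr by simp
    qed
    also have "\<dots> \<le> Z"
    proof -
      have "1 / u - 1 / p = 1 / v + - (1 / q)"
        using u au by (simp add: iq v_def field_simps)
      then have e: "m powr (1 / u - 1 / p) = m powr (1 / v) * m powr - (1 / q)" by (simp only: powr_add)
      have "q - v \<in> {0<..<q - 1}" using v1 vq by simp
      then have "y (q - v) \<le> Y" by (rule yY)
      moreover have "y (q - v) = (q - v) powr (\<theta>' / v) * m powr (1 / v)"
        by (simp add: y_def powr_mult powr_powr)
      ultimately have yle: "(q - v) powr (\<theta>' / v) * m powr (1 / v) \<le> Y" by simp
      have "\<epsilon> powr (\<theta> / u) \<le> K * (q - v) powr (\<theta>' / v)"
        using Kc[OF u] by (simp add: u_def v_def \<theta>'_def)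
      then have "\<epsilon> powr (\<theta> / u) * m powr (1 / v) \<le> K * (q - v) powr (\<theta>' / v) * m powr (1 / v)"
        by (rule mult_right_mono) simp
      also have "\<dots> \<le> K * Y" using mult_left_mono[OF yle, of K] K by (simp add: mult.assoc)
      finally have "\<epsilon> powr (\<theta> / u) * m powr (1 / v) * (S powr (1 / p) * m powr - (1 / q)) \<le> Z"
        unfolding Z_def by (rule mult_right_mono) simp
      then show ?thesis unfolding e by (simp only: mult_ac)
    qed
    finally show "ennpowr (ennreal (\<epsilon> powr \<theta>) * (\<integral>\<^sup>+t. ennreal (\<bar>f t\<bar> powr (p - \<epsilon>) * w t) \<partial>unit_leb)) (1 / (p - \<epsilon>)) \<le> ennreal Z"
      by (simp add: u_def ennreal_leI)
  qed
  then have fg: "f \<in> grand_Lebesgue p \<theta> w"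
    using f_unit le_less_trans[OF gp ennreal_less_top] by (simp add: grand_Lebesgue_def)
  define R where "R = riesz_potential \<alpha> (\<lambda>y. f y * w y powr \<alpha>)"
  have int: "AE x in unit_leb. integrable unit_leb (\<lambda>y. f y * w y powr \<alpha> / \<bar>x - y\<bar> powr (1 - \<alpha>))"
    using ineq fg unfolding riesz_potential_defined_def by blast
  have gq: "grand_norm q \<theta>' w R \<le> ennreal (c * Z)"
  proof -
    have "grand_norm q \<theta>' w R \<le> ennreal c * grand_norm p \<theta> w f" using ineq fg by (simp add: R_def \<theta>'_def)
    also have "\<dots> \<le> ennreal c * ennreal Z" by (rule mult_left_mono[OF gp]) simp
    finally show ?thesis using c Z0 by (simp add: ennreal_mult)
  qed
  \<comment> \<open>On \<open>J\<close> the kernel is at least \<open>D powr (\<alpha> - 1)\<close>, so the potential is at least \<open>L\<close>.\<close>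
  define L where "L = D powr (\<alpha> - 1) * S"
  have L0: "0 < L" using D S by (simp add: L_def)
  have \<tau>_unit [measurable]: "\<tau> \<in> borel_measurable unit_leb" by (rule measurable_restrict_space1[OF \<tau>])
  have \<tau>_nn: "(\<integral>\<^sup>+x. ennreal (\<tau> x) \<partial>unit_leb) = ennreal S"
  proof -
    have "(\<integral>\<^sup>+x. ennreal (\<tau> x) \<partial>unit_leb) = (\<integral>\<^sup>+x. ennreal (\<tau> x) * indicator {0..1} x \<partial>lebesgue)"
      by (rule nn_integral_restrict_space) simp
    also have "\<dots> = (\<integral>\<^sup>+x. ennreal (\<tau> x) \<partial>lebesgue)"
      using J01 by (intro nn_integral_cong) (auto simp: \<tau>_def indicator_def)
    finally show ?thesis by (simp add: \<tau>S)
  qed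
  have \<tau>_int: "integrable unit_leb \<tau>" by (rule integrableI_nonneg) (use \<tau>0 \<tau>_nn in auto)
  have \<tau>_LINT: "(LINT x|unit_leb. \<tau> x) = S"
    using \<tau>_nn S(2) \<tau>0 by (subst integral_eq_nn_integral) auto
  have R_low: "AE x in unit_leb. x \<in> J \<longrightarrow> L \<le> R x"
    using int
  proof eventually_elim
    case (elim x)
    show ?case
    proof
      assume x: "x \<in> J"
      have "AE y in lebesgue. y \<noteq> x" by (rule AE_completion[OF AE_lborel_singleton])
      then have "AE y in unit_leb. y \<noteq> x" unfolding AE_unit_leb_iff by eventually_elim simp
      then have "AE y in unit_leb. \<tau> y * D powr (\<alpha> - 1) \<le> f y * w y powr \<alpha> / \<bar>x - y\<bar> powr (1 - \<alpha>)"
        using AE_positive_version[OF w]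
      proof eventually_elim
        case (elim y)
        have fw: "f y * w y powr \<alpha> = \<tau> y"
          using elim W0[of y] by (simp add: f_def W_def powr_minus)
        show ?case
        proof (cases "y \<in> J")
          case True
          then have d: "0 < \<bar>x - y\<bar>" "\<bar>x - y\<bar> \<le> D" using x elim by (auto simp: J_def D_def)
          have "\<bar>x - y\<bar> powr (1 - \<alpha>) \<le> D powr (1 - \<alpha>)" using d \<alpha>1 by (intro powr_mono2) auto
          then have "\<tau> y / D powr (1 - \<alpha>) \<le> \<tau> y / \<bar>x - y\<bar> powr (1 - \<alpha>)"
            using \<tau>0[of y] d D by (intro divide_left_mono) auto
          moreover have "D powr (\<alpha> - 1) = 1 / D powr (1 - \<alpha>)" using powr_minus_divide[of D "1 - \<alpha>"] by simp
          ultimately show ?thesis unfolding fw by simp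
        next
          case False
          then have "\<tau> y = 0" by (simp add: \<tau>_def)
          then show ?thesis unfolding fw by simp
        qed
      qed
      then have "(LINT y|unit_leb. \<tau> y * D powr (\<alpha> - 1)) \<le> R x"
        unfolding R_def riesz_potential_def using \<tau>_int elim by (intro integral_mono_AE) auto
      then show "L \<le> R x" using \<tau>_LINT by (simp add: L_def mult.commute)
    qed
  qed
  have yL: "y \<eta> * L \<le> c * Z" if \<eta>: "\<eta> \<in> {0<..<q - 1}" for \<eta>
  proof -
    define v where "v = q - \<eta>"
    have v: "1 < v" using \<eta> by (auto simp: v_def)
    have "ennreal (L powr v * m) = (\<integral>\<^sup>+t. ennreal (L powr v) * indicator J t \<partial>weight_measure W)"
      using J' by (simp add: nn_integral_cmult m_def W.emeasure_eq_measure ennreal_mult)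
    also have "\<dots> = (\<integral>\<^sup>+t. ennreal (L powr v * indicator J t) \<partial>weight_measure W)"
      by (intro nn_integral_cong) (auto simp: indicator_def)
    also have "\<dots> = (\<integral>\<^sup>+t. ennreal (L powr v * indicator J t * w t) \<partial>unit_leb)"
      unfolding W_def by (rule nn_integral_unit_leb_weight[OF w, symmetric]) auto
    also have "\<dots> \<le> (\<integral>\<^sup>+t. ennreal (\<bar>R t\<bar> powr v * w t) \<partial>unit_leb)"
    proof (rule nn_integral_mono_AE)
      have "AE x in unit_leb. 0 < w x" using w by (simp add: weight_def)
      then show "AE t in unit_leb. ennreal (L powr v * indicator J t * w t) \<le> ennreal (\<bar>R t\<bar> powr v * w t)"
        using R_low
      proof eventually_elim
        case (elim t)
        have "L powr v * indicator J t \<le> \<bar>R t\<bar> powr v"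
          using elim L0 v by (cases "t \<in> J") (auto intro!: powr_mono2)
        then show ?case using elim by (auto intro!: ennreal_leI mult_right_mono)
      qed
    qed
    finally have "ennreal ((\<eta> powr \<theta>' * (L powr v * m)) powr (1 / v)) \<le>
      ennpowr (ennreal (\<eta> powr \<theta>') * (\<integral>\<^sup>+t. ennreal (\<bar>R t\<bar> powr v * w t) \<partial>unit_leb)) (1 / v)"
      by (rule ennpowr_ge_of_ge) (use v m in auto)
    also have "\<dots> \<le> grand_norm q \<theta>' w R"
      unfolding grand_norm_def v_def by (rule SUP_upper) (use \<eta> in auto)
    also note gq
    finally have "(\<eta> powr \<theta>' * (L powr v * m)) powr (1 / v) \<le> c * Z" using c Z0 by simp
    moreover have "(\<eta> powr \<theta>' * (L powr v * m)) powr (1 / v) = y \<eta> * L"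
      using v L0 unfolding y_def v_def[symmetric] powr_mult powr_powr by (simp add: mult_ac)
    ultimately show ?thesis by simp
  qed
  have "Y \<le> c * Z / L"
    unfolding Y_def by (rule cSUP_least[OF ne]) (use yL L0 in \<open>simp add: pos_le_divide_eq\<close>)
  then have "Y * L \<le> c * Z" using L0 by (simp add: pos_le_divide_eq)
  then have "Y * L \<le> Y * (c * K * (S powr (1 / p) * m powr - (1 / q)))" by (simp add: Z_def mult_ac)
  then have "L \<le> c * K * (S powr (1 / p) * m powr - (1 / q))" using Y by simp
  then have "L * (S powr - (1 / p) * m powr (1 / q) * D powr (1 - \<alpha>)) \<le>
      c * K * (S powr (1 / p) * m powr - (1 / q)) * (S powr - (1 / p) * m powr (1 / q) * D powr (1 - \<alpha>))"
    by (rule mult_right_mono) simp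
  also have "L * (S powr - (1 / p) * m powr (1 / q) * D powr (1 - \<alpha>)) =
      (S powr 1 * S powr - (1 / p)) * m powr (1 / q) * (D powr (\<alpha> - 1) * D powr (1 - \<alpha>))"
    using S(2) by (simp add: L_def mult_ac)
  also have "\<dots> = S powr (1 - 1 / p) * m powr (1 / q)"
    unfolding powr_add[symmetric] using D by simp
  also have "c * K * (S powr (1 / p) * m powr - (1 / q)) * (S powr - (1 / p) * m powr (1 / q) * D powr (1 - \<alpha>)) =
      c * K * ((S powr (1 / p) * S powr - (1 / p)) * (m powr - (1 / q) * m powr (1 / q))) * D powr (1 - \<alpha>)"
    by (simp only: mult_ac)
  also have "\<dots> = c * K * D powr (1 - \<alpha>)" using S(2) m by (simp flip: powr_add)
  finally have "(S powr (1 - 1 / p) * m powr (1 / q)) powr q \<le> (c * K * D powr (1 - \<alpha>)) powr q"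
    using q1 by (intro powr_mono2) auto
  moreover have "(S powr (1 - 1 / p) * m powr (1 / q)) powr q = m * S powr (r - 1)"
  proof -
    have "(1 - 1 / p) * q = r - 1" "1 / q * q = 1" using p den q1 by (auto simp: rm1 q field_simps)
    then show ?thesis unfolding powr_mult powr_powr using m by simp
  qed
  moreover have "(c * K * D powr (1 - \<alpha>)) powr q = (c * K) powr q * D powr r"
  proof -
    have "(1 - \<alpha>) * q = r" using p den by (simp add: r q field_simps)
    then show ?thesis unfolding powr_mult powr_powr by simp
  qed
  ultimately show ?thesis by (simp add: m_def J_def D_def W_def)
qed

text \<open>
  The bound for the truncations does not depend on \<open>n\<close>; monotone convergence gives it for the
  dual weight itself, in particular its integrability.
\<close>

lemma Ap_condition_if_grand_inequality:
  fixes p \<alpha> \<theta> q c :: real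
  assumes p: "1 < p" and \<alpha>: "0 < \<alpha>" "\<alpha> * p < 1" and \<theta>: "0 < \<theta>" and q: "q = p / (1 - \<alpha> * p)"
    and w: "weight w" and r: "r = 1 + (p - 1) / (1 - \<alpha> * p)" and c: "0 < c"
    and ineq: "\<forall>f \<in> grand_Lebesgue p \<theta> w.
        riesz_potential_defined \<alpha> (\<lambda>y. f y * w y powr \<alpha>) \<and>
        grand_norm q (\<theta> * (1 + \<alpha> * q)) w (riesz_potential \<alpha> (\<lambda>y. f y * w y powr \<alpha>))
          \<le> ennreal c * grand_norm p \<theta> w f"
  shows "\<exists>A. Ap_condition (positive_version w) r A"
proof -
  define W where "W = positive_version w"
  have W [measurable]: "W \<in> borel_measurable lebesgue" and W0: "\<And>x. 0 < W x"
    using positive_version_measurable[OF w] positive_version_pos by (simp_all add: W_def)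
  have finW: "finite_measure (weight_measure W)" using finite_weight_measure[OF w] by (simp add: W_def)
  define \<sigma> where "\<sigma> = (\<lambda>x. W x powr (- 1 / (r - 1)))"
  have \<sigma> [measurable]: "\<sigma> \<in> borel_measurable lebesgue" unfolding \<sigma>_def by measurable
  have \<sigma>0: "0 < \<sigma> x" for x using W0[of x] by (simp add: \<sigma>_def)
  have r1: "0 < r - 1" using p \<alpha> by (simp add: r)
  obtain K where K: "1 \<le> K" and Kc: "\<And>u. 1 < u \<Longrightarrow> u < p \<Longrightarrow>
      (p - u) powr (\<theta> / u) \<le> K * (q - u / (1 - \<alpha> * u)) powr (\<theta> * (1 + \<alpha> * q) / (u / (1 - \<alpha> * u)))"
    by (rule exponent_comparison[OF p \<alpha> \<theta> q]) blast
  define A where "A = (c * K) powr q"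
  have A: "A > 0" using c K by (simp add: A_def)
  have em: "emeasure (weight_measure \<sigma>) {a<..<b} \<le> ennreal ((A * (b - a) powr r / measure (weight_measure W) {a<..<b}) powr (1 / (r - 1)))"
    if ab: "0 \<le> a" "a < b" "b \<le> 1" for a b
  proof -
    define m where "m = measure (weight_measure W) {a<..<b}"
    have m: "0 < m" unfolding m_def by (rule measure_weight_measure_interval_pos[OF W W0 finW ab])
    define T where "T = (A * (b - a) powr r / m) powr (1 / (r - 1))"
    have [measurable]: "{a<..<b} \<in> sets lebesgue" by simp
    have trunc: "(\<integral>\<^sup>+x. ennreal (min (\<sigma> x) (real (Suc n)) * indicator {a<..<b} x) \<partial>lebesgue) \<le> ennreal T" for n
    proof -
      define I where "I = (\<integral>\<^sup>+x. ennreal (min (\<sigma> x) (real (Suc n)) * indicator {a<..<b} x) \<partial>lebesgue)"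
      have "I \<le> (\<integral>\<^sup>+x. ennreal (real (Suc n)) * indicator {a<..<b} x \<partial>lebesgue)"
        unfolding I_def by (intro nn_integral_mono) (auto simp: indicator_def simp del: of_nat_Suc intro!: ennreal_leI)
      also have "\<dots> = ennreal (real (Suc n)) * ennreal (b - a)" using ab by (simp add: nn_integral_cmult)
      also have "\<dots> < top" by (simp add: ennreal_mult_less_top)
      finally obtain S where S: "I = ennreal S" "0 \<le> S" by (cases I) auto
      show ?thesis
      proof (cases "S = 0")
        case True then show ?thesis using S by (simp add: I_def)
      next
        case False
        then have S0: "0 < S" using S by simp
        have "m * S powr (r - 1) \<le> A * (b - a) powr r"
          unfolding m_def A_def W_def
          by (rule truncated_dual_weight_test[OF p \<alpha> \<theta> q w r c ineq K Kc ab _ _ S0, of "real (Suc n)"])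
             (use S in \<open>simp_all add: I_def \<sigma>_def W_def\<close>)
        then have "S powr (r - 1) \<le> A * (b - a) powr r / m" using m by (simp add: pos_le_divide_eq mult.commute)
        then have "(S powr (r - 1)) powr (1 / (r - 1)) \<le> T" unfolding T_def using r1 by (intro powr_mono2) auto
        then have "S \<le> T" using r1 S0 by (simp add: powr_powr)
        then show ?thesis using S by (simp add: I_def ennreal_leI)
      qed
    qed
    have "emeasure (weight_measure \<sigma>) {a<..<b} = (\<integral>\<^sup>+x. ennreal (\<sigma> x) * indicator {0..1} x * indicator {a<..<b} x \<partial>lebesgue)"
      by (rule emeasure_weight_measure) auto
    also have "\<dots> \<le> (\<integral>\<^sup>+x. (SUP n. ennreal (min (\<sigma> x) (real (Suc n)) * indicator {a<..<b} x)) \<partial>lebesgue)"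
    proof (rule nn_integral_mono)
      fix x
      obtain n where n: "\<sigma> x \<le> real n" using real_arch_simple by blast
      have "ennreal (\<sigma> x) * indicator {0..1} x * indicator {a<..<b} x \<le> ennreal (min (\<sigma> x) (real (Suc n)) * indicator {a<..<b} x)"
        using n by (auto simp: indicator_def min_def)
      also have "\<dots> \<le> (SUP n. ennreal (min (\<sigma> x) (real (Suc n)) * indicator {a<..<b} x))" by (rule SUP_upper) simp
      finally show "ennreal (\<sigma> x) * indicator {0..1} x * indicator {a<..<b} x \<le> \<dots>" .
    qed
    also have "\<dots> = (SUP n. \<integral>\<^sup>+x. ennreal (min (\<sigma> x) (real (Suc n)) * indicator {a<..<b} x) \<partial>lebesgue)"
    proof (rule nn_integral_monotone_convergence_SUP)
      show "incseq (\<lambda>n x. ennreal (min (\<sigma> x) (real (Suc n)) * indicator {a<..<b} x))"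
        by (intro incseq_SucI le_funI ennreal_leI mult_right_mono) auto
    qed measurable
    also have "\<dots> \<le> ennreal T" by (rule SUP_least) (rule trunc)
    finally show ?thesis by (simp add: T_def m_def)
  qed
  have fin\<sigma>: "finite_measure (weight_measure \<sigma>)"
    using le_less_trans[OF em[of 0 1] ennreal_less_top] by (intro finite_measure_weight_measure_if_interval[OF \<sigma>]) simp
  interpret \<sigma>: finite_measure "weight_measure \<sigma>" by fact
  have "Ap_condition W r A"
    unfolding Ap_condition_def \<sigma>_def[symmetric]
  proof (intro conjI allI impI fin\<sigma>)
    fix a b :: real assume ab: "0 \<le> a" "a < b" "b \<le> 1"
    define m where "m = measure (weight_measure W) {a<..<b}"
    have m: "0 < m" unfolding m_def by (rule measure_weight_measure_interval_pos[OF W W0 finW ab])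
    define X where "X = A * (b - a) powr r / m"
    have X: "0 \<le> X" using A m by (simp add: X_def)
    have "measure (weight_measure \<sigma>) {a<..<b} \<le> X powr (1 / (r - 1))"
      using em[OF ab] unfolding \<sigma>.emeasure_eq_measure m_def[symmetric] X_def[symmetric] by simp
    then have "measure (weight_measure \<sigma>) {a<..<b} powr (r - 1) \<le> (X powr (1 / (r - 1))) powr (r - 1)"
      using r1 by (intro powr_mono2) auto
    also have "\<dots> = X" using r1 X by (simp add: powr_powr)
    finally have "m * measure (weight_measure \<sigma>) {a<..<b} powr (r - 1) \<le> m * X" using m by simp
    also have "m * X = A * (b - a) powr r" using m by (simp add: X_def)
    finally show "measure (weight_measure W) {a<..<b} * measure (weight_measure \<sigma>) {a<..<b} powr (r - 1) \<le> A * (b - a) powr r"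
      by (simp add: m_def)
  qed
  then show ?thesis unfolding W_def by blast
qed

section \<open>The characterization\<close>

theorem theorem3p1:
  fixes p \<alpha> \<theta> q :: real and w :: "real \<Rightarrow> real"
  assumes "1 < p" and "0 < \<alpha>" and "\<alpha> < 1 / p" and "0 < \<theta>"
    and "q = p / (1 - \<alpha> * p)"
    and "weight w"
  shows "(\<exists>c::real. 0 < c \<and>
      (\<forall>f \<in> grand_Lebesgue p \<theta> w.
        riesz_potential_defined \<alpha> (\<lambda>y. f y * w y powr \<alpha>) \<and>
        grand_norm q (\<theta> * (1 + \<alpha> * q)) w (riesz_potential \<alpha> (\<lambda>y. f y * w y powr \<alpha>))
          \<le> ennreal c * grand_norm p \<theta> w f))
    \<longleftrightarrow> w \<in> Muckenhoupt (1 + q / conj_exponent p)"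
proof -
  have \<alpha>p: "\<alpha> * p < 1" using assms(1,3) by (simp add: pos_less_divide_eq)
  have r: "1 + q / conj_exponent p = 1 + (p - 1) / (1 - \<alpha> * p)"
    using assms(1) \<alpha>p by (simp add: assms(5) conj_exponent_def)
  have r1: "1 < 1 + (p - 1) / (1 - \<alpha> * p)" using assms(1) \<alpha>p by simp
  show ?thesis
    unfolding r Muckenhoupt_iff_Ap_condition[OF assms(6) r1]
    using grand_inequality_if_Ap_condition[OF assms(1,2) \<alpha>p assms(4-6) refl]
      Ap_condition_if_grand_inequality[OF assms(1,2) \<alpha>p assms(4-6) refl]
    by blast
qed

end
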